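(* Let the truth solution $\boldsymbol u_d^0,\dots,\boldsymbol u_d^M\in\boldsymbol X^d$ be as in the context, and suppose that for $1\le r\le d$ its projection $P_r(\boldsymbol u_d^n)$ satisfies the filtered equations (LES) in the context. Let $\boldsymbol u_r^0,\dots,\boldsymbol u_r^M\in\boldsymbol X^r$ be the solution of the DD-VMS-ROM (with linear ansatz defined by the matrix $\widetilde{\boldsymbol A}$ and with the physical constraint $\boldsymbol a^\top\widetilde{\boldsymbol A}\boldsymbol a\le 0$ for all $\boldsymbol a\in\mathbb R^r$) with initial condition $\boldsymbol u_r^0=P_r(\boldsymbol u_d^0)$. Set $\boldsymbol e^n=P_r(\boldsymbol u_d^n)-\boldsymbol u_r^n$ and $$d_j=\frac{27\,(Re)^3\,C(\Omega)^4}{16}\,\|\nabla P_r(\boldsymbol u_d^j)\|^4+Re ,\qquad j=1,\dots,M .$$ If the time step is small enough that $\Delta t\,d_j<1$ for all $j=1,\dots,M$, then for all $n=1,\dots,M$ $$\|\boldsymbol e^{n}\|^2+\Delta t\sum_{j=1}^{n}Re^{-1}\|\nabla\boldsymbol e^{j}\|^2\;\le\;\exp\Big(\Delta t\sum_{j=1}^{n}\frac{d_j}{1-\Delta t\,d_j}\Big)\Big(\Delta t\sum_{j=1}^{n}Re^{-1}\big\|P_r\big(\boldsymbol\tau^{FOM}(\boldsymbol u_d^j)-\boldsymbol\tau^{ROM}(P_r(\boldsymbol u_d^j))\big)\big\|^2\Big).$$ In particular, when for every $r\le d$ the projection $P_r(\boldsymbol u_d^n)$ satisfies the filtered equations (LES)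 in the context, $\boldsymbol u_r^0,\dots,\boldsymbol u_r^M\in\boldsymbol X^r$ is the solution of the DD-VMS-ROM (with linear ansatz defined by $\widetilde{\boldsymbol A}$ and with the physical constraint $\boldsymbol a^\top\widetilde{\boldsymbol A}\boldsymbol a\le 0$ for all $\boldsymbol a\in\mathbb R^r$) with initial condition $\boldsymbol u_r^0=P_r(\boldsymbol u_d^0)$, and the time step condition $\Delta t\,d_j<1$ holds for all $j=1,\dots,M$ (with $d_j$, which depends on $r$ through $P_r$, formed for that $r$), the DD-VMS-ROM is verifiable in the sense defined in the context.
   Context: Setting. $\Omega\subset\mathbb R^q$, $q\in\{2,3\}$, is an open bounded set of class $C^2$; $(\cdot,\cdot)$ and $\|\cdot\|$ are the $L^2(\Omega)$ inner product and norm (of scalar, vector or matrix fields); $Re>0$ is the Reynolds number, $\Delta t>0$ the time step, $M$ a fixed positive integer (number of time steps/snapshots), and $\boldsymbol f^n$, $n=1,\dots,M$, given forcing terms. Homogeneous Dirichlet boundary conditions are used. $C(\Omega)>0$ is a constant such that, with $b(\boldsymbol u,\boldsymbol v,\boldsymbol w):=(\boldsymbol u\cdot\nabla\boldsymbol v,\boldsymbol w)$, $$b(\boldsymbol u,\boldsymbol v,\boldsymbol w)\le C(\Omega)\sqrt{\|\boldsymbol u\|\,\|\nabla\boldsymbol u\|}\,\|\nabla\boldsymbol v\|\,\|\nabla\boldsymbol w\|\qquad\text{for all }\boldsymbol u,\boldsymbol v,\boldsymbol w\in[H_0^1(\Omega)]^q$$ (such a constant is known to exist). ROM spaces. $\boldsymbol\varphi_1,\dots,\boldsymbol\varphi_d\in[H_0^1(\Omega)]^q$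 is a fixed $L^2$-orthonormal family of divergence-free functions (the reduced basis; $d$ is the number of linearly independent snapshots and is fixed). For $1\le r\le d$, $\boldsymbol X^r=\mathrm{span}\{\boldsymbol\varphi_1,\dots,\boldsymbol\varphi_r\}$ and $P_r(\boldsymbol u)=\sum_{i=1}^r(\boldsymbol u,\boldsymbol\varphi_i)\boldsymbol\varphi_i$ is the $L^2$-orthogonal projection onto $\boldsymbol X^r$. Since $\boldsymbol X^r$ consists of divergence-free fields vanishing on the boundary, $b(\boldsymbol v,\boldsymbol w,\boldsymbol w)=0$ for $\boldsymbol v,\boldsymbol w\in\boldsymbol X^r$. Truth solution. $\boldsymbol u_d^n=\sum_{i=1}^d(\boldsymbol a_d^n)_i\boldsymbol\varphi_i\in\boldsymbol X^d$, $n=0,\dots,M$, is the fixed solution of the $d$-dimensional Galerkin ROM: for $n=1,\dots,M$ and all $\boldsymbol v_d\in\boldsymbol X^d$, $$\Big(\tfrac{\boldsymbol u_d^n-\boldsymbol u_d^{n-1}}{\Delta t},\boldsymbol v_d\Big)+Re^{-1}(\nabla\boldsymbol u_d^n,\nabla\boldsymbol v_d)+(\boldsymbol u_d^n\cdot\nabla\boldsymbol u_d^n,\boldsymbol v_d)=(\boldsymbol f^n,\boldsymbol v_d).$$ Put $\boldsymbol\tau^{FOM}(\boldsymbol u_d^n)=\boldsymbol u_d^n\cdot\nabla\boldsymbol u_d^n-P_r(\boldsymbol u_d^n)\cdot\nabla P_r(\boldsymbol u_d^n)$. Filtered equations (LES). The commutation error $Re^{-1}(\nabla(\boldsymbol u_d^n-P_r(\boldsymbol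 u_d^n)),\nabla\boldsymbol v_r)$, $\boldsymbol v_r\in\boldsymbol X^r$, is not considered (taken to be zero), so that $P_r(\boldsymbol u_d^n)$ satisfies, for $n=1,\dots,M$ and all $\boldsymbol v_r\in\boldsymbol X^r$, $$\Big(\tfrac{P_r(\boldsymbol u_d^n)-P_r(\boldsymbol u_d^{n-1})}{\Delta t},\boldsymbol v_r\Big)+Re^{-1}(\nabla P_r(\boldsymbol u_d^n),\nabla\boldsymbol v_r)+(P_r(\boldsymbol u_d^n)\cdot\nabla P_r(\boldsymbol u_d^n),\boldsymbol v_r)+(\boldsymbol\tau^{FOM}(\boldsymbol u_d^n),\boldsymbol v_r)=(\boldsymbol f^n,\boldsymbol v_r).\quad\text{(LES)}$$ DD-VMS-ROM (data-driven variational multiscale reduced order model). For given $r$, let $\boldsymbol b_r^n\in\mathbb R^r$ be the vector of the first $r$ entries of $\boldsymbol a_d^n$, and let $\widetilde{\boldsymbol A}\in\mathbb R^{r\times r}$ be a solution of the least squares problem $$\min_{\widetilde{\boldsymbol A}}\sum_{n=1}^M\Big\|-\big[(\boldsymbol\tau^{FOM}(\boldsymbol u_d^n),\boldsymbol\varphi_i)\big]_{i=1,\dots,r}-\widetilde{\boldsymbol A}\,\boldsymbol b_r^n\Big\|^2$$ (Euclidean norm in $\mathbb R^r$) subject to the physical constraint $\boldsymbol a^\top\widetilde{\boldsymbol A}\boldsymbol a\le0$ for all $\boldsymbol a\in\mathbb R^r$. The closure model $\boldsymbol\tau^{ROM}$ is given by the linear ansatz: for $\boldsymbol v=\sum_{i=1}^r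 a_i\boldsymbol\varphi_i\in\boldsymbol X^r$ with coefficient vector $\boldsymbol a$, $(\boldsymbol\tau^{ROM}(\boldsymbol v),\boldsymbol\varphi_i)=-(\widetilde{\boldsymbol A}\boldsymbol a)_i$ for $i=1,\dots,r$ (that is, $\boldsymbol\tau^{ROM}(\boldsymbol v)=-\sum_{i=1}^r(\widetilde{\boldsymbol A}\boldsymbol a)_i\boldsymbol\varphi_i$). The DD-VMS-ROM solution $\boldsymbol u_r^n\in\boldsymbol X^r$ satisfies, for $n=1,\dots,M$ and all $\boldsymbol v_r\in\boldsymbol X^r$, $$\Big(\tfrac{\boldsymbol u_r^n-\boldsymbol u_r^{n-1}}{\Delta t},\boldsymbol v_r\Big)+Re^{-1}(\nabla\boldsymbol u_r^n,\nabla\boldsymbol v_r)+(\boldsymbol u_r^n\cdot\nabla\boldsymbol u_r^n,\boldsymbol v_r)+(\boldsymbol\tau^{ROM}(\boldsymbol u_r^n),\boldsymbol v_r)=(\boldsymbol f^n,\boldsymbol v_r).$$ Verifiability. With $M$ and $d$ fixed, a ROM closure model is verifiable (in the $L^2$ norm) if there is a constant $C$ such that for all $r\le d$ and all $n=1,\dots,M$, $$\|P_r(\boldsymbol u_d^n)-\boldsymbol u_r^n\|^2\le C\,\frac1n\sum_{j=1}^n\big\|P_r\big(\boldsymbol\tau^{FOM}(\boldsymbol u_d^j)-\boldsymbol\tau^{ROM}(P_r(\boldsymbol u_d^j))\big)\big\|^2 ,$$ where $C$ may depend on the fixed data ($\Omega$, $Re$, $\boldsymbol f$, $\Delta t$,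 $M$, $d$, the basis $\boldsymbol\varphi_1,\dots,\boldsymbol\varphi_d$, the truth solution) but not on $r$ or on the ROM solution $\boldsymbol u_r$. *)

theory Defs
  imports "HOL-Analysis.Analysis"
begin

section \<open>Differentiability classes, test functions, domains of class C2\<close>

text \<open>\<open>Ck k f\<close>: \<open>f\<close> is of class \<open>C\<^sup>k\<close> on the whole space.\<close>

fun Ck :: "nat \<Rightarrow> ('a::euclidean_space \<Rightarrow> real) \<Rightarrow> bool" where
  "Ck 0 f \<longleftrightarrow> continuous_on UNIV f"
| "Ck (Suc k) f \<longleftrightarrow> (\<forall>x. f differentiable (at x)) \<and>
     (\<forall>b\<in>Basis. Ck k (\<lambda>x. frechet_derivative f (at x) b))"

text \<open>Near each boundary point, \<open>\<Omega>\<close> is the part strictly above the graph of a \<open>C\<^sup>2\<close> function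
  in a rotated coordinate system whose last axis is \<open>\<nu>\<close>. A function of the remaining \<open>q - 1\<close>
  coordinates is encoded as a function on the whole space that is constant along \<open>\<nu>\<close>.\<close>

definition C2_domain :: "(real ^ 'q) set \<Rightarrow> bool" where
  "C2_domain \<Omega> \<longleftrightarrow>
     (\<forall>x\<^sub>0\<in>frontier \<Omega>. \<exists>\<rho>>0. \<exists>\<nu> \<gamma>. norm \<nu> = 1 \<and> Ck 2 \<gamma> \<and> (\<forall>x t. \<gamma> (x + t *\<^sub>R \<nu>) = \<gamma> x) \<and>
        \<Omega> \<inter> ball x\<^sub>0 \<rho> = {x \<in> ball x\<^sub>0 \<rho>. \<gamma> x < x \<bullet> \<nu>})"

definition test_function :: "(real ^ 'q) set \<Rightarrow> (real ^ 'q \<Rightarrow> real) \<Rightarrow> bool" where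
  "test_function \<Omega> \<psi> \<longleftrightarrow>
     (\<forall>k. Ck k \<psi>) \<and> compact (closure {x. \<psi> x \<noteq> 0}) \<and> closure {x. \<psi> x \<noteq> 0} \<subseteq> \<Omega>"

definition test_field :: "(real ^ 'q) set \<Rightarrow> (real ^ 'q \<Rightarrow> real ^ 'q) \<Rightarrow> bool" where
  "test_field \<Omega> \<psi> \<longleftrightarrow> (\<forall>i. test_function \<Omega> (\<lambda>x. \<psi> x $ i))"


section \<open>Lebesgue and Sobolev spaces\<close>

text \<open>Elements of \<open>L\<^sup>2(\<Omega>)\<close> are handled through representatives defined on the whole space; only
  their values on \<open>\<Omega>\<close> matter. On \<open>real ^ 'q ^ 'q\<close> the inner product is the Frobenius one.\<close>

definition L2 :: "(real ^ 'q) set \<Rightarrow> (real ^ 'q \<Rightarrow> 'b::euclidean_space) set" where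
  "L2 \<Omega> = {u. u \<in> borel_measurable (lebesgue_on \<Omega>) \<and>
              integrable (lebesgue_on \<Omega>) (\<lambda>x. (norm (u x))\<^sup>2)}"

definition l2_inner ::
  "(real ^ 'q) set \<Rightarrow> (real ^ 'q \<Rightarrow> 'b::euclidean_space) \<Rightarrow> (real ^ 'q \<Rightarrow> 'b) \<Rightarrow> real" where
  "l2_inner \<Omega> u v = integral\<^sup>L (lebesgue_on \<Omega>) (\<lambda>x. u x \<bullet> v x)"

definition l2_norm :: "(real ^ 'q) set \<Rightarrow> (real ^ 'q \<Rightarrow> 'b::euclidean_space) \<Rightarrow> real" where
  "l2_norm \<Omega> u = sqrt (l2_inner \<Omega> u u)"

text \<open>Convention for gradients: \<open>G x $ i $ j\<close> is the weak derivative of the \<open>i\<close>-th component of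
  \<open>u\<close> in the direction of the \<open>j\<close>-th coordinate.\<close>

definition is_weak_grad ::
  "(real ^ 'q) set \<Rightarrow> (real ^ 'q \<Rightarrow> real ^ 'q) \<Rightarrow> (real ^ 'q \<Rightarrow> real ^ 'q ^ 'q) \<Rightarrow> bool" where
  "is_weak_grad \<Omega> u G \<longleftrightarrow>
     (\<forall>\<psi>. test_function \<Omega> \<psi> \<longrightarrow> (\<forall>i j.
        integral\<^sup>L (lebesgue_on \<Omega>) (\<lambda>x. u x $ i * frechet_derivative \<psi> (at x) (axis j 1)) =
        - integral\<^sup>L (lebesgue_on \<Omega>) (\<lambda>x. G x $ i $ j * \<psi> x)))"

definition H1 :: "(real ^ 'q) set \<Rightarrow> (real ^ 'q \<Rightarrow> real ^ 'q) set" where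
  "H1 \<Omega> = {u \<in> L2 \<Omega>. \<exists>G\<in>L2 \<Omega>. is_weak_grad \<Omega> u G}"

text \<open>A representative of the weak gradient, which is determined up to a null set for
  \<open>u \<in> H1 \<Omega>\<close>.\<close>

definition wgrad :: "(real ^ 'q) set \<Rightarrow> (real ^ 'q \<Rightarrow> real ^ 'q) \<Rightarrow> real ^ 'q \<Rightarrow> real ^ 'q ^ 'q" where
  "wgrad \<Omega> u = (SOME G. G \<in> L2 \<Omega> \<and> is_weak_grad \<Omega> u G)"

definition h1_norm :: "(real ^ 'q) set \<Rightarrow> (real ^ 'q \<Rightarrow> real ^ 'q) \<Rightarrow> real" where
  "h1_norm \<Omega> u = sqrt ((l2_norm \<Omega> u)\<^sup>2 + (l2_norm \<Omega> (wgrad \<Omega> u))\<^sup>2)"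

text \<open>The closure of the test fields in \<open>H1\<close>.\<close>

definition H10 :: "(real ^ 'q) set \<Rightarrow> (real ^ 'q \<Rightarrow> real ^ 'q) set" where
  "H10 \<Omega> = {u \<in> H1 \<Omega>. \<forall>\<epsilon>>0. \<exists>\<psi>. test_field \<Omega> \<psi> \<and> h1_norm \<Omega> (\<lambda>x. u x - \<psi> x) < \<epsilon>}"

definition divergence_free :: "(real ^ 'q) set \<Rightarrow> (real ^ 'q \<Rightarrow> real ^ 'q) \<Rightarrow> bool" where
  "divergence_free \<Omega> u \<longleftrightarrow> (AE x in lebesgue_on \<Omega>. (\<Sum>i\<in>UNIV. wgrad \<Omega> u x $ i $ i) = 0)"

text \<open>\<open>u \<cdot> \<nabla>v\<close>, with \<open>i\<close>-th component \<open>\<Sum>j. u\<^sub>j \<partial>\<^sub>j v\<^sub>i\<close>. For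
  \<open>u, v \<in> H10 \<Omega>\<close> it need not be square integrable, but its product with any \<open>w \<in> H10 \<Omega>\<close> is
  integrable if \<open>q \<le> 3\<close>, since \<open>H10 \<Omega>\<close> then embeds into \<open>L\<^sup>4\<close>; all pairings with it below are of
  this kind.\<close>

definition convect ::
  "(real ^ 'q) set \<Rightarrow> (real ^ 'q \<Rightarrow> real ^ 'q) \<Rightarrow> (real ^ 'q \<Rightarrow> real ^ 'q) \<Rightarrow> real ^ 'q \<Rightarrow> real ^ 'q" where
  "convect \<Omega> u v = (\<lambda>x. wgrad \<Omega> v x *v u x)"

definition trilinear_b ::
  "(real ^ 'q) set \<Rightarrow> (real ^ 'q \<Rightarrow> real ^ 'q) \<Rightarrow> (real ^ 'q \<Rightarrow> real ^ 'q) \<Rightarrow> (real ^ 'q \<Rightarrow> real ^ 'q)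
   \<Rightarrow> real" where
  "trilinear_b \<Omega> u v w = l2_inner \<Omega> (convect \<Omega> u v) w"


section \<open>Reduced order model spaces\<close>

text \<open>Basis functions and coefficients are indexed from 1; entries beyond the stated dimension
  are irrelevant.\<close>

definition rom_field ::
  "(nat \<Rightarrow> real ^ 'q \<Rightarrow> real ^ 'q) \<Rightarrow> nat \<Rightarrow> (nat \<Rightarrow> real) \<Rightarrow> real ^ 'q \<Rightarrow> real ^ 'q" where
  "rom_field \<phi> r a = (\<lambda>x. \<Sum>i=1..r. a i *\<^sub>R \<phi> i x)"

definition rom_space ::
  "(nat \<Rightarrow> real ^ 'q \<Rightarrow> real ^ 'q) \<Rightarrow> nat \<Rightarrow> (real ^ 'q \<Rightarrow> real ^ 'q) set" where
  "rom_space \<phi> r = range (rom_field \<phi> r)"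

definition rom_coeffs ::
  "(nat \<Rightarrow> real ^ 'q \<Rightarrow> real ^ 'q) \<Rightarrow> nat \<Rightarrow> (real ^ 'q \<Rightarrow> real ^ 'q) \<Rightarrow> nat \<Rightarrow> real" where
  "rom_coeffs \<phi> r v = (THE a. (\<forall>i. i \<notin> {1..r} \<longrightarrow> a i = 0) \<and> v = rom_field \<phi> r a)"

definition rom_proj ::
  "(real ^ 'q) set \<Rightarrow> (nat \<Rightarrow> real ^ 'q \<Rightarrow> real ^ 'q) \<Rightarrow> nat
   \<Rightarrow> (real ^ 'q \<Rightarrow> real ^ 'q) \<Rightarrow> real ^ 'q \<Rightarrow> real ^ 'q" where
  "rom_proj \<Omega> \<phi> r u = rom_field \<phi> r (\<lambda>i. l2_inner \<Omega> u (\<phi> i))"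


section \<open>Truth solution and filtered equations\<close>

text \<open>The terms common to all discrete equations at time step \<open>n\<close>, tested with \<open>v\<close>; \<open>Rey\<close> is the
  Reynolds number.\<close>

definition navier_stokes_form ::
  "(real ^ 'q) set \<Rightarrow> real \<Rightarrow> real \<Rightarrow> (nat \<Rightarrow> real ^ 'q \<Rightarrow> real ^ 'q) \<Rightarrow> nat
   \<Rightarrow> (real ^ 'q \<Rightarrow> real ^ 'q) \<Rightarrow> real" where
  "navier_stokes_form \<Omega> Rey dt u n v =
     l2_inner \<Omega> (\<lambda>x. (u n x - u (n - 1) x) /\<^sub>R dt) v
     + inverse Rey * l2_inner \<Omega> (wgrad \<Omega> (u n)) (wgrad \<Omega> v)
     + l2_inner \<Omega> (convect \<Omega> (u n) (u n)) v"

definition truth_solution ::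
  "(real ^ 'q) set \<Rightarrow> real \<Rightarrow> real \<Rightarrow> nat \<Rightarrow> (nat \<Rightarrow> real ^ 'q \<Rightarrow> real ^ 'q)
   \<Rightarrow> (nat \<Rightarrow> real ^ 'q \<Rightarrow> real ^ 'q) \<Rightarrow> nat
   \<Rightarrow> (nat \<Rightarrow> nat \<Rightarrow> real) \<Rightarrow> (nat \<Rightarrow> real ^ 'q \<Rightarrow> real ^ 'q) \<Rightarrow> bool" where
  "truth_solution \<Omega> Rey dt M f \<phi> d ad ud \<longleftrightarrow>
     (\<forall>n\<le>M. ud n = rom_field \<phi> d (ad n)) \<and>
     (\<forall>n\<in>{1..M}. \<forall>v\<in>rom_space \<phi> d. navier_stokes_form \<Omega> Rey dt ud n v = l2_inner \<Omega> (f n) v)"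

definition tau_fom ::
  "(real ^ 'q) set \<Rightarrow> (nat \<Rightarrow> real ^ 'q \<Rightarrow> real ^ 'q) \<Rightarrow> nat
   \<Rightarrow> (real ^ 'q \<Rightarrow> real ^ 'q) \<Rightarrow> real ^ 'q \<Rightarrow> real ^ 'q" where
  "tau_fom \<Omega> \<phi> r u =
     (\<lambda>x. convect \<Omega> u u x - convect \<Omega> (rom_proj \<Omega> \<phi> r u) (rom_proj \<Omega> \<phi> r u) x)"

definition filtered_equations ::
  "(real ^ 'q) set \<Rightarrow> real \<Rightarrow> real \<Rightarrow> nat \<Rightarrow> (nat \<Rightarrow> real ^ 'q \<Rightarrow> real ^ 'q)
   \<Rightarrow> (nat \<Rightarrow> real ^ 'q \<Rightarrow> real ^ 'q) \<Rightarrow> (nat \<Rightarrow> real ^ 'q \<Rightarrow> real ^ 'q) \<Rightarrow> nat \<Rightarrow> bool" where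
  "filtered_equations \<Omega> Rey dt M f \<phi> ud r \<longleftrightarrow>
     (\<forall>n\<in>{1..M}. \<forall>v\<in>rom_space \<phi> r.
        navier_stokes_form \<Omega> Rey dt (\<lambda>k. rom_proj \<Omega> \<phi> r (ud k)) n v
        + l2_inner \<Omega> (tau_fom \<Omega> \<phi> r (ud n)) v = l2_inner \<Omega> (f n) v)"


section \<open>The data-driven variational multiscale model\<close>

text \<open>Since the dimension \<open>r\<close> varies, matrices are functions of two indices in \<open>{1..r}\<close>.\<close>

definition mat_vec :: "nat \<Rightarrow> (nat \<Rightarrow> nat \<Rightarrow> real) \<Rightarrow> (nat \<Rightarrow> real) \<Rightarrow> nat \<Rightarrow> real" where
  "mat_vec r A a i = (\<Sum>j=1..r. A i j * a j)"

definition physical_constraint :: "nat \<Rightarrow> (nat \<Rightarrow> nat \<Rightarrow> real) \<Rightarrow> bool" where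
  "physical_constraint r A \<longleftrightarrow> (\<forall>a. (\<Sum>i=1..r. a i * mat_vec r A a i) \<le> 0)"

definition least_squares_objective ::
  "(real ^ 'q) set \<Rightarrow> nat \<Rightarrow> (nat \<Rightarrow> real ^ 'q \<Rightarrow> real ^ 'q) \<Rightarrow> (nat \<Rightarrow> nat \<Rightarrow> real)
   \<Rightarrow> (nat \<Rightarrow> real ^ 'q \<Rightarrow> real ^ 'q) \<Rightarrow> nat \<Rightarrow> (nat \<Rightarrow> nat \<Rightarrow> real) \<Rightarrow> real" where
  "least_squares_objective \<Omega> M \<phi> ad ud r A =
     (\<Sum>n=1..M. \<Sum>i=1..r. (- l2_inner \<Omega> (tau_fom \<Omega> \<phi> r (ud n)) (\<phi> i) - mat_vec r A (ad n) i)\<^sup>2)"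

definition tau_rom ::
  "(nat \<Rightarrow> real ^ 'q \<Rightarrow> real ^ 'q) \<Rightarrow> nat \<Rightarrow> (nat \<Rightarrow> nat \<Rightarrow> real)
   \<Rightarrow> (real ^ 'q \<Rightarrow> real ^ 'q) \<Rightarrow> real ^ 'q \<Rightarrow> real ^ 'q" where
  "tau_rom \<phi> r A v = rom_field \<phi> r (\<lambda>i. - mat_vec r A (rom_coeffs \<phi> r v) i)"

definition rom_solution ::
  "(real ^ 'q) set \<Rightarrow> real \<Rightarrow> real \<Rightarrow> nat \<Rightarrow> (nat \<Rightarrow> real ^ 'q \<Rightarrow> real ^ 'q)
   \<Rightarrow> (nat \<Rightarrow> real ^ 'q \<Rightarrow> real ^ 'q) \<Rightarrow> nat
   \<Rightarrow> ((real ^ 'q \<Rightarrow> real ^ 'q) \<Rightarrow> real ^ 'q \<Rightarrow> real ^ 'q) \<Rightarrow> (nat \<Rightarrow> real ^ 'q \<Rightarrow> real ^ 'q) \<Rightarrow> bool" where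
  "rom_solution \<Omega> Rey dt M f \<phi> r \<tau> u \<longleftrightarrow>
     (\<forall>n\<le>M. u n \<in> rom_space \<phi> r) \<and>
     (\<forall>n\<in>{1..M}. \<forall>v\<in>rom_space \<phi> r.
        navier_stokes_form \<Omega> Rey dt u n v + l2_inner \<Omega> (\<tau> (u n)) v = l2_inner \<Omega> (f n) v)"

definition dd_vms_rom ::
  "(real ^ 'q) set \<Rightarrow> real \<Rightarrow> real \<Rightarrow> nat \<Rightarrow> (nat \<Rightarrow> real ^ 'q \<Rightarrow> real ^ 'q)
   \<Rightarrow> (nat \<Rightarrow> real ^ 'q \<Rightarrow> real ^ 'q) \<Rightarrow> (nat \<Rightarrow> nat \<Rightarrow> real) \<Rightarrow> (nat \<Rightarrow> real ^ 'q \<Rightarrow> real ^ 'q) \<Rightarrow> nat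
   \<Rightarrow> (nat \<Rightarrow> nat \<Rightarrow> real) \<Rightarrow> (nat \<Rightarrow> real ^ 'q \<Rightarrow> real ^ 'q) \<Rightarrow> bool" where
  "dd_vms_rom \<Omega> Rey dt M f \<phi> ad ud r A u \<longleftrightarrow>
     is_arg_min (least_squares_objective \<Omega> M \<phi> ad ud r) (physical_constraint r) A \<and>
     rom_solution \<Omega> Rey dt M f \<phi> r (tau_rom \<phi> r A) u \<and>
     u 0 = rom_proj \<Omega> \<phi> r (ud 0)"


section \<open>Verifiability\<close>

definition closure_error ::
  "(real ^ 'q) set \<Rightarrow> (nat \<Rightarrow> real ^ 'q \<Rightarrow> real ^ 'q) \<Rightarrow> nat
   \<Rightarrow> ((real ^ 'q \<Rightarrow> real ^ 'q) \<Rightarrow> real ^ 'q \<Rightarrow> real ^ 'q) \<Rightarrow> (real ^ 'q \<Rightarrow> real ^ 'q) \<Rightarrow> real" where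
  "closure_error \<Omega> \<phi> r \<tau> u =
     l2_norm \<Omega> (rom_proj \<Omega> \<phi> r (\<lambda>x. tau_fom \<Omega> \<phi> r u x - \<tau> (rom_proj \<Omega> \<phi> r u) x))"

text \<open>A closure model is given as a relation \<open>model r \<tau> u\<close>: at dimension \<open>r\<close> the model has the
  closure term \<open>\<tau>\<close> and \<open>u\<close> is a solution of the corresponding reduced order model. The constant
  is chosen before \<open>r\<close>, \<open>\<tau>\<close> and \<open>u\<close>.\<close>

definition verifiable ::
  "(real ^ 'q) set \<Rightarrow> nat \<Rightarrow> (nat \<Rightarrow> real ^ 'q \<Rightarrow> real ^ 'q) \<Rightarrow> nat \<Rightarrow> (nat \<Rightarrow> real ^ 'q \<Rightarrow> real ^ 'q)
   \<Rightarrow> (nat \<Rightarrow> ((real ^ 'q \<Rightarrow> real ^ 'q) \<Rightarrow> real ^ 'q \<Rightarrow> real ^ 'q)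
        \<Rightarrow> (nat \<Rightarrow> real ^ 'q \<Rightarrow> real ^ 'q) \<Rightarrow> bool) \<Rightarrow> bool" where
  "verifiable \<Omega> M \<phi> d ud model \<longleftrightarrow>
     (\<exists>C. \<forall>r\<in>{1..d}. \<forall>\<tau> u. model r \<tau> u \<longrightarrow>
        (\<forall>n\<in>{1..M}. (l2_norm \<Omega> (\<lambda>x. rom_proj \<Omega> \<phi> r (ud n) x - u n x))\<^sup>2
           \<le> C * (1 / real n * (\<Sum>j=1..n. (closure_error \<Omega> \<phi> r \<tau> (ud j))\<^sup>2))))"

definition gronwall_coeff ::
  "(real ^ 'q) set \<Rightarrow> real \<Rightarrow> real \<Rightarrow> (nat \<Rightarrow> real ^ 'q \<Rightarrow> real ^ 'q)
   \<Rightarrow> (nat \<Rightarrow> real ^ 'q \<Rightarrow> real ^ 'q) \<Rightarrow> nat \<Rightarrow> nat \<Rightarrow> real" where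
  "gronwall_coeff \<Omega> Rey C\<^sub>\<Omega> \<phi> ud r j =
     27 * Rey ^ 3 * C\<^sub>\<Omega> ^ 4 / 16 * (l2_norm \<Omega> (wgrad \<Omega> (rom_proj \<Omega> \<phi> r (ud j)))) ^ 4 + Rey"

end

theory Submission
  imports Defs
begin

text \<open>Subtracting the reduced order model from the filtered equations and testing with the error
  \<open>e\<close> leaves three terms. The convective one is \<open>b(e, P u, e) + b(u\<^sub>r, e, e)\<close>; its second part
  vanishes, its first part is absorbed by the viscous term through Young's inequality. The linear
  closure gives \<open>e \<cdot> A e \<le> 0\<close> plus the closure error paired with \<open>e\<close>. A discrete Gronwall
  argument with \<open>e 0 = 0\<close> concludes, and the constants for the finitely many \<open>r\<close> are summed.

  The analytic work is to justify splitting \<open>b\<close>, since an integral that does not exist is \<open>0\<close> by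
  convention. The integrals exist because \<open>H10\<close> embeds into \<open>L\<^sup>4\<close> for \<open>q \<le> 3\<close>, by Ladyzhenskaya's
  inequality for test functions and Fatou's lemma. Skew-symmetry holds for test fields by testing
  the weak divergence, and extends to \<open>H10\<close> by the assumed bound on \<open>b\<close>. Linearity of the
  chosen weak gradient rests on its uniqueness, which needs smooth functions approximating the
  indicators of boxes.\<close>

section \<open>Smooth bump functions\<close>

text \<open>Two conventions create most of the work. \<open>wgrad\<close> is an arbitrary choice
  among weak gradients, so not even \<open>wgrad\<close> of a sum is literally a sum: identities
  hold almost everywhere and must pass through an integral. And the convective term need not lie in
  L2, so it is paired with the basis functions one at a time, after integrability of each pairing.

  The bound on b is one-sided, so signs are moved into an argument: \<open>b(e, P u, - e)\<close>
  controls the first convective part from below, and \<open>b(- u, e, e) \<le> 0\<close> replaces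
  the equation \<open>b(u, e, e) = 0\<close>.

  The constants come from testing the equation and then doubling it. Half of the viscous term is
  spent on Young's inequality with exponents 4/3 and 4, which leaves 27/32; doubling gives 27/16.
  Young's inequality with weight \<open>Rey\<close> for the closure error gives the summand
  \<open>Rey\<close> in d_j and the factor \<open>inverse Rey\<close> on the right. Backward Euler
  places d_j on the current error, whence the condition that dt d_j be below 1 and the quotients d_j
  / (1 - dt d_j).\<close>

lemma Ck_Suc_imp_Ck: "Ck (Suc k) f \<Longrightarrow> Ck k f"
proof (induction k arbitrary: f)
  case 0
  then show ?case
    by (auto simp: continuous_on_eq_continuous_at intro: differentiable_imp_continuous_within)
next
  case (Suc k)
  have "\<forall>x. f differentiable (at x)" using Suc.prems by simp
  moreover have "Ck k (\<lambda>x. frechet_derivative f (at x) b)" if "b \<in> Basis" for b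
    by (rule Suc.IH) (use Suc.prems that in simp)
  ultimately show ?case by simp
qed

lemma Ck_imp_continuous_on: "Ck k f \<Longrightarrow> continuous_on A f"
proof (induction k)
  case 0
  then show ?case by (auto intro: continuous_on_subset)
next
  case (Suc k)
  then show ?case using Ck_Suc_imp_Ck by blast
qed

lemma Ck_const: "Ck k (\<lambda>x. c)"
  by (induction k arbitrary: c) (auto simp: frechet_derivative_const)

lemma Ck_add: "Ck k f \<Longrightarrow> Ck k g \<Longrightarrow> Ck k (\<lambda>x. f x + g x)"
proof (induction k arbitrary: f g)
  case 0
  then show ?case by (auto intro: continuous_on_add)
next
  case (Suc k)
  have "frechet_derivative (\<lambda>x. f x + g x) (at x)
      = (\<lambda>b. frechet_derivative f (at x) b + frechet_derivative g (at x) b)" for x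
    using Suc.prems by (intro frechet_derivative_at[symmetric])
      (auto intro!: has_derivative_add simp: frechet_derivative_works[symmetric])
  then show ?case using Suc by (auto intro: differentiable_add)
qed

lemma Ck_mult: "Ck k f \<Longrightarrow> Ck k g \<Longrightarrow> Ck k (\<lambda>x. f x * g x)"
proof (induction k arbitrary: f g)
  case 0
  then show ?case by (auto intro: continuous_on_mult)
next
  case (Suc k)
  have "frechet_derivative (\<lambda>x. f x * g x) (at x)
      = (\<lambda>b. f x * frechet_derivative g (at x) b + frechet_derivative f (at x) b * g x)" for x
    using Suc.prems by (intro frechet_derivative_at[symmetric])
      (auto intro!: has_derivative_mult simp: frechet_derivative_works[symmetric])
  \<comment> \<open>The product rule leaves one factor undifferentiated, so both factors are also
    needed at the lower level.\<close>
  then show ?case using Suc Ck_Suc_imp_Ck[OF Suc.prems(1)] Ck_Suc_imp_Ck[OF Suc.prems(2)]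
    by (auto intro!: Ck_add differentiable_mult)
qed

lemma Ck_prod: "finite I \<Longrightarrow> (\<And>i. i \<in> I \<Longrightarrow> Ck k (f i)) \<Longrightarrow> Ck k (\<lambda>x. \<Prod>i\<in>I. f i x)"
  by (induction I rule: finite_induct) (auto intro: Ck_const Ck_mult)

text \<open>The factor p(1/t) makes this family closed under differentiation, so that smoothness of
  every order is a single induction with p arbitrary. \<open>flat 1\<close> is the classical smooth
  function exp(-1/t), extended by zero.\<close>

definition flat :: "real poly \<Rightarrow> real \<Rightarrow> real" where
  "flat p t = (if t > 0 then poly p (1 / t) * exp (- (1 / t)) else 0)"

lemma tendsto_poly_times_exp_minus: "((\<lambda>s::real. poly p s * exp (- s)) \<longlongrightarrow> 0) at_top"
proof -
  have "((\<lambda>s::real. \<Sum>i\<le>degree p. coeff p i * (s ^ i / exp s)) \<longlongrightarrow> (\<Sum>i\<le>degree p. coeff p i * 0)) at_top"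
    by (intro tendsto_intros tendsto_power_div_exp_0)
  then show ?thesis
    by (simp add: poly_altdef sum_distrib_right exp_minus divide_inverse mult.assoc)
qed

text \<open>Put s = 1/t, so that ds/dt = - s^2: the derivative of p(s) exp(-s) is s^2 (p(s) - p'(s))
  exp(-s), and \<open>[:0, 0, 1:]\<close> is s^2. At the origin exponential decay beats every
  polynomial in s.\<close>

lemma DERIV_flat:
  "(flat p has_real_derivative flat ([:0, 0, 1:] * (p - pderiv p)) t) (at t)"
proof -
  consider "t > 0" | "t < 0" | "t = 0" by linarith
  then show ?thesis
  proof cases
    case 1
    have "((\<lambda>t. poly p (1 / t) * exp (- (1 / t))) has_real_derivative
        flat ([:0, 0, 1:] * (p - pderiv p)) t) (at t)"
      using 1 by (auto intro!: derivative_eq_intros poly_DERIV[THEN DERIV_chain2]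
          simp: flat_def field_simps power2_eq_square)
    then show ?thesis
      by (rule has_field_derivative_transform_within_open[where S = "{0<..}"])
        (use 1 in \<open>auto simp: flat_def\<close>)
  next
    case 2
    have "((\<lambda>t. 0) has_real_derivative flat ([:0, 0, 1:] * (p - pderiv p)) t) (at t)"
      using 2 by (auto simp: flat_def)
    then show ?thesis
      by (rule has_field_derivative_transform_within_open[where S = "{..<0}"])
        (use 2 in \<open>auto simp: flat_def\<close>)
  next
    case 3
    have "((\<lambda>h. flat p h / h) \<longlongrightarrow> 0) (at_right 0)"
    proof -
      \<comment> \<open>Division by h is one more factor s = 1/h, which is the polynomial
        \<open>[:0, 1:]\<close>.\<close>
      have "((\<lambda>h::real. poly ([:0, 1:] * p) (inverse h) * exp (- inverse h)) \<longlongrightarrow> 0) (at_right 0)"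
        by (rule filterlim_compose[OF tendsto_poly_times_exp_minus filterlim_inverse_at_top_right])
      then show ?thesis
        by (rule Lim_transform_eventually)
          (auto simp: eventually_at_filter flat_def divide_inverse mult_ac)
    qed
    moreover have "((\<lambda>h. flat p h / h) \<longlongrightarrow> 0) (at_left 0)"
      by (rule Lim_transform_eventually[OF tendsto_const])
        (auto simp: eventually_at_filter flat_def)
    ultimately have "((\<lambda>h. flat p h / h) \<longlongrightarrow> 0) (at 0)"
      by (simp add: filterlim_split_at)
    then show ?thesis using 3 by (simp add: has_field_derivative_iff flat_def)
  qed
qed

lemma Ck_flat: "Ck k (\<lambda>x. flat p (x \<bullet> v + c))"
proof (induction k arbitrary: p)
  case 0
  have "continuous_on UNIV (flat p)"
    using DERIV_flat DERIV_isCont by (intro continuous_at_imp_continuous_on ballI) blast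
  then have "continuous_on UNIV (\<lambda>x. flat p (x \<bullet> v + c))"
    by (rule continuous_on_compose2) (auto intro!: continuous_intros)
  then show ?case by simp
next
  case (Suc k)
  let ?q = "[:0, 0, 1:] * (p - pderiv p)"
  have D: "((\<lambda>x. flat p (x \<bullet> v + c)) has_derivative (\<lambda>b. (b \<bullet> v) * flat ?q (x \<bullet> v + c))) (at x)" for x
  proof -
    have "((\<lambda>x. x \<bullet> v + c) has_derivative (\<lambda>b. b \<bullet> v)) (at x)"
      by (auto intro!: derivative_eq_intros)
    from DERIV_compose_FDERIV[OF DERIV_flat this] show ?thesis .
  qed
  then have "frechet_derivative (\<lambda>x. flat p (x \<bullet> v + c)) (at x) = (\<lambda>b. (b \<bullet> v) * flat ?q (x \<bullet> v + c))" for x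
    using frechet_derivative_at by metis
  then show ?case using D Suc.IH by (auto simp: differentiable_def intro!: Ck_mult Ck_const simp del: mult_pCons_left)
qed

lemma flat_one_bounds: "0 \<le> flat 1 t" "flat 1 t \<le> 1" "flat 1 t \<noteq> 0 \<longleftrightarrow> t > 0"
  by (auto simp: flat_def)

text \<open>The stretched profile converges pointwise to a step function; for fixed s > 0 the shift
  by 1 is negligible against n s.\<close>

lemma flat_one_tendsto:
  assumes "s > 0"
  shows "(\<lambda>n. flat 1 (real n * s - 1)) \<longlonglongrightarrow> 1"
proof -
  have lim: "filterlim (\<lambda>n. real n * s - 1) at_top sequentially"
    using assms by real_asymp
  have "((\<lambda>t::real. exp (- (1 / t))) \<longlongrightarrow> 1) at_top" by real_asymp
  then have "((\<lambda>t. flat 1 t) \<longlongrightarrow> 1) at_top"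
    by (rule Lim_transform_eventually)
      (auto simp: flat_def intro: eventually_mono[OF eventually_gt_at_top[of 0]])
  from filterlim_compose[OF this lim] show ?thesis .
qed

text \<open>The shifts by \<open>1\<close> keep the support in a compact subset of the open box.\<close>

definition bump :: "'a::euclidean_space \<Rightarrow> 'a \<Rightarrow> nat \<Rightarrow> 'a \<Rightarrow> real" where
  "bump a b n x = (\<Prod>i\<in>Basis. flat 1 (real n * (x \<bullet> i - a \<bullet> i) - 1) * flat 1 (real n * (b \<bullet> i - x \<bullet> i) - 1))"

lemma Ck_bump: "Ck k (bump a b n)"
proof -
  have eq: "real n * (x \<bullet> i - a \<bullet> i) - 1 = x \<bullet> (real n *\<^sub>R i) + (- real n * (a \<bullet> i) - 1)"
    "real n * (b \<bullet> i - x \<bullet> i) - 1 = x \<bullet> (- real n *\<^sub>R i) + (real n * (b \<bullet> i) - 1)"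
    for x i by (simp_all add: algebra_simps)
  show ?thesis
    unfolding bump_def eq by (intro Ck_prod Ck_mult Ck_flat finite_Basis)
qed

lemma bump_bounds: "0 \<le> bump a b n x" "bump a b n x \<le> 1"
  unfolding bump_def
  by (auto intro!: prod_nonneg prod_le_1 mult_nonneg_nonneg mult_le_one simp: flat_one_bounds)

lemma bump_nonzero_iff:
  "bump a b n x \<noteq> 0 \<longleftrightarrow> (\<forall>i\<in>Basis. 1 < real n * (x \<bullet> i - a \<bullet> i) \<and> 1 < real n * (b \<bullet> i - x \<bullet> i))"
  unfolding bump_def by (simp add: flat_one_bounds)

lemma bump_eq_0_outside: 
  assumes "x \<notin> box a b" shows "bump a b n x = 0"
proof (rule ccontr)
  assume "bump a b n x \<noteq> 0"
  then have "1 < real n * (x \<bullet> i - a \<bullet> i) \<and> 1 < real n * (b \<bullet> i - x \<bullet> i)" if "i \<in> Basis" for i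
    using that by (auto simp: bump_nonzero_iff)
  moreover have "0 < y" if "1 < real n * y" for y
    using that mult_nonneg_nonpos[of "real n" y] by force
  ultimately have "0 < x \<bullet> i - a \<bullet> i \<and> 0 < b \<bullet> i - x \<bullet> i" if "i \<in> Basis" for i
    using that by blast
  then show False using assms by (auto simp: mem_box)
qed

lemma bump_tendsto_indicator: "(\<lambda>n. bump a b n x) \<longlonglongrightarrow> indicator (box a b) x"
proof (cases "x \<in> box a b")
  case True
  have "(\<lambda>n. bump a b n x) \<longlonglongrightarrow> (\<Prod>i\<in>(Basis::'a set). 1 * 1)"
    unfolding bump_def by (intro tendsto_intros flat_one_tendsto) (use True in \<open>auto simp: mem_box\<close>)
  then show ?thesis using True by simp
next
  case False
  then show ?thesis by (simp add: bump_eq_0_outside)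
qed

lemma test_function_bump:
  fixes a b :: "real ^ 'q"
  assumes "box a b \<subseteq> \<Omega>"
  shows "test_function \<Omega> (bump a b n)"
proof (cases "n = 0")
  case True
  \<comment> \<open>For n = 0 every factor contains \<open>flat 1 (- 1)\<close>, which is 0. The
    basis is nonempty, so the product is not the empty one.\<close>
  have "bump a b n x = 0" for x :: "real ^ 'q"
  proof -
    have "\<exists>i::real^'q. i \<in> Basis" using nonempty_Basis by blast
    then show ?thesis using bump_nonzero_iff[of a b n x] True by auto
  qed
  then have "{x. bump a b n x \<noteq> 0} = {}" by simp
  then show ?thesis unfolding test_function_def using Ck_bump by auto
next
  case False
  define K where "K = cbox (a + (1 / real n) *\<^sub>R One) (b - (1 / real n) *\<^sub>R One)"
  have le: "1 / real n \<le> y" if "1 < real n * y" for y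
    using that False by (simp add: field_simps)
  have "{x. bump a b n x \<noteq> 0} \<subseteq> K"
  proof
    fix x assume "x \<in> {x. bump a b n x \<noteq> 0}"
    then have "1 / real n \<le> x \<bullet> i - a \<bullet> i \<and> 1 / real n \<le> b \<bullet> i - x \<bullet> i" if "i \<in> Basis" for i
      using that le unfolding mem_Collect_eq bump_nonzero_iff by blast
    then show "x \<in> K" unfolding K_def mem_box by (force simp: inner_simps)
  qed
  then have cl: "closure {x. bump a b n x \<noteq> 0} \<subseteq> K"
    unfolding K_def by (rule closure_minimal) (rule closed_cbox)
  have "K \<subseteq> box a b"
  proof
    fix x assume x: "x \<in> K"
    have pos: "1 / real n > 0" using False by simp
    have le:  "a \<bullet> i + 1 / real n \<le> x \<bullet> i \<and> x \<bullet> i \<le> b \<bullet> i - 1 / real n" if "i \<in> Basis" for i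
      using x that unfolding K_def mem_box by (force simp: inner_simps)
    have "a \<bullet> i < x \<bullet> i \<and> x \<bullet> i < b \<bullet> i" if "i \<in> Basis" for i
      using le[OF that] pos by linarith
    then show "x \<in> box a b" by (simp add: mem_box)
  qed
  then have "K \<subseteq> \<Omega>" using assms by blast
  moreover have "compact (closure {x. bump a b n x \<noteq> 0})"
    using cl bounded_subset[OF bounded_cbox] unfolding K_def compact_eq_bounded_closed by blast
  ultimately show ?thesis
    unfolding test_function_def by (intro conjI allI Ck_bump) (use cl in auto)
qed

section \<open>Test functions\<close>

text \<open>Any compact set off which f vanishes may replace the closure of the support, so that
  sums, products and derivatives inherit a set without computing their own closure.\<close>

lemma test_functionI:
  assumes "\<And>k. Ck k f" "compact K" "K \<subseteq> \<Omega>" "\<And>x. x \<notin> K \<Longrightarrow> f x = 0"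
  shows "test_function \<Omega> f"
proof -
  have "{x. f x \<noteq> 0} \<subseteq> K" using assms(4) by blast
  then have "closure {x. f x \<noteq> 0} \<subseteq> K"
    by (simp add: assms(2) closure_minimal compact_imp_closed)
  then show ?thesis
    unfolding test_function_def using assms
    by (meson bounded_subset closed_closure compact_eq_bounded_closed order_trans)
qed

lemma test_functionE:
  assumes "test_function \<Omega> f"
  obtains K where "\<And>k. Ck k f" "compact K" "K \<subseteq> \<Omega>" "\<And>x. x \<notin> K \<Longrightarrow> f x = 0"
  using assms unfolding test_function_def
  by (metis (mono_tags, lifting) closure_subset mem_Collect_eq subsetD)

lemma test_function_zero: "test_function \<Omega> (\<lambda>x. 0)"
  by (rule test_functionI[where K = "{}"]) (auto intro: Ck_const)

lemma test_function_add:
  assumes "test_function \<Omega> f" "test_function \<Omega> g"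
  shows "test_function \<Omega> (\<lambda>x. f x + g x)"
proof -
  obtain K where K: "\<And>k. Ck k f" "compact K" "K \<subseteq> \<Omega>" "\<And>x. x \<notin> K \<Longrightarrow> f x = 0"
    using assms(1) by (rule test_functionE) blast
  obtain L where L: "\<And>k. Ck k g" "compact L" "L \<subseteq> \<Omega>" "\<And>x. x \<notin> L \<Longrightarrow> g x = 0"
    using assms(2) by (rule test_functionE) blast
  show ?thesis
    by (rule test_functionI[where K = "K \<union> L"]) (use K L in \<open>auto intro: Ck_add compact_Un\<close>)
qed

lemma test_function_Ck_mult:
  assumes "\<And>k. Ck k f" "test_function \<Omega> g"
  shows "test_function \<Omega> (\<lambda>x. f x * g x)"
  using assms(2) by (rule test_functionE) (auto intro!: test_functionI Ck_mult assms(1))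

lemma test_function_Ck: "test_function \<Omega> f \<Longrightarrow> Ck k f"
  by (simp add: test_function_def)

lemma test_function_mult:
  "test_function \<Omega> f \<Longrightarrow> test_function \<Omega> g \<Longrightarrow> test_function \<Omega> (\<lambda>x. f x * g x)"
  by (rule test_function_Ck_mult) (auto intro: test_function_Ck)

lemma test_function_cmult: "test_function \<Omega> g \<Longrightarrow> test_function \<Omega> (\<lambda>x. c * g x)"
  by (rule test_function_Ck_mult) (auto intro: Ck_const)

lemma test_function_sum:
  "finite I \<Longrightarrow> (\<And>i. i \<in> I \<Longrightarrow> test_function \<Omega> (f i)) \<Longrightarrow> test_function \<Omega> (\<lambda>x. \<Sum>i\<in>I. f i x)"
  by (induction I rule: finite_induct) (auto intro: test_function_zero test_function_add)

lemma test_function_has_derivative: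
  assumes "test_function \<Omega> f"
  shows "(f has_derivative frechet_derivative f (at x)) (at x)"
  using test_function_Ck[OF assms, of "Suc 0"] by (simp add: frechet_derivative_works[symmetric])

lemma test_function_line_derivative:
  assumes "test_function \<Omega> f"
  shows "((\<lambda>t. f (t *\<^sub>R b + w)) has_real_derivative frechet_derivative f (at (t *\<^sub>R b + w)) b) (at t)"
proof -
  have D: "((\<lambda>t. t *\<^sub>R b + w) has_derivative (\<lambda>s. s *\<^sub>R b)) (at t)"
    by (auto intro!: derivative_eq_intros)
  have "((\<lambda>t. f (t *\<^sub>R b + w)) has_derivative (\<lambda>s. frechet_derivative f (at (t *\<^sub>R b + w)) (s *\<^sub>R b))) (at t)"
    by (rule has_derivative_compose[OF D test_function_has_derivative[OF assms]])
  moreover have "linear (frechet_derivative f (at y))" for y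
    using test_function_has_derivative[OF assms] has_derivative_linear by blast
  ultimately show ?thesis
    by (simp add: has_field_derivative_def linear_cmul mult_commute_abs)
qed

lemma test_function_derivative:
  assumes "test_function \<Omega> f" "b \<in> Basis"
  shows "test_function \<Omega> (\<lambda>x. frechet_derivative f (at x) b)"
proof -
  obtain K where K: "\<And>k. Ck k f" "compact K" "K \<subseteq> \<Omega>" "\<And>x. x \<notin> K \<Longrightarrow> f x = 0"
    using assms(1) by (rule test_functionE) blast
  have "frechet_derivative f (at x) b = 0" if "x \<notin> K" for x
  proof -
    \<comment> \<open>The complement of K is open, so f agrees with the zero function near x and not
      only at x.\<close>
    have "frechet_derivative f (at x) = frechet_derivative (\<lambda>x. 0) (at x)"
    proof (rule frechet_derivative_transform_within_open)
      show "f differentiable at x"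
        using test_function_has_derivative[OF assms(1)] unfolding differentiable_def by blast
      show "open (- K)" using K(2) by (simp add: compact_imp_closed open_Compl)
    qed (use that K(4) in auto)
    then show ?thesis by (simp add: frechet_derivative_const)
  qed
  moreover have "Ck k (\<lambda>x. frechet_derivative f (at x) b)" for k
    using K(1)[of "Suc k"] assms(2) by simp
  ultimately show ?thesis using K by (auto intro!: test_functionI)
qed

section \<open>Integrals of compactly supported functions\<close>

lemma integrable_compact_support:
  fixes f :: "real ^ 'q \<Rightarrow> real"
  assumes "continuous_on UNIV f" "compact K" "\<And>x. x \<notin> K \<Longrightarrow> f x = 0"
  shows "integrable lborel f"
proof -
  have "integrable lborel (\<lambda>x. indicator K x *\<^sub>R f x)"
    using assms by (intro borel_integrable_compact) (auto intro: continuous_on_subset)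
  moreover have "(\<lambda>x. indicator K x *\<^sub>R f x) = f"
    by (rule ext) (metis assms(3) indicator_simps(1,2) scaleR_one scaleR_zero_right)
  ultimately show ?thesis by simp
qed

text \<open>Translation invariance and Fubini are used for \<open>lborel\<close>, whereas the
  Sobolev spaces are built on \<open>lebesgue_on \<Omega>\<close>. This is the passage between the
  two for functions supported in \<Omega>.\<close>

lemma lebesgue_on_compact_support:
  fixes f :: "real ^ 'q \<Rightarrow> real"
  assumes "open \<Omega>" "continuous_on UNIV f" "compact K" "K \<subseteq> \<Omega>" "\<And>x. x \<notin> K \<Longrightarrow> f x = 0"
  shows "integrable (lebesgue_on \<Omega>) f"
    and "integral\<^sup>L (lebesgue_on \<Omega>) f = integral\<^sup>L lborel f"
proof -
  have eq: "(\<lambda>x. indicator \<Omega> x *\<^sub>R f x) = f"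
    by (rule ext) (metis assms(4,5) indicator_simps(1,2) scaleR_one scaleR_zero_right subsetD)
  have i: "integrable lborel f" using assms integrable_compact_support by blast
  then have m: "f \<in> borel_measurable lborel" by blast
  have "\<Omega> \<in> sets lebesgue" using assms(1) by auto
  with i m eq show "integrable (lebesgue_on \<Omega>) f"
    "integral\<^sup>L (lebesgue_on \<Omega>) f = integral\<^sup>L lborel f"
    by (simp_all add: integrable_restrict_space integral_restrict_space integrable_completion integral_completion)
qed

lemma test_function_integrable:
  assumes "open \<Omega>" "test_function \<Omega> f"
  shows "integrable lborel f" "integrable (lebesgue_on \<Omega>) f"
    and "integral\<^sup>L (lebesgue_on \<Omega>) f = integral\<^sup>L lborel f"
  using assms(2) by (rule test_functionE; use assms(1) in \<open>auto intro!: integrable_compact_support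
      lebesgue_on_compact_support Ck_imp_continuous_on\<close>)+

lemma test_function_bounded:
  assumes "test_function \<Omega> f"
  obtains B where "B > 0" "\<And>x. \<bar>f x\<bar> \<le> B"
proof -
  obtain K where K: "\<And>k. Ck k f" "compact K" "K \<subseteq> \<Omega>" "\<And>x. x \<notin> K \<Longrightarrow> f x = 0"
    using assms(1) by (rule test_functionE) blast
  have "compact (f ` K)" by (intro compact_continuous_image Ck_imp_continuous_on K)
  then obtain B where "B > 0" "\<And>x. x \<in> K \<Longrightarrow> \<bar>f x\<bar> \<le> B"
    using compact_imp_bounded bounded_pos by (metis image_eqI real_norm_def)
  then show ?thesis using that[of B] K(4) by (metis abs_zero less_le)
qed

text \<open>Translation invariance: difference quotients integrate to zero.\<close>

lemma integral_partial_derivative_eq_0: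
  fixes f :: "real ^ 'q \<Rightarrow> real"
  assumes "open \<Omega>" "test_function \<Omega> f" "b \<in> Basis"
  shows "integral\<^sup>L lborel (\<lambda>x. frechet_derivative f (at x) b) = 0"
proof -
  obtain K where K: "\<And>k. Ck k f" "compact K" "K \<subseteq> \<Omega>" "\<And>x. x \<notin> K \<Longrightarrow> f x = 0"
    using assms(2) by (rule test_functionE) blast
  obtain B where B: "B > 0" "\<And>x. \<bar>frechet_derivative f (at x) b\<bar> \<le> B"
    using test_function_bounded[OF test_function_derivative[OF assms(2,3)]] by blast
  obtain R where R: "R > 0" "\<And>x. x \<in> K \<Longrightarrow> norm x \<le> R"
    using K(2) compact_imp_bounded bounded_pos by metis
  define h where "h n = 1 / real (Suc n)" for n
  have h: "h n > 0" "h n \<le> 1" for n by (auto simp: h_def)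
  have h0: "h \<longlonglongrightarrow> 0" unfolding h_def by (rule LIMSEQ_Suc[OF lim_1_over_n])
  define q where "q n x = (f (x + h n *\<^sub>R b) - f x) / h n" for n x
  have line: "((\<lambda>t. f (x + t *\<^sub>R b)) has_real_derivative frechet_derivative f (at (x + t *\<^sub>R b)) b) (at t)" for x t
    using test_function_line_derivative[OF assms(2), of b x t] by (simp add: add.commute)
  \<comment> \<open>Domination: the mean value theorem bounds every quotient by the bound B of the
    derivative, and since h n \<le> 1 all of them vanish outside one ball of radius R + 1.\<close>
  have bd: "\<bar>q n x\<bar> \<le> B" for n x
  proof -
    obtain z where "f (x + h n *\<^sub>R b) - f (x + 0 *\<^sub>R b) = (h n - 0) * frechet_derivative f (at (x + z *\<^sub>R b)) b"
      using MVT2[OF h(1)[of n], of "\<lambda>t. f (x + t *\<^sub>R b)"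
          "\<lambda>t. frechet_derivative f (at (x + t *\<^sub>R b)) b"] line by blast
    then have "q n x = frechet_derivative f (at (x + z *\<^sub>R b)) b"
      using h(1)[of n] by (simp add: q_def)
    then show ?thesis using B(2) by simp
  qed
  have supp: "q n x = 0" if "x \<notin> cball 0 (R + 1)" for n x
  proof -
    have n: "norm x > R + 1" using that by simp
    have "norm (h n *\<^sub>R b) \<le> 1" using h[of n] assms(3) by simp
    then have "norm (x + h n *\<^sub>R b) > R"
      using n norm_triangle_ineq4[of "x + h n *\<^sub>R b" "h n *\<^sub>R b"] by simp
    then have "f (x + h n *\<^sub>R b) = 0" "f x = 0" using R K(4) n by force+
    then show ?thesis by (simp add: q_def)
  qed
  have meas[measurable]: "f \<in> borel_measurable borel"
    using K(1) by (intro borel_measurable_continuous_onI Ck_imp_continuous_on) blast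
  have lim: "(\<lambda>n. integral\<^sup>L lborel (q n)) \<longlonglongrightarrow> integral\<^sup>L lborel (\<lambda>x. frechet_derivative f (at x) b)"
  proof (rule integral_dominated_convergence[where w = "\<lambda>x. indicator (cball 0 (R + 1)) x *\<^sub>R B"])
    show "(\<lambda>x. frechet_derivative f (at x) b) \<in> borel_measurable lborel"
      using test_function_integrable(1)[OF assms(1) test_function_derivative[OF assms(2,3)]] by blast
    show "q n \<in> borel_measurable lborel" for n unfolding q_def by measurable
    show "integrable lborel (\<lambda>x. indicator (cball 0 (R + 1)) x *\<^sub>R B)"
      by (intro borel_integrable_compact) auto
    show "AE x in lborel. (\<lambda>n. q n x) \<longlonglongrightarrow> frechet_derivative f (at x) b"
    proof (rule AE_I2)
      fix x
      have "((\<lambda>t. (f (x + t *\<^sub>R b) - f x) / t) \<longlongrightarrow> frechet_derivative f (at x) b) (at 0)"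
        using line[of x 0] by (simp add: has_field_derivative_iff)
      moreover have "filterlim h (at 0) sequentially"
        using h0 h(1) by (auto simp: filterlim_at less_imp_neq[symmetric])
      ultimately show "(\<lambda>n. q n x) \<longlonglongrightarrow> frechet_derivative f (at x) b"
        unfolding q_def by (rule filterlim_compose)
    qed
    show "AE x in lborel. norm (q n x) \<le> indicator (cball 0 (R + 1)) x *\<^sub>R B" for n
      using bd supp by (auto intro!: AE_I2 simp: indicator_def simp del: mem_cball)
  qed
  have "integral\<^sup>L lborel (q n) = 0" for n
  proof -
    have i: "integrable lborel f" using test_function_integrable(1)[OF assms(1,2)] .
    have d: "distr lborel borel (\<lambda>x. x + h n *\<^sub>R b) = (lborel :: (real ^ 'q) measure)"
      using lborel_distr_plus[of "h n *\<^sub>R b"] by (simp add: add.commute[of "h n *\<^sub>R b"] cong: distr_cong)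
    have i': "integrable lborel (\<lambda>x. f (x + h n *\<^sub>R b))"
      using i by (subst (asm) d[symmetric]) (simp add: integrable_distr_eq)
    have "integral\<^sup>L lborel (\<lambda>x. f (x + h n *\<^sub>R b)) = integral\<^sup>L lborel f"
      by (subst (2) d[symmetric]) (simp add: integral_distr)
    then show ?thesis using i i' by (simp add: q_def[abs_def])
  qed
  then show ?thesis using lim LIMSEQ_unique[OF tendsto_const] by fastforce
qed

text \<open>The fundamental lemma of the calculus of variations. Bumps converge boundedly to
  indicators, so the integral over every box inside \<Omega> vanishes; boxes generate the Borel
  sets, which forces g to vanish on each box, and countably many boxes cover \<Omega>.\<close>

lemma AE_eq_0_if_integral_test_eq_0:
  fixes g :: "real ^ 'q \<Rightarrow> real"
  assumes "open \<Omega>" and g: "integrable (lebesgue_on \<Omega>) g"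
    and z: "\<And>\<psi>. test_function \<Omega> \<psi> \<Longrightarrow> integral\<^sup>L (lebesgue_on \<Omega>) (\<lambda>x. g x * \<psi> x) = 0"
  shows "AE x in lebesgue_on \<Omega>. g x = 0"
proof -
  have \<Omega>: "\<Omega> \<in> sets lebesgue" using assms(1) by auto
  \<comment> \<open>Since g is only Lebesgue measurable and matters only on \<Omega>, it is extended
    by zero and replaced by a Borel representative \<open>g0\<close>, to which uniqueness of Borel
    measures applies.\<close>
  define g1 where "g1 x = indicator \<Omega> x *\<^sub>R g x" for x
  have g1: "integrable lebesgue g1"
    using g \<Omega> unfolding g1_def by (simp add: integrable_restrict_space)
  obtain g0 where [measurable]: "g0 \<in> borel_measurable lborel" and ae: "AE x in lborel. g1 x = g0 x"
    using completion_ex_borel_measurable_real[of g1 lborel] g1 by auto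
  note aec = AE_completion[OF ae]
  have "integrable lebesgue g0"
    by (rule integrable_cong_AE_imp[OF g1]) (use aec in \<open>auto intro: measurable_completion\<close>)
  then have g0: "integrable lborel g0" by (simp add: integrable_completion)
  have z0: "integral\<^sup>L lborel (\<lambda>x. g0 x * \<psi> x) = 0" if "test_function \<Omega> \<psi>" for \<psi>
  proof -
    have [measurable]: "\<psi> \<in> borel_measurable lborel"
      using test_function_integrable(1)[OF assms(1) that] by blast
    have [measurable]: "g1 \<in> borel_measurable lebesgue" using g1 by blast
    have p: "\<psi> \<in> borel_measurable lebesgue" by (auto intro: measurable_completion)
    have "integral\<^sup>L lborel (\<lambda>x. g0 x * \<psi> x) = integral\<^sup>L lebesgue (\<lambda>x. g0 x * \<psi> x)"
      by (simp add: integral_completion)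
    also have "\<dots> = integral\<^sup>L lebesgue (\<lambda>x. g1 x * \<psi> x)"
      using aec p by (intro integral_cong_AE borel_measurable_times)
        (auto intro: measurable_completion)
    also have "\<dots> = integral\<^sup>L (lebesgue_on \<Omega>) (\<lambda>x. g x * \<psi> x)"
      using \<Omega> by (simp add: integral_restrict_space g1_def mult_ac)
    finally show ?thesis using z[OF that] by simp
  qed
  have box0: "integral\<^sup>L lborel (\<lambda>x. g0 x * indicator (box a b) x) = 0" if "box a b \<subseteq> \<Omega>" for a b
  proof -
    have "(\<lambda>n. integral\<^sup>L lborel (\<lambda>x. g0 x * bump a b n x)) \<longlonglongrightarrow> integral\<^sup>L lborel (\<lambda>x. g0 x * indicator (box a b) x)"
    proof (rule integral_dominated_convergence[where w = "\<lambda>x. \<bar>g0 x\<bar>"])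
      have "bump a b n \<in> borel_measurable borel" for n
        by (intro borel_measurable_continuous_onI Ck_imp_continuous_on Ck_bump)
      then show "(\<lambda>x. g0 x * bump a b n x) \<in> borel_measurable lborel" for n by simp
      show "AE x in lborel. (\<lambda>n. g0 x * bump a b n x) \<longlonglongrightarrow> g0 x * indicator (box a b) x"
        by (intro AE_I2 tendsto_intros bump_tendsto_indicator)
      show "AE x in lborel. norm (g0 x * bump a b n x) \<le> \<bar>g0 x\<bar>" for n
        using bump_bounds[of a b n] by (auto simp: abs_mult mult_left_le)
    qed (use g0 in auto)
    moreover have "integral\<^sup>L lborel (\<lambda>x. g0 x * bump a b n x) = 0" for n
      using z0 test_function_bump[OF that] by blast
    ultimately show ?thesis using LIMSEQ_unique[OF tendsto_const] by fastforce
  qed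
  have ae_box: "AE x in lborel. x \<in> box a b \<longrightarrow> g0 x = 0" if sub: "box a b \<subseteq> \<Omega>" for a b
  proof -
    \<comment> \<open>Only boxes inside \<Omega> are controlled. The intersection of such a box with
      any other box is again a box inside \<Omega>, so after this restriction k integrates to 0 over
      all boxes.\<close>
    define k where "k x = g0 x * indicator (box a b) x" for x
    have k: "integrable lborel k" unfolding k_def using g0 by (intro integrable_real_mult_indicator) auto
    then have [measurable]: "k \<in> borel_measurable lborel" by blast
    have fin: "(\<integral>\<^sup>+x. ennreal (s * k x) * indicator A x \<partial>lborel) \<noteq> \<infinity>" if "\<bar>s\<bar> = 1" for s A
    proof -
      have "(\<integral>\<^sup>+x. ennreal (s * k x) * indicator A x \<partial>lborel) \<le> (\<integral>\<^sup>+x. ennreal (norm (k x)) \<partial>lborel)"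
        using that by (intro nn_integral_mono) (auto simp: indicator_def abs_if intro!: ennreal_leI split: if_splits)
      then show ?thesis using k unfolding integrable_iff_bounded by (auto simp: top_unique)
    qed
    have eqb: "(\<integral>\<^sup>+x. ennreal (k x) * indicator (box c d) x \<partial>lborel)
        = (\<integral>\<^sup>+x. ennreal (- k x) * indicator (box c d) x \<partial>lborel)" for c d
    proof -
      obtain c' d' where cd: "box a b \<inter> box c d = box c' d'" by (rule that) (rule box_Int_box)
      have "(\<lambda>x. k x * indicator (box c d) x) = (\<lambda>x. g0 x * indicator (box c' d') x)"
        unfolding k_def cd[symmetric] by (auto simp: indicator_def)
      moreover have "box c' d' \<subseteq> \<Omega>" using cd sub by blast
      ultimately have 0: "integral\<^sup>L lborel (\<lambda>x. k x * indicator (box c d) x) = 0"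
        using box0 by presburger
      have i: "integrable lborel (\<lambda>x. k x * indicator (box c d) x)"
        using k by (intro integrable_real_mult_indicator) auto
      have s: "ennreal (k x * indicator (box c d) x) = ennreal (k x) * indicator (box c d) x"
        "ennreal (- (k x * indicator (box c d) x)) = ennreal (- k x) * indicator (box c d) x" for x
        by (auto simp: indicator_def)
      have "enn2real (\<integral>\<^sup>+x. ennreal (k x) * indicator (box c d) x \<partial>lborel)
        = enn2real (\<integral>\<^sup>+x. ennreal (- k x) * indicator (box c d) x \<partial>lborel)"
        using real_lebesgue_integral_def[OF i] 0 unfolding s by simp
      \<comment> \<open>Both integrals are finite, so the equality of their real values lifts to the
        extended reals, where measures take their values.\<close>
      then have "ennreal (enn2real (\<integral>\<^sup>+x. ennreal (k x) * indicator (box c d) x \<partial>lborel))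
        = ennreal (enn2real (\<integral>\<^sup>+x. ennreal (- k x) * indicator (box c d) x \<partial>lborel))" by simp
      moreover have "(\<integral>\<^sup>+x. ennreal (k x) * indicator (box c d) x \<partial>lborel) < top"
        "(\<integral>\<^sup>+x. ennreal (- k x) * indicator (box c d) x \<partial>lborel) < top"
        using fin[of 1 "box c d"] fin[of "-1" "box c d"] by (simp_all add: less_top[symmetric])
      ultimately show ?thesis by (simp only: ennreal_enn2real)
    qed
    \<comment> \<open>\<open>ennreal\<close> sends negative reals to 0, so the densities are the
      positive and the negative part of k. The two measures agree on boxes, an intersection-stable
      generator, and are finite there, hence agree everywhere.\<close>
    have "density lborel (\<lambda>x. ennreal (k x)) = density lborel (\<lambda>x. ennreal (- k x))"
    proof (rule measure_eqI_generator_eq)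
      let ?E = "range (\<lambda>(a, b). box a b :: (real ^ 'q) set)"
      show "Int_stable ?E" by (auto simp: Int_stable_def box_Int_box)
      show "?E \<subseteq> Pow UNIV" by simp
      show "sets (density lborel (\<lambda>x. ennreal (k x))) = sigma_sets UNIV ?E"
        "sets (density lborel (\<lambda>x. ennreal (- k x))) = sigma_sets UNIV ?E"
        by (simp_all add: borel_eq_box)
      let ?A = "\<lambda>n::nat. box (- (real n *\<^sub>R One)) (real n *\<^sub>R One) :: (real ^ 'q) set"
      show "range ?A \<subseteq> ?E" "(\<Union>i. ?A i) = UNIV"
        unfolding UN_box_eq_UNIV by auto
      show "emeasure (density lborel (\<lambda>x. ennreal (k x))) (?A i) \<noteq> \<infinity>" for i
        using fin[of 1] by (simp add: emeasure_density)
      show "emeasure (density lborel (\<lambda>x. ennreal (k x))) X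
          = emeasure (density lborel (\<lambda>x. ennreal (- k x))) X" if "X \<in> ?E" for X
        using that eqb by (auto simp: emeasure_density)
    qed
    then have "AE x in lborel. ennreal (k x) = ennreal (- k x)"
      by (intro sigma_finite_measure.density_unique[OF sigma_finite_lborel]) auto
    then show ?thesis
    proof (rule AE_mp, intro AE_I2 impI)
      fix x assume e: "ennreal (k x) = ennreal (- k x)" and x: "x \<in> box a b"
      have "k x = 0"
        using e by (cases "k x" "0::real" rule: linorder_cases) (auto simp: ennreal_neg ennreal_eq_0_iff)
      then show "g0 x = 0" using x by (simp add: k_def)
    qed
  qed
  obtain D where D: "countable D" "\<And>S. S \<in> D \<Longrightarrow> S \<subseteq> \<Omega> \<and> (\<exists>a b. S = box a b)" "\<Union>D = \<Omega>"
    using open_countable_Union_open_box[OF assms(1)] by (metis (no_types, lifting) PowD subsetD)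
  have "AE x in lborel. x \<in> S \<longrightarrow> g0 x = 0" if S: "S \<in> D" for S
  proof -
    obtain a b where "S = box a b" "box a b \<subseteq> \<Omega>" using D(2)[OF S] by blast
    then show ?thesis using ae_box by blast
  qed
  then have "AE x in lborel. \<forall>S\<in>D. x \<in> S \<longrightarrow> g0 x = 0"
    using D(1) by (rule AE_ball_countable')
  then have "AE x in lborel. x \<in> \<Omega> \<longrightarrow> g x = 0"
    using ae
  proof eventually_elim
    case (elim x)
    show ?case
    proof
      assume x: "x \<in> \<Omega>"
      then have "g0 x = 0" using elim(1) D(3) by blast
      then show "g x = 0" using elim(2) x by (simp add: g1_def)
    qed
  qed
  then show ?thesis
    using \<Omega> by (simp add: AE_restrict_space_iff AE_completion)
qed

section \<open>The spaces \<open>L2\<close>, \<open>H1\<close> and \<open>H10\<close>\<close>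

lemma L2_measurable: "u \<in> L2 \<Omega> \<Longrightarrow> u \<in> borel_measurable (lebesgue_on \<Omega>)"
  by (simp add: L2_def)

lemma L2_bounded_by:
  assumes "g \<in> L2 \<Omega>" "f \<in> borel_measurable (lebesgue_on \<Omega>)" "\<And>x. norm (f x) \<le> norm (g x)"
  shows "f \<in> L2 \<Omega>"
proof -
  have "integrable (lebesgue_on \<Omega>) (\<lambda>x. (norm (f x))\<^sup>2)"
    by (rule Bochner_Integration.integrable_bound[where f = "\<lambda>x. (norm (g x))\<^sup>2"])
      (use assms in \<open>auto simp: L2_def intro!: power_mono\<close>)
  then show ?thesis using assms(2) by (simp add: L2_def)
qed

lemma L2_inner_integrable:
  assumes "u \<in> L2 \<Omega>" "v \<in> L2 \<Omega>"
  shows "integrable (lebesgue_on \<Omega>) (\<lambda>x. u x \<bullet> v x)"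
proof (rule Bochner_Integration.integrable_bound[where f = "\<lambda>x. (norm (u x))\<^sup>2 + (norm (v x))\<^sup>2"])
  show "AE x in lebesgue_on \<Omega>. norm (u x \<bullet> v x) \<le> norm ((norm (u x))\<^sup>2 + (norm (v x))\<^sup>2)"
  proof (rule AE_I2)
    fix x
    have "\<bar>u x \<bullet> v x\<bar> \<le> norm (u x) * norm (v x)" by (rule Cauchy_Schwarz_ineq2)
    also have "\<dots> \<le> (norm (u x))\<^sup>2 + (norm (v x))\<^sup>2"
      using sum_squares_bound[of "norm (u x)" "norm (v x)"]
        mult_nonneg_nonneg[OF norm_ge_zero norm_ge_zero, of "u x" "v x"]
      by (simp only: mult.assoc)
    finally show "norm (u x \<bullet> v x) \<le> norm ((norm (u x))\<^sup>2 + (norm (v x))\<^sup>2)" by simp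
  qed
qed (use assms in \<open>auto simp: L2_def\<close>)

lemma L2_add:
  assumes "u \<in> L2 \<Omega>" "v \<in> L2 \<Omega>"
  shows "(\<lambda>x. u x + v x) \<in> L2 \<Omega>"
proof -
  have "integrable (lebesgue_on \<Omega>) (\<lambda>x. (norm (u x))\<^sup>2 + 2 * (u x \<bullet> v x) + (norm (v x))\<^sup>2)"
    using assms L2_inner_integrable[OF assms] by (simp add: L2_def)
  then have "integrable (lebesgue_on \<Omega>) (\<lambda>x. (norm (u x + v x))\<^sup>2)"
    by (simp add: power2_norm_eq_inner inner_simps inner_commute algebra_simps)
  then show ?thesis using assms by (auto simp: L2_def)
qed

lemma L2_scaleR: "u \<in> L2 \<Omega> \<Longrightarrow> (\<lambda>x. c *\<^sub>R u x) \<in> L2 \<Omega>"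
  by (auto simp: L2_def power_mult_distrib)

lemma L2_diff: "u \<in> L2 \<Omega> \<Longrightarrow> v \<in> L2 \<Omega> \<Longrightarrow> (\<lambda>x. u x - v x) \<in> L2 \<Omega>"
  using L2_add[of u \<Omega> "\<lambda>x. (-1) *\<^sub>R v x"] L2_scaleR[of v \<Omega> "-1"] by simp

lemma L2_zero: "(\<lambda>x. 0) \<in> L2 \<Omega>"
  by (simp add: L2_def)

lemma L2_sum: "finite I \<Longrightarrow> (\<And>i. i \<in> I \<Longrightarrow> f i \<in> L2 \<Omega>) \<Longrightarrow> (\<lambda>x. \<Sum>i\<in>I. f i x) \<in> L2 \<Omega>"
  by (induction I rule: finite_induct) (auto intro: L2_zero L2_add)

lemma L2_component:
  fixes u :: "real ^ 'q \<Rightarrow> 'b::euclidean_space ^ 'n"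
  assumes "u \<in> L2 \<Omega>" shows "(\<lambda>x. u x $ i) \<in> L2 \<Omega>"
proof (rule L2_bounded_by[OF assms])
  have "(\<lambda>z :: 'b ^ 'n. z $ i) \<in> borel_measurable borel"
    by (intro borel_measurable_continuous_onI continuous_intros)
  from measurable_compose[OF L2_measurable[OF assms] this]
  show "(\<lambda>x. u x $ i) \<in> borel_measurable (lebesgue_on \<Omega>)" .
qed (rule Finite_Cartesian_Product.norm_nth_le)

lemma vec_eq_sum_axis: "(x :: 'b::real_vector ^ 'n) = (\<Sum>i\<in>UNIV. axis i (x $ i))"
  by (simp add: vec_eq_iff axis_def if_distrib cong: if_cong)

lemma norm_axis: "norm (axis i x :: 'b::real_normed_vector ^ 'n) = norm x"
proof -
  have "(\<Sum>j\<in>UNIV. (norm (axis i x $ j :: 'b))\<^sup>2) = (\<Sum>j\<in>UNIV. if j = i then (norm x)\<^sup>2 else 0)"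
    by (intro sum.cong) (auto simp: axis_def)
  then show ?thesis by (simp add: norm_vec_def L2_set_def)
qed

lemma L2_axis:
  fixes f :: "real ^ 'q \<Rightarrow> 'b::euclidean_space"
  assumes "f \<in> L2 \<Omega>" shows "(\<lambda>x. axis i (f x) :: 'b ^ 'n) \<in> L2 \<Omega>"
proof -
  have "continuous_on UNIV (\<lambda>z. axis i z :: 'b ^ 'n)"
  proof -
    have "linear (\<lambda>z. axis i z :: 'b ^ 'n)"
      by (rule linearI) (auto simp: vec_eq_iff axis_def)
    then show ?thesis using linear_continuous_on linear_conv_bounded_linear by blast
  qed
  then have "(\<lambda>z. axis i z :: 'b ^ 'n) \<in> borel_measurable borel"
    by (rule borel_measurable_continuous_onI)
  from measurable_compose[OF L2_measurable[OF assms] this]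
  show ?thesis by (rule L2_bounded_by[OF assms]) (simp add: norm_axis)
qed

lemma L2_componentwise:
  fixes u :: "real ^ 'q \<Rightarrow> 'b::euclidean_space ^ 'n"
  assumes "\<And>i. (\<lambda>x. u x $ i) \<in> L2 \<Omega>" shows "u \<in> L2 \<Omega>"
proof -
  have "(\<lambda>x. \<Sum>i\<in>UNIV. axis i (u x $ i)) \<in> L2 \<Omega>"
    by (intro L2_sum L2_axis assms) auto
  then show ?thesis by (simp flip: vec_eq_sum_axis)
qed

lemma l2_inner_scaleR_left: "l2_inner \<Omega> (\<lambda>x. c *\<^sub>R u x) v = c * l2_inner \<Omega> u v"
  by (simp add: l2_inner_def)

lemma l2_inner_scaleR_right: "l2_inner \<Omega> u (\<lambda>x. c *\<^sub>R v x) = c * l2_inner \<Omega> u v"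
  by (simp add: l2_inner_def)

lemma l2_inner_add_left:
  "u \<in> L2 \<Omega> \<Longrightarrow> u' \<in> L2 \<Omega> \<Longrightarrow> v \<in> L2 \<Omega> \<Longrightarrow>
    l2_inner \<Omega> (\<lambda>x. u x + u' x) v = l2_inner \<Omega> u v + l2_inner \<Omega> u' v"
  by (simp add: l2_inner_def inner_add_left L2_inner_integrable)

lemma l2_inner_sum_left:
  "finite I \<Longrightarrow> (\<And>i. i \<in> I \<Longrightarrow> f i \<in> L2 \<Omega>) \<Longrightarrow> v \<in> L2 \<Omega> \<Longrightarrow>
    l2_inner \<Omega> (\<lambda>x. \<Sum>i\<in>I. f i x) v = (\<Sum>i\<in>I. l2_inner \<Omega> (f i) v)"
  by (simp add: l2_inner_def inner_sum_left L2_inner_integrable)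

text \<open>Chosen weak gradients are determined only up to null sets; algebraic identities for them
  enter inner products through this congruence.\<close>

lemma l2_inner_cong_AE:
  assumes "u \<in> L2 \<Omega>" "u' \<in> L2 \<Omega>" "v \<in> L2 \<Omega>" "v' \<in> L2 \<Omega>"
    and "AE x in lebesgue_on \<Omega>. u x = u' x" "AE x in lebesgue_on \<Omega>. v x = v' x"
  shows "l2_inner \<Omega> u v = l2_inner \<Omega> u' v'"
  unfolding l2_inner_def using assms L2_inner_integrable[of u \<Omega> v] L2_inner_integrable[of u' \<Omega> v']
  by (intro integral_cong_AE borel_measurable_integrable) auto

lemma l2_inner_self_nonneg: "0 \<le> l2_inner \<Omega> u u"
  by (simp add: l2_inner_def)

lemma l2_norm_power2: "(l2_norm \<Omega> u)\<^sup>2 = l2_inner \<Omega> u u"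
  by (simp add: l2_norm_def l2_inner_self_nonneg)

lemma l2_norm_nonneg: "0 \<le> l2_norm \<Omega> u"
  by (simp add: l2_norm_def l2_inner_self_nonneg)

lemma l2_norm_scaleR: "l2_norm \<Omega> (\<lambda>x. c *\<^sub>R u x) = \<bar>c\<bar> * l2_norm \<Omega> u"
proof -
  have "l2_inner \<Omega> (\<lambda>x. c *\<^sub>R u x) (\<lambda>x. c *\<^sub>R u x) = c\<^sup>2 * l2_inner \<Omega> u u"
    by (simp add: l2_inner_scaleR_left l2_inner_scaleR_right power2_eq_square)
  then show ?thesis by (simp add: l2_norm_def real_sqrt_mult)
qed

text \<open>The parallelogram law with the term of u - v dropped. It takes the place of the triangle
  inequality, at the price of a factor 2.\<close>

lemma l2_norm_add_power2_le:
  assumes "u \<in> L2 \<Omega>" "v \<in> L2 \<Omega>"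
  shows "(l2_norm \<Omega> (\<lambda>x. u x + v x))\<^sup>2 \<le> 2 * (l2_norm \<Omega> u)\<^sup>2 + 2 * (l2_norm \<Omega> v)\<^sup>2"
proof -
  have uv: "(\<lambda>x. u x + v x) \<in> L2 \<Omega>" "(\<lambda>x. u x - v x) \<in> L2 \<Omega>" using assms L2_add L2_diff by auto
  have "l2_inner \<Omega> (\<lambda>x. u x + v x) (\<lambda>x. u x + v x) + l2_inner \<Omega> (\<lambda>x. u x - v x) (\<lambda>x. u x - v x)
     = 2 * l2_inner \<Omega> u u + 2 * l2_inner \<Omega> v v"
    unfolding l2_inner_def using assms
    by (simp add: L2_inner_integrable inner_simps inner_commute algebra_simps)
  then show ?thesis unfolding l2_norm_power2
    using l2_inner_self_nonneg[of \<Omega> "\<lambda>x. u x - v x"] by linarith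
qed

section \<open>Weak gradients and the Jacobian of test fields\<close>

lemma is_weak_grad_zero: "is_weak_grad \<Omega> (\<lambda>x. 0) (\<lambda>x. 0)"
  by (simp add: is_weak_grad_def)

lemma is_weak_grad_scaleR:
  "is_weak_grad \<Omega> u G \<Longrightarrow> is_weak_grad \<Omega> (\<lambda>x. c *\<^sub>R u x) (\<lambda>x. c *\<^sub>R G x)"
  unfolding is_weak_grad_def by (simp add: mult.assoc)

text \<open>The classical Jacobian in the index convention of \<open>is_weak_grad\<close>. Unlike
  \<open>wgrad\<close> it is a concrete function, so pointwise calculus with test fields uses
  it.\<close>

definition field_grad :: "(real ^ 'q \<Rightarrow> real ^ 'q) \<Rightarrow> real ^ 'q \<Rightarrow> real ^ 'q ^ 'q" where
  "field_grad \<psi> x = (\<chi> i j. frechet_derivative (\<lambda>y. \<psi> y $ i) (at x) (axis j 1))"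

lemma test_field_add:
  "test_field \<Omega> \<psi> \<Longrightarrow> test_field \<Omega> \<theta> \<Longrightarrow> test_field \<Omega> (\<lambda>x. \<psi> x + \<theta> x)"
  by (simp add: test_field_def test_function_add)

lemma test_field_scaleR: "test_field \<Omega> \<psi> \<Longrightarrow> test_field \<Omega> (\<lambda>x. c *\<^sub>R \<psi> x)"
  by (simp add: test_field_def test_function_cmult)

lemma axis_real_in_Basis: "axis j (1::real) \<in> Basis"
  by (auto simp: Basis_vec_def)

lemma
  assumes "u \<in> H1 \<Omega>"
  shows wgrad_L2: "wgrad \<Omega> u \<in> L2 \<Omega>" and is_weak_grad_wgrad: "is_weak_grad \<Omega> u (wgrad \<Omega> u)"
proof -
  have "\<exists>G. G \<in> L2 \<Omega> \<and> is_weak_grad \<Omega> u G" using assms by (auto simp: H1_def)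
  from someI_ex[OF this] show "wgrad \<Omega> u \<in> L2 \<Omega>" "is_weak_grad \<Omega> u (wgrad \<Omega> u)"
    by (auto simp: wgrad_def)
qed

lemma H1_L2: "u \<in> H1 \<Omega> \<Longrightarrow> u \<in> L2 \<Omega>"
  by (simp add: H1_def)

lemma h1_norm_power2: "(h1_norm \<Omega> u)\<^sup>2 = (l2_norm \<Omega> u)\<^sup>2 + (l2_norm \<Omega> (wgrad \<Omega> u))\<^sup>2"
  by (simp add: h1_norm_def)

lemma h1_norm_nonneg: "0 \<le> h1_norm \<Omega> u"
  by (simp add: h1_norm_def)

lemma H10_H1: "u \<in> H10 \<Omega> \<Longrightarrow> u \<in> H1 \<Omega>"
  by (simp add: H10_def)

lemma H10_approx:
  assumes "u \<in> H10 \<Omega>" "\<epsilon> > 0"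
  obtains \<psi> where "test_field \<Omega> \<psi>" "h1_norm \<Omega> (\<lambda>x. u x - \<psi> x) < \<epsilon>"
  using assms by (auto simp: H10_def)

context
  fixes \<Omega> :: "(real ^ 'q) set"
  assumes op: "open \<Omega>"
begin

lemma test_function_L2:
  assumes "test_function \<Omega> \<psi>" shows "\<psi> \<in> L2 \<Omega>"
  using test_function_integrable(2)[OF op test_function_mult[OF assms assms]]
    test_function_integrable(2)[OF op assms]
  by (simp add: L2_def power2_eq_square borel_measurable_integrable)

lemma test_field_L2: "test_field \<Omega> \<psi> \<Longrightarrow> \<psi> \<in> L2 \<Omega>"
  by (rule L2_componentwise) (simp add: test_field_def test_function_L2)

lemma field_grad_L2: "test_field \<Omega> \<psi> \<Longrightarrow> field_grad \<psi> \<in> L2 \<Omega>"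
  by (intro L2_componentwise)
    (simp add: field_grad_def test_field_def test_function_L2 test_function_derivative axis_real_in_Basis)

lemma integrable_mult_test:
  assumes "f \<in> L2 \<Omega>" "test_function \<Omega> \<psi>"
  shows "integrable (lebesgue_on \<Omega>) (\<lambda>x. f x * \<psi> x)"
  using L2_inner_integrable[OF assms(1) test_function_L2[OF assms(2)]] by simp

lemma is_weak_grad_add:
  assumes "is_weak_grad \<Omega> u G" "is_weak_grad \<Omega> v H"
    and "u \<in> L2 \<Omega>" "G \<in> L2 \<Omega>" "v \<in> L2 \<Omega>" "H \<in> L2 \<Omega>"
  shows "is_weak_grad \<Omega> (\<lambda>x. u x + v x) (\<lambda>x. G x + H x)"
  using assms(1,2) unfolding is_weak_grad_def
  by (auto simp: distrib_right integrable_mult_test L2_component assms(3-) test_function_derivative axis_real_in_Basis)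

text \<open>Integration by parts: a component of \<psi> times \<theta> is again a test function, so
  each of its partial derivatives integrates to 0, and the product rule splits that
  integral.\<close>

lemma is_weak_grad_test_field:
  assumes "test_field \<Omega> \<psi>"
  shows "is_weak_grad \<Omega> \<psi> (field_grad \<psi>)"
  unfolding is_weak_grad_def
proof (intro allI impI)
  fix \<theta> i j assume \<theta>: "test_function \<Omega> \<theta>"
  let ?f = "\<lambda>x. \<psi> x $ i" and ?b = "axis j (1::real) :: real ^ 'q"
  have f: "test_function \<Omega> ?f" using assms by (simp add: test_field_def)
  have "frechet_derivative (\<lambda>x. ?f x * \<theta> x) (at x)
      = (\<lambda>b. ?f x * frechet_derivative \<theta> (at x) b + frechet_derivative ?f (at x) b * \<theta> x)" for x
    by (rule frechet_derivative_at[symmetric])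
      (intro has_derivative_mult test_function_has_derivative[OF f] test_function_has_derivative[OF \<theta>])
  then have eq: "frechet_derivative (\<lambda>x. ?f x * \<theta> x) (at x) ?b
      = ?f x * frechet_derivative \<theta> (at x) ?b + field_grad \<psi> x $ i $ j * \<theta> x" for x
    by (simp add: field_grad_def)
  have "test_function \<Omega> (\<lambda>x. ?f x * \<theta> x)" by (rule test_function_mult[OF f \<theta>])
  then have "integral\<^sup>L (lebesgue_on \<Omega>) (\<lambda>x. frechet_derivative (\<lambda>x. ?f x * \<theta> x) (at x) ?b) = 0"
    using test_function_integrable(3)[OF op test_function_derivative[OF _ axis_real_in_Basis]]
      integral_partial_derivative_eq_0[OF op _ axis_real_in_Basis] by simp
  then show "integral\<^sup>L (lebesgue_on \<Omega>) (\<lambda>x. ?f x * frechet_derivative \<theta> (at x) ?b)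
      = - integral\<^sup>L (lebesgue_on \<Omega>) (\<lambda>x. field_grad \<psi> x $ i $ j * \<theta> x)"
    unfolding eq using assms \<theta> by (simp add: integrable_mult_test L2_component field_grad_L2 test_field_L2
        test_function_derivative axis_real_in_Basis)
qed

end

section \<open>Uniqueness of weak gradients and the vector space H1 on bounded open sets\<close>

context
  fixes \<Omega> :: "(real ^ 'q) set"
  assumes op: "open \<Omega>" and bd: "bounded \<Omega>"
begin

text \<open>A bounded open set has finite measure, so the constant 1 is square integrable and f can
  be paired with it.\<close>

lemma L2_imp_integrable:
  fixes f :: "real ^ 'q \<Rightarrow> real"
  assumes "f \<in> L2 \<Omega>" shows "integrable (lebesgue_on \<Omega>) f"
proof -
  interpret finite_measure "lebesgue_on \<Omega>"
    using op bd by (intro finite_measure_lebesgue_on bounded_set_imp_lmeasurable) auto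
  have "(\<lambda>x. 1 :: real) \<in> L2 \<Omega>" by (simp add: L2_def)
  from L2_inner_integrable[OF assms this] show ?thesis by simp
qed

text \<open>Each entry of G - H integrates to 0 against all test functions, and it is integrable
  because L2 lies in L1 here, so the fundamental lemma applies. This makes the choice in
  \<open>wgrad\<close> harmless inside integrals.\<close>

lemma is_weak_grad_unique:
  assumes "is_weak_grad \<Omega> u G" "is_weak_grad \<Omega> u H" and L2: "G \<in> L2 \<Omega>" "H \<in> L2 \<Omega>"
  shows "AE x in lebesgue_on \<Omega>. G x = H x"
proof -
  have "AE x in lebesgue_on \<Omega>. G x $ i $ j - H x $ i $ j = 0" for i j
  proof (rule AE_eq_0_if_integral_test_eq_0[OF op])
    show "integrable (lebesgue_on \<Omega>) (\<lambda>x. G x $ i $ j - H x $ i $ j)"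
      by (intro L2_imp_integrable L2_diff L2_component L2)
    show "integral\<^sup>L (lebesgue_on \<Omega>) (\<lambda>x. (G x $ i $ j - H x $ i $ j) * \<psi> x) = 0"
      if "test_function \<Omega> \<psi>" for \<psi>
    proof -
      have "integral\<^sup>L (lebesgue_on \<Omega>) (\<lambda>x. G x $ i $ j * \<psi> x) = integral\<^sup>L (lebesgue_on \<Omega>) (\<lambda>x. H x $ i $ j * \<psi> x)"
        using assms(1)[unfolded is_weak_grad_def, rule_format, OF that, of i j]
          assms(2)[unfolded is_weak_grad_def, rule_format, OF that, of i j] by simp
      then show ?thesis
        using that by (simp add: left_diff_distrib integrable_mult_test[OF op] L2_component L2)
    qed
  qed
  then have "AE x in lebesgue_on \<Omega>. \<forall>i\<in>UNIV. \<forall>j\<in>UNIV. G x $ i $ j - H x $ i $ j = 0"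
    by (intro AE_finite_allI) auto
  then show ?thesis by (rule eventually_mono) (simp add: vec_eq_iff)
qed

lemma wgrad_eqI:
  assumes "u \<in> L2 \<Omega>" "G \<in> L2 \<Omega>" "is_weak_grad \<Omega> u G"
  shows "u \<in> H1 \<Omega>" "AE x in lebesgue_on \<Omega>. wgrad \<Omega> u x = G x"
proof -
  show u: "u \<in> H1 \<Omega>" using assms by (auto simp: H1_def)
  show "AE x in lebesgue_on \<Omega>. wgrad \<Omega> u x = G x"
    by (rule is_weak_grad_unique[OF is_weak_grad_wgrad[OF u] assms(3) wgrad_L2[OF u] assms(2)])
qed

lemma
  assumes "u \<in> H1 \<Omega>" "v \<in> H1 \<Omega>"
  shows H1_add: "(\<lambda>x. u x + v x) \<in> H1 \<Omega>"
    and wgrad_add: "AE x in lebesgue_on \<Omega>. wgrad \<Omega> (\<lambda>x. u x + v x) x = wgrad \<Omega> u x + wgrad \<Omega> v x"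
proof -
  have *: "(\<lambda>x. u x + v x) \<in> L2 \<Omega>" "(\<lambda>x. wgrad \<Omega> u x + wgrad \<Omega> v x) \<in> L2 \<Omega>"
    "is_weak_grad \<Omega> (\<lambda>x. u x + v x) (\<lambda>x. wgrad \<Omega> u x + wgrad \<Omega> v x)"
    by (intro L2_add is_weak_grad_add[OF op] is_weak_grad_wgrad wgrad_L2 H1_L2 assms)+
  show "(\<lambda>x. u x + v x) \<in> H1 \<Omega>"
    "AE x in lebesgue_on \<Omega>. wgrad \<Omega> (\<lambda>x. u x + v x) x = wgrad \<Omega> u x + wgrad \<Omega> v x"
    using wgrad_eqI[OF *] by auto
qed

lemma
  assumes "u \<in> H1 \<Omega>"
  shows H1_scaleR: "(\<lambda>x. c *\<^sub>R u x) \<in> H1 \<Omega>"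
    and wgrad_scaleR: "AE x in lebesgue_on \<Omega>. wgrad \<Omega> (\<lambda>x. c *\<^sub>R u x) x = c *\<^sub>R wgrad \<Omega> u x"
proof -
  have *: "(\<lambda>x. c *\<^sub>R u x) \<in> L2 \<Omega>" "(\<lambda>x. c *\<^sub>R wgrad \<Omega> u x) \<in> L2 \<Omega>"
    "is_weak_grad \<Omega> (\<lambda>x. c *\<^sub>R u x) (\<lambda>x. c *\<^sub>R wgrad \<Omega> u x)"
    by (intro L2_scaleR is_weak_grad_scaleR is_weak_grad_wgrad wgrad_L2 H1_L2 assms)+
  show "(\<lambda>x. c *\<^sub>R u x) \<in> H1 \<Omega>"
    "AE x in lebesgue_on \<Omega>. wgrad \<Omega> (\<lambda>x. c *\<^sub>R u x) x = c *\<^sub>R wgrad \<Omega> u x"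
    using wgrad_eqI[OF *] by auto
qed

lemma
  assumes "test_field \<Omega> \<psi>"
  shows H1_test_field: "\<psi> \<in> H1 \<Omega>"
    and wgrad_test_field: "AE x in lebesgue_on \<Omega>. wgrad \<Omega> \<psi> x = field_grad \<psi> x"
  using wgrad_eqI[OF test_field_L2[OF op assms] field_grad_L2[OF op assms]
      is_weak_grad_test_field[OF op assms]] by auto

lemma l2_norm_wgrad_scaleR:
  assumes "u \<in> H1 \<Omega>"
  shows "l2_norm \<Omega> (wgrad \<Omega> (\<lambda>x. c *\<^sub>R u x)) = \<bar>c\<bar> * l2_norm \<Omega> (wgrad \<Omega> u)"
proof -
  have "l2_inner \<Omega> (wgrad \<Omega> (\<lambda>x. c *\<^sub>R u x)) (wgrad \<Omega> (\<lambda>x. c *\<^sub>R u x))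
      = l2_inner \<Omega> (\<lambda>x. c *\<^sub>R wgrad \<Omega> u x) (\<lambda>x. c *\<^sub>R wgrad \<Omega> u x)"
    by (intro l2_inner_cong_AE wgrad_scaleR wgrad_L2 L2_scaleR H1_scaleR assms)
  then show ?thesis
    by (simp add: l2_norm_def l2_norm_scaleR[unfolded l2_norm_def])
qed

lemma l2_inner_wgrad_add_left:
  assumes "u \<in> H1 \<Omega>" "v \<in> H1 \<Omega>" "G \<in> L2 \<Omega>"
  shows "l2_inner \<Omega> (wgrad \<Omega> (\<lambda>x. u x + v x)) G = l2_inner \<Omega> (wgrad \<Omega> u) G + l2_inner \<Omega> (wgrad \<Omega> v) G"
proof -
  have "l2_inner \<Omega> (wgrad \<Omega> (\<lambda>x. u x + v x)) G = l2_inner \<Omega> (\<lambda>x. wgrad \<Omega> u x + wgrad \<Omega> v x) G"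
    by (intro l2_inner_cong_AE wgrad_add wgrad_L2 L2_add H1_add assms) auto
  then show ?thesis using assms by (simp add: l2_inner_add_left wgrad_L2)
qed

lemma h1_norm_scaleR: "u \<in> H1 \<Omega> \<Longrightarrow> h1_norm \<Omega> (\<lambda>x. c *\<^sub>R u x) = \<bar>c\<bar> * h1_norm \<Omega> u"
  by (simp add: h1_norm_def l2_norm_scaleR l2_norm_wgrad_scaleR power_mult_distrib real_sqrt_mult
      flip: distrib_left)

lemma h1_norm_add_power2_le:
  assumes "u \<in> H1 \<Omega>" "v \<in> H1 \<Omega>"
  shows "(h1_norm \<Omega> (\<lambda>x. u x + v x))\<^sup>2 \<le> 2 * (h1_norm \<Omega> u)\<^sup>2 + 2 * (h1_norm \<Omega> v)\<^sup>2"
proof -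
  have "l2_inner \<Omega> (wgrad \<Omega> (\<lambda>x. u x + v x)) (wgrad \<Omega> (\<lambda>x. u x + v x))
      = l2_inner \<Omega> (\<lambda>x. wgrad \<Omega> u x + wgrad \<Omega> v x) (\<lambda>x. wgrad \<Omega> u x + wgrad \<Omega> v x)"
    by (intro l2_inner_cong_AE wgrad_add wgrad_L2 L2_add H1_add assms)
  then have "(l2_norm \<Omega> (wgrad \<Omega> (\<lambda>x. u x + v x)))\<^sup>2 = (l2_norm \<Omega> (\<lambda>x. wgrad \<Omega> u x + wgrad \<Omega> v x))\<^sup>2"
    by (simp add: l2_norm_power2)
  then show ?thesis unfolding h1_norm_power2
    using l2_norm_add_power2_le[OF H1_L2[OF assms(1)] H1_L2[OF assms(2)]]
      l2_norm_add_power2_le[OF wgrad_L2[OF assms(1)] wgrad_L2[OF assms(2)]] by simp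
qed

lemma H1_diff: "u \<in> H1 \<Omega> \<Longrightarrow> v \<in> H1 \<Omega> \<Longrightarrow> (\<lambda>x. u x - v x) \<in> H1 \<Omega>"
  using H1_add[of u "\<lambda>x. (-1) *\<^sub>R v x"] H1_scaleR[of v "-1"] by simp

section \<open>H10 as a vector space\<close>

lemma H10_add:
  assumes "u \<in> H10 \<Omega>" "v \<in> H10 \<Omega>" shows "(\<lambda>x. u x + v x) \<in> H10 \<Omega>"
  unfolding H10_def
proof (intro CollectI conjI allI impI)
  show "(\<lambda>x. u x + v x) \<in> H1 \<Omega>" using assms H1_add H10_H1 by blast
  fix \<epsilon> :: real assume \<epsilon>: "\<epsilon> > 0"
  obtain \<psi> where \<psi>: "test_field \<Omega> \<psi>" "h1_norm \<Omega> (\<lambda>x. u x - \<psi> x) < \<epsilon> / 2"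
    using H10_approx[OF assms(1), of "\<epsilon> / 2"] \<epsilon> by auto
  obtain \<theta> where \<theta>: "test_field \<Omega> \<theta>" "h1_norm \<Omega> (\<lambda>x. v x - \<theta> x) < \<epsilon> / 2"
    using H10_approx[OF assms(2), of "\<epsilon> / 2"] \<epsilon> by auto
  have "(h1_norm \<Omega> (\<lambda>x. (u x - \<psi> x) + (v x - \<theta> x)))\<^sup>2
      \<le> 2 * (h1_norm \<Omega> (\<lambda>x. u x - \<psi> x))\<^sup>2 + 2 * (h1_norm \<Omega> (\<lambda>x. v x - \<theta> x))\<^sup>2"
    using assms \<psi> \<theta> by (intro h1_norm_add_power2_le H1_diff H10_H1 H1_test_field)
  \<comment> \<open>The tolerance \<epsilon>/2 for each summand exactly absorbs the factors 2 of the
    parallelogram bound.\<close>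
  also have "\<dots> < 2 * (\<epsilon> / 2)\<^sup>2 + 2 * (\<epsilon> / 2)\<^sup>2"
    using \<psi>(2) \<theta>(2) by (intro add_strict_mono mult_strict_left_mono power_strict_mono h1_norm_nonneg) auto
  also have "\<dots> = \<epsilon>\<^sup>2" by (simp add: power2_eq_square)
  finally have "h1_norm \<Omega> (\<lambda>x. (u x - \<psi> x) + (v x - \<theta> x)) < \<epsilon>"
    using \<epsilon> by (auto intro: power2_less_imp_less)
  then have "h1_norm \<Omega> (\<lambda>x. u x + v x - (\<psi> x + \<theta> x)) < \<epsilon>"
    by (simp add: algebra_simps)
  then show "\<exists>\<psi>. test_field \<Omega> \<psi> \<and> h1_norm \<Omega> (\<lambda>x. u x + v x - \<psi> x) < \<epsilon>"
    using test_field_add[OF \<psi>(1) \<theta>(1)] by (intro exI[of _ "\<lambda>x. \<psi> x + \<theta> x"] conjI)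
qed

lemma H10_scaleR:
  assumes "u \<in> H10 \<Omega>" shows "(\<lambda>x. c *\<^sub>R u x) \<in> H10 \<Omega>"
  unfolding H10_def
proof (intro CollectI conjI allI impI)
  show "(\<lambda>x. c *\<^sub>R u x) \<in> H1 \<Omega>" using assms H1_scaleR H10_H1 by blast
  fix \<epsilon> :: real assume \<epsilon>: "\<epsilon> > 0"
  \<comment> \<open>The added 1 keeps the tolerance positive and finite when c = 0.\<close>
  obtain \<psi> where \<psi>: "test_field \<Omega> \<psi>" "h1_norm \<Omega> (\<lambda>x. u x - \<psi> x) < \<epsilon> / (\<bar>c\<bar> + 1)"
    using H10_approx[OF assms(1), of "\<epsilon> / (\<bar>c\<bar> + 1)"] \<epsilon> by auto
  have "h1_norm \<Omega> (\<lambda>x. c *\<^sub>R (u x - \<psi> x)) = \<bar>c\<bar> * h1_norm \<Omega> (\<lambda>x. u x - \<psi> x)"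
    using assms \<psi> by (intro h1_norm_scaleR H1_diff H10_H1 H1_test_field)
  also have "\<dots> \<le> (\<bar>c\<bar> + 1) * h1_norm \<Omega> (\<lambda>x. u x - \<psi> x)"
    by (intro mult_right_mono h1_norm_nonneg) auto
  also have "\<dots> < \<epsilon>" using \<psi>(2) by (simp add: field_simps)
  finally have "h1_norm \<Omega> (\<lambda>x. c *\<^sub>R u x - c *\<^sub>R \<psi> x) < \<epsilon>"
    by (simp add: scaleR_diff_right)
  then show "\<exists>\<psi>. test_field \<Omega> \<psi> \<and> h1_norm \<Omega> (\<lambda>x. c *\<^sub>R u x - \<psi> x) < \<epsilon>"
    using test_field_scaleR[OF \<psi>(1)] by (intro exI[of _ "\<lambda>x. c *\<^sub>R \<psi> x"] conjI)
qed

lemma H10_diff: "u \<in> H10 \<Omega> \<Longrightarrow> v \<in> H10 \<Omega> \<Longrightarrow> (\<lambda>x. u x - v x) \<in> H10 \<Omega>"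
  using H10_add[of u "\<lambda>x. (-1) *\<^sub>R v x"] H10_scaleR[of v "-1"] by simp

text \<open>\<open>wgrad\<close> of the zero field is an arbitrary choice that vanishes only almost
  everywhere; homogeneity with the scalar 0 avoids looking at it.\<close>

lemma h1_norm_zero: "h1_norm \<Omega> (\<lambda>x. 0) = 0"
proof -
  have "(\<lambda>x. 0) \<in> H1 \<Omega>" 
    unfolding H1_def by (intro CollectI conjI bexI[of _ "\<lambda>x. 0"] L2_zero is_weak_grad_zero)
  from h1_norm_scaleR[OF this, of 0] show ?thesis by simp
qed

lemma H10_test_field: "test_field \<Omega> \<psi> \<Longrightarrow> \<psi> \<in> H10 \<Omega>"
  unfolding H10_def using H1_test_field[of \<psi>] h1_norm_zero
  by (intro CollectI conjI allI impI exI[of _ \<psi>]) simp_all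

lemma H10_zero: "(\<lambda>x. 0) \<in> H10 \<Omega>"
  by (intro H10_test_field) (simp add: test_field_def test_function_zero)

lemma H10_sum: "finite I \<Longrightarrow> (\<And>i. i \<in> I \<Longrightarrow> f i \<in> H10 \<Omega>) \<Longrightarrow> (\<lambda>x. \<Sum>i\<in>I. f i x) \<in> H10 \<Omega>"
  by (induction I rule: finite_induct) (auto intro: H10_zero H10_add)

section \<open>Divergence-free fields\<close>

lemma divergence_free_add:
  assumes "u \<in> H1 \<Omega>" "v \<in> H1 \<Omega>" "divergence_free \<Omega> u" "divergence_free \<Omega> v"
  shows "divergence_free \<Omega> (\<lambda>x. u x + v x)"
  using assms(3,4) wgrad_add[OF assms(1,2)] unfolding divergence_free_def
  by eventually_elim (simp add: sum.distrib)

lemma divergence_free_scaleR: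
  assumes "u \<in> H1 \<Omega>" "divergence_free \<Omega> u"
  shows "divergence_free \<Omega> (\<lambda>x. c *\<^sub>R u x)"
  using assms(2) wgrad_scaleR[OF assms(1), of c] unfolding divergence_free_def
  by eventually_elim (simp flip: sum_distrib_left)

lemma divergence_free_zero: "divergence_free \<Omega> (\<lambda>x. 0)"
  using wgrad_scaleR[of "\<lambda>x. 0" 0] H10_H1[OF H10_zero] unfolding divergence_free_def
  by (auto elim!: AE_mp)

lemma divergence_free_sum:
  "finite I \<Longrightarrow> (\<And>i. i \<in> I \<Longrightarrow> f i \<in> H10 \<Omega> \<and> divergence_free \<Omega> (f i)) \<Longrightarrow>
    divergence_free \<Omega> (\<lambda>x. \<Sum>i\<in>I. f i x)"
  by (induction I rule: finite_induct)
    (auto intro!: divergence_free_zero divergence_free_add H10_H1 H10_sum)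

end

section \<open>Ladyzhenskaya's inequality\<close>

text \<open>The derivative 2 f f' of f^2 is integrated from a zero of f up to t. Extending the
  integral to the whole line removes t from the right-hand side, which later decouples the
  variables.\<close>

lemma compact_support_square_le_nn_integral:
  fixes f f' :: "real \<Rightarrow> real"
  assumes f: "\<And>t. (f has_real_derivative f' t) (at t)" and f': "continuous_on UNIV f'"
    and R: "\<And>t. t \<le> - R \<Longrightarrow> f t = 0"
  shows "ennreal ((f t)\<^sup>2) \<le> (\<integral>\<^sup>+s. ennreal (2 * \<bar>f s\<bar> * \<bar>f' s\<bar>) \<partial>lborel)"
proof -
  \<comment> \<open>The minimum covers a point t that itself lies left of - R; the interval of
    integration then shrinks to a point.\<close>
  define a where "a = min (- R) t"
  have a: "a \<le> t" "f a = 0" using R by (auto simp: a_def)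
  have fc: "continuous_on A f" for A
    using f DERIV_continuous_on has_field_derivative_at_within by blast
  have c: "continuous_on {a..t} (\<lambda>s. 2 * f s * f' s)"
    by (intro continuous_intros fc continuous_on_subset[OF f']) auto
  have "integral\<^sup>L lborel (\<lambda>s. indicator {a..t} s *\<^sub>R (2 * f s * f' s)) = (f t)\<^sup>2 - (f a)\<^sup>2"
  proof (rule integral_FTC_atLeastAtMost[OF a(1) _ c])
    fix s
    have "((\<lambda>s. (f s)\<^sup>2) has_real_derivative 2 * f s * f' s) (at s within {a..t})"
      by (rule has_field_derivative_at_within) (auto intro!: derivative_eq_intros f)
    then show "((\<lambda>s. (f s)\<^sup>2) has_vector_derivative 2 * f s * f' s) (at s within {a..t})"
      by (rule has_real_derivative_iff_has_vector_derivative[THEN iffD1])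
  qed
  then have "ennreal ((f t)\<^sup>2) = ennreal (norm (integral\<^sup>L lborel (\<lambda>s. indicator {a..t} s *\<^sub>R (2 * f s * f' s))))"
    using a(2) by simp
  also have "\<dots> \<le> (\<integral>\<^sup>+s. ennreal (norm (indicator {a..t} s *\<^sub>R (2 * f s * f' s))) \<partial>lborel)"
    by (intro integral_norm_bound_ennreal borel_integrable_compact c) simp
  also have "\<dots> \<le> (\<integral>\<^sup>+s. ennreal (2 * \<bar>f s\<bar> * \<bar>f' s\<bar>) \<partial>lborel)"
    by (intro nn_integral_mono ennreal_leI) (auto simp: indicator_def abs_mult)
  finally show ?thesis .
qed

text \<open>The bound by A does not depend on x and the bound by B does not depend on y, so the
  integral of their product factors.\<close>

lemma nn_integral_product_square_le:
  fixes P A B :: "real \<Rightarrow> real \<Rightarrow> ennreal"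
  assumes [measurable]: "case_prod A \<in> borel_measurable (lborel \<Otimes>\<^sub>M lborel)"
    "case_prod B \<in> borel_measurable (lborel \<Otimes>\<^sub>M lborel)"
    and A: "\<And>x y. P x y \<le> (\<integral>\<^sup>+s. A s y \<partial>lborel)" and B: "\<And>x y. P x y \<le> (\<integral>\<^sup>+t. B x t \<partial>lborel)"
  shows "(\<integral>\<^sup>+x. \<integral>\<^sup>+y. (P x y)\<^sup>2 \<partial>lborel \<partial>lborel)
    \<le> (\<integral>\<^sup>+x. \<integral>\<^sup>+y. A x y \<partial>lborel \<partial>lborel) * (\<integral>\<^sup>+x. \<integral>\<^sup>+y. B x y \<partial>lborel \<partial>lborel)"
proof -
  have "(\<integral>\<^sup>+x. \<integral>\<^sup>+y. (P x y)\<^sup>2 \<partial>lborel \<partial>lborel)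
      \<le> (\<integral>\<^sup>+x. \<integral>\<^sup>+y. (\<integral>\<^sup>+s. A s y \<partial>lborel) * (\<integral>\<^sup>+t. B x t \<partial>lborel) \<partial>lborel \<partial>lborel)"
    unfolding power2_eq_square by (intro nn_integral_mono mult_mono A B) auto
  also have "\<dots> = (\<integral>\<^sup>+x. (\<integral>\<^sup>+y. \<integral>\<^sup>+s. A s y \<partial>lborel \<partial>lborel) * (\<integral>\<^sup>+t. B x t \<partial>lborel) \<partial>lborel)"
    by (intro nn_integral_cong nn_integral_multc) measurable
  also have "\<dots> = (\<integral>\<^sup>+y. \<integral>\<^sup>+s. A s y \<partial>lborel \<partial>lborel) * (\<integral>\<^sup>+x. \<integral>\<^sup>+t. B x t \<partial>lborel \<partial>lborel)"
    by (intro nn_integral_cmult) measurable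
  also have "(\<integral>\<^sup>+y. \<integral>\<^sup>+s. A s y \<partial>lborel \<partial>lborel) = (\<integral>\<^sup>+x. \<integral>\<^sup>+y. A x y \<partial>lborel \<partial>lborel)"
    by (rule lborel_pair.Fubini') measurable
  finally show ?thesis .
qed

lemma product_sigma_finite_lborel: "product_sigma_finite (\<lambda>_. lborel)"
  by (simp add: product_sigma_finite_def sigma_finite_lborel)

text \<open>Tonelli's theorem through \<open>lborel_eq\<close>, which presents Lebesgue measure as
  the image of a product measure indexed by \<open>Basis\<close>. The basis is only known as a set,
  so names for its elements are a hypothesis.\<close>

lemma nn_integral_lborel_Basis2:
  fixes f :: "'a::euclidean_space \<Rightarrow> ennreal"
  assumes [measurable]: "f \<in> borel_measurable borel" and Basis: "Basis = {b, c}" "b \<noteq> c"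
  shows "(\<integral>\<^sup>+z. f z \<partial>lborel) = (\<integral>\<^sup>+x. \<integral>\<^sup>+y. f (x *\<^sub>R b + y *\<^sub>R c) \<partial>lborel \<partial>lborel)"
proof -
  interpret product_sigma_finite "\<lambda>_::'a. lborel :: real measure" by (rule product_sigma_finite_lborel)
  have "(\<integral>\<^sup>+z. f z \<partial>lborel) = (\<integral>\<^sup>+w. f (w b *\<^sub>R b + w c *\<^sub>R c) \<partial>(\<Pi>\<^sub>M b\<in>{b, c}. lborel))"
    by (subst lborel_eq) (simp add: nn_integral_distr Basis)
  also have "\<dots> = (\<integral>\<^sup>+x. \<integral>\<^sup>+w. f (x *\<^sub>R b + w c *\<^sub>R c) \<partial>(\<Pi>\<^sub>M b\<in>{c}. lborel) \<partial>lborel)"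
    using Basis(2) by (subst product_nn_integral_insert_rev) auto
  also have "\<dots> = (\<integral>\<^sup>+x. \<integral>\<^sup>+y. f (x *\<^sub>R b + y *\<^sub>R c) \<partial>lborel \<partial>lborel)"
    by (intro nn_integral_cong product_nn_integral_singleton) simp
  finally show ?thesis .
qed

lemma nn_integral_lborel_Basis3:
  fixes f :: "'a::euclidean_space \<Rightarrow> ennreal"
  assumes [measurable]: "f \<in> borel_measurable borel"
    and Basis: "Basis = {a, b, c}" "a \<noteq> b" "b \<noteq> c" "a \<noteq> c"
  shows "(\<integral>\<^sup>+z. f z \<partial>lborel) = (\<integral>\<^sup>+z. \<integral>\<^sup>+x. \<integral>\<^sup>+y. f (z *\<^sub>R a + x *\<^sub>R b + y *\<^sub>R c) \<partial>lborel \<partial>lborel \<partial>lborel)"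
proof -
  interpret product_sigma_finite "\<lambda>_::'a. lborel :: real measure" by (rule product_sigma_finite_lborel)
  have "(\<integral>\<^sup>+z. f z \<partial>lborel) = (\<integral>\<^sup>+w. f (w a *\<^sub>R a + w b *\<^sub>R b + w c *\<^sub>R c) \<partial>(\<Pi>\<^sub>M b\<in>{a, b, c}. lborel))"
    by (subst lborel_eq) (simp add: nn_integral_distr Basis add.assoc)
  also have "\<dots> = (\<integral>\<^sup>+z. \<integral>\<^sup>+w. f (z *\<^sub>R a + w b *\<^sub>R b + w c *\<^sub>R c) \<partial>(\<Pi>\<^sub>M b\<in>{b, c}. lborel) \<partial>lborel)"
    using Basis(2-) by (subst product_nn_integral_insert_rev) auto
  also have "\<dots> = (\<integral>\<^sup>+z. \<integral>\<^sup>+x. \<integral>\<^sup>+w. f (z *\<^sub>R a + x *\<^sub>R b + w c *\<^sub>R c) \<partial>(\<Pi>\<^sub>M b\<in>{c}. lborel) \<partial>lborel \<partial>lborel)"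
    using Basis(2-) by (intro nn_integral_cong, subst product_nn_integral_insert_rev) auto
  also have "\<dots> = (\<integral>\<^sup>+z. \<integral>\<^sup>+x. \<integral>\<^sup>+y. f (z *\<^sub>R a + x *\<^sub>R b + y *\<^sub>R c) \<partial>lborel \<partial>lborel \<partial>lborel)"
    by (intro nn_integral_cong product_nn_integral_singleton) simp
  finally show ?thesis .
qed

definition grad_norm :: "(real ^ 'q \<Rightarrow> real) \<Rightarrow> real ^ 'q \<Rightarrow> real" where
  "grad_norm f x = sqrt (\<Sum>b\<in>Basis. (frechet_derivative f (at x) b)\<^sup>2)"

lemma abs_derivative_le_grad_norm:
  assumes "b \<in> Basis" shows "\<bar>frechet_derivative f (at x) b\<bar> \<le> grad_norm f x"
proof -
  have "(frechet_derivative f (at x) b)\<^sup>2 \<le> (\<Sum>b\<in>Basis. (frechet_derivative f (at x) b)\<^sup>2)"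
    using assms by (intro member_le_sum) auto
  then show ?thesis unfolding grad_norm_def by (metis real_sqrt_abs real_sqrt_le_mono)
qed

lemma grad_norm_nonneg: "0 \<le> grad_norm f x"
  by (simp add: grad_norm_def sum_nonneg)

text \<open>Replacing the directional derivative by the length of the full gradient gives one
  integrand that serves all directions b.\<close>

lemma test_function_square_le_line_integral:
  assumes f: "test_function \<Omega> f" and b: "b \<in> Basis"
  shows "ennreal ((f (t *\<^sub>R b + w))\<^sup>2)
    \<le> (\<integral>\<^sup>+s. ennreal (2 * \<bar>f (s *\<^sub>R b + w)\<bar> * grad_norm f (s *\<^sub>R b + w)) \<partial>lborel)"
proof -
  obtain K where K: "\<And>k. Ck k f" "compact K" "K \<subseteq> \<Omega>" "\<And>x. x \<notin> K \<Longrightarrow> f x = 0"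
    using f by (rule test_functionE) blast
  obtain B where B: "\<And>x. x \<in> K \<Longrightarrow> norm x \<le> B"
    using K(2) compact_imp_bounded bounded_pos by metis
  have z: "f (t *\<^sub>R b + w) = 0" if "t \<le> - (B + norm w + 1)" for t
  proof -
    have "norm (t *\<^sub>R b) - norm w \<le> norm (t *\<^sub>R b + w)"
      using norm_triangle_ineq4[of "t *\<^sub>R b + w" w] by simp
    moreover have "norm (t *\<^sub>R b) = \<bar>t\<bar>" using b by simp
    ultimately have "norm (t *\<^sub>R b + w) > B" using that by linarith
    then show ?thesis using B K(4) by force
  qed
  have c: "continuous_on UNIV (\<lambda>s. frechet_derivative f (at (s *\<^sub>R b + w)) b)"
    by (rule continuous_on_compose2[OF Ck_imp_continuous_on[OF test_function_Ck[OF
            test_function_derivative[OF f b], of 0], of UNIV]])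
      (auto intro!: continuous_intros)
  have "ennreal ((f (t *\<^sub>R b + w))\<^sup>2)
    \<le> (\<integral>\<^sup>+s. ennreal (2 * \<bar>f (s *\<^sub>R b + w)\<bar> * \<bar>frechet_derivative f (at (s *\<^sub>R b + w)) b\<bar>) \<partial>lborel)"
    by (rule compact_support_square_le_nn_integral[OF test_function_line_derivative[OF f] c z])
  also have "\<dots> \<le> (\<integral>\<^sup>+s. ennreal (2 * \<bar>f (s *\<^sub>R b + w)\<bar> * grad_norm f (s *\<^sub>R b + w)) \<partial>lborel)"
    by (intro nn_integral_mono ennreal_leI mult_left_mono abs_derivative_le_grad_norm b) auto
  finally show ?thesis .
qed

text \<open>Ladyzhenskaya's argument: two line integrals bound the fourth power on a plane; in three
  dimensions the remaining supremum over planes of the squared \<open>L\<^sup>2\<close> norm is bounded by a line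
  integral in the normal direction.\<close>

lemma nn_integral_test_function_power4_le:
  fixes f :: "real ^ 'q \<Rightarrow> real"
  assumes card: "CARD('q) \<in> {2, 3}" and f: "test_function \<Omega> f"
  shows "(\<integral>\<^sup>+x. ennreal ((f x) ^ 4) \<partial>lborel)
    \<le> 4 * (\<integral>\<^sup>+x. ennreal ((f x)\<^sup>2 + (grad_norm f x)\<^sup>2) \<partial>lborel)\<^sup>2"
proof -
  define H where "H = (\<integral>\<^sup>+x. ennreal ((f x)\<^sup>2 + (grad_norm f x)\<^sup>2) \<partial>lborel)"
  define p where "p x = ennreal \<bar>f x\<bar>" for x
  define g where "g x = ennreal (grad_norm f x)" for x
  \<comment> \<open>K dominates the absolute value of every partial derivative of f^2.\<close>
  define K where "K x = 2 * p x * g x" for x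
  have fm[measurable]: "f \<in> borel_measurable borel"
    using test_function_Ck[OF f, of 0] by (intro borel_measurable_continuous_onI) simp
  have dm: "(\<lambda>x. frechet_derivative f (at x) b) \<in> borel_measurable borel" if "b \<in> Basis" for b
    using test_function_Ck[OF test_function_derivative[OF f that], of 0]
    by (intro borel_measurable_continuous_onI) simp
  have gm[measurable]: "grad_norm f \<in> borel_measurable borel"
    unfolding grad_norm_def using dm by measurable
  have [measurable]: "p \<in> borel_measurable borel" "g \<in> borel_measurable borel"
    unfolding p_def g_def by measurable
  then have [measurable]: "K \<in> borel_measurable borel" unfolding K_def by measurable
  have p2: "(p x)\<^sup>2 = ennreal ((f x)\<^sup>2)" and g2: "(g x)\<^sup>2 = ennreal ((grad_norm f x)\<^sup>2)" for x
    by (simp_all add: p_def g_def ennreal_power grad_norm_nonneg)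
  have p4: "ennreal ((f x) ^ 4) = ((p x)\<^sup>2)\<^sup>2" for x
    by (simp add: p2 ennreal_power)
  have K: "K x = ennreal (2 * \<bar>f x\<bar> * grad_norm f x)" for x
    by (simp add: K_def p_def g_def ennreal_mult' grad_norm_nonneg)
  have line: "(p (t *\<^sub>R b + w))\<^sup>2 \<le> (\<integral>\<^sup>+s. K (s *\<^sub>R b + w) \<partial>lborel)" if "b \<in> Basis" for t b w
    using test_function_square_le_line_integral[OF f that] unfolding p2 K .
  have KH: "(\<integral>\<^sup>+x. K x \<partial>lborel) \<le> H"
    unfolding K H_def
    using sum_squares_bound[of "\<bar>f _\<bar>" "grad_norm f _"] by (intro nn_integral_mono ennreal_leI) simp
  have gH: "(\<integral>\<^sup>+x. (g x)\<^sup>2 \<partial>lborel) \<le> H"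
    unfolding g2 H_def by (intro nn_integral_mono ennreal_leI) simp
  have plane: "(\<integral>\<^sup>+x. \<integral>\<^sup>+y. ((p (w + x *\<^sub>R b + y *\<^sub>R c))\<^sup>2)\<^sup>2 \<partial>lborel \<partial>lborel)
      \<le> (\<integral>\<^sup>+x. \<integral>\<^sup>+y. K (w + x *\<^sub>R b + y *\<^sub>R c) \<partial>lborel \<partial>lborel)\<^sup>2"
    if "b \<in> Basis" "c \<in> Basis" for w b c
    unfolding power2_eq_square[of "\<integral>\<^sup>+x. \<integral>\<^sup>+y. K (w + x *\<^sub>R b + y *\<^sub>R c) \<partial>lborel \<partial>lborel"]
  proof (rule nn_integral_product_square_le)
    show "(p (w + x *\<^sub>R b + y *\<^sub>R c))\<^sup>2 \<le> (\<integral>\<^sup>+s. K (w + s *\<^sub>R b + y *\<^sub>R c) \<partial>lborel)" for x y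
      using line[OF that(1), of x "w + y *\<^sub>R c"] by (simp add: algebra_simps)
    show "(p (w + x *\<^sub>R b + y *\<^sub>R c))\<^sup>2 \<le> (\<integral>\<^sup>+s. K (w + x *\<^sub>R b + s *\<^sub>R c) \<partial>lborel)" for x y
      using line[OF that(2), of y "w + x *\<^sub>R b"] by (simp add: algebra_simps)
  qed measurable
  have card': "card (Basis :: (real ^ 'q) set) = CARD('q)" by simp
  consider "card (Basis :: (real ^ 'q) set) = 2" | "card (Basis :: (real ^ 'q) set) = 3"
    using card card' by auto
  then have "(\<integral>\<^sup>+x. ((p x)\<^sup>2)\<^sup>2 \<partial>lborel) \<le> 4 * H\<^sup>2"
  proof cases
    case 1
    then obtain b c :: "real ^ 'q" where B: "Basis = {b, c}" "b \<noteq> c" unfolding card_2_iff by blast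
    then have bc: "b \<in> Basis" "c \<in> Basis" by auto
    have "(\<integral>\<^sup>+x. ((p x)\<^sup>2)\<^sup>2 \<partial>lborel) \<le> (\<integral>\<^sup>+x. K x \<partial>lborel)\<^sup>2"
      using plane[OF bc, of 0] by (simp add: nn_integral_lborel_Basis2[OF _ B])
    also have "\<dots> \<le> 1 * H\<^sup>2" using KH by (simp add: power_mono)
    also have "\<dots> \<le> 4 * H\<^sup>2" by (intro mult_right_mono) auto
    finally show ?thesis .
  next
    case 2
    then obtain a b c :: "real ^ 'q" where B: "Basis = {a, b, c}" "a \<noteq> b" "b \<noteq> c" "a \<noteq> c"
      unfolding card_3_iff by blast
    then have bc: "b \<in> Basis" "c \<in> Basis" and a: "a \<in> Basis" by auto
    let ?w = "\<lambda>z x y. z *\<^sub>R a + x *\<^sub>R b + y *\<^sub>R c"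
    note split = nn_integral_lborel_Basis3[OF _ B]
    have slab: "(\<integral>\<^sup>+x. \<integral>\<^sup>+y. (p (?w z x y))\<^sup>2 \<partial>lborel \<partial>lborel) \<le> H" for z
    proof -
      have "(\<integral>\<^sup>+x. \<integral>\<^sup>+y. (p (?w z x y))\<^sup>2 \<partial>lborel \<partial>lborel)
          \<le> (\<integral>\<^sup>+x. \<integral>\<^sup>+y. \<integral>\<^sup>+s. K (?w s x y) \<partial>lborel \<partial>lborel \<partial>lborel)"
        using line[OF a] by (intro nn_integral_mono) (simp add: add.assoc)
      also have "\<dots> = (\<integral>\<^sup>+x. \<integral>\<^sup>+s. \<integral>\<^sup>+y. K (?w s x y) \<partial>lborel \<partial>lborel \<partial>lborel)"
        by (intro nn_integral_cong lborel_pair.Fubini') measurable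
      also have "\<dots> = (\<integral>\<^sup>+s. \<integral>\<^sup>+x. \<integral>\<^sup>+y. K (?w s x y) \<partial>lborel \<partial>lborel \<partial>lborel)"
        by (intro lborel_pair.Fubini') measurable
      also have "\<dots> = (\<integral>\<^sup>+x. K x \<partial>lborel)" by (simp add: split)
      finally show ?thesis using KH by simp
    qed
    have "(\<integral>\<^sup>+x. \<integral>\<^sup>+y. ((p (?w z x y))\<^sup>2)\<^sup>2 \<partial>lborel \<partial>lborel)
        \<le> 4 * H * (\<integral>\<^sup>+x. \<integral>\<^sup>+y. (g (?w z x y))\<^sup>2 \<partial>lborel \<partial>lborel)" for z
    proof -
      let ?P = "\<lambda>h. \<integral>\<^sup>+v. h (?w z (fst v) (snd v)) \<partial>(lborel \<Otimes>\<^sub>M lborel)"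
      have it: "(\<integral>\<^sup>+x. \<integral>\<^sup>+y. h (?w z x y) \<partial>lborel \<partial>lborel) = ?P h"
        if [measurable]: "h \<in> borel_measurable borel" for h :: "real ^ 'q \<Rightarrow> ennreal"
        by (subst lborel.nn_integral_fst[symmetric]) auto
      have "(\<integral>\<^sup>+x. \<integral>\<^sup>+y. ((p (?w z x y))\<^sup>2)\<^sup>2 \<partial>lborel \<partial>lborel) \<le> (?P K)\<^sup>2"
        using plane[OF bc, of "z *\<^sub>R a"] by (simp add: it)
      \<comment> \<open>Cauchy-Schwarz on the plane separates the factors 2 p and g of K; the square
        of the 2 is the constant 4 of the conclusion.\<close>
      also have "\<dots> \<le> ?P (\<lambda>x. (2 * p x)\<^sup>2) * ?P (\<lambda>x. (g x)\<^sup>2)"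
        unfolding K_def by (rule Cauchy_Schwarz_nn_integral) measurable
      also have "?P (\<lambda>x. (2 * p x)\<^sup>2) = 4 * ?P (\<lambda>x. (p x)\<^sup>2)"
        by (simp add: power_mult_distrib nn_integral_cmult)
      also have "4 * ?P (\<lambda>x. (p x)\<^sup>2) * ?P (\<lambda>x. (g x)\<^sup>2) \<le> 4 * H * ?P (\<lambda>x. (g x)\<^sup>2)"
        using slab[of z] it[of "\<lambda>x. (p x)\<^sup>2"] by (intro mult_right_mono mult_left_mono) auto
      finally show ?thesis using it[of "\<lambda>x. (g x)\<^sup>2"] by simp
    qed
    \<comment> \<open>The bound H on the squares of p is uniform in z, so only the gradient factor
      remains to be integrated over the planes.\<close>
    then have "(\<integral>\<^sup>+x. ((p x)\<^sup>2)\<^sup>2 \<partial>lborel)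
        \<le> (\<integral>\<^sup>+z. 4 * H * (\<integral>\<^sup>+x. \<integral>\<^sup>+y. (g (?w z x y))\<^sup>2 \<partial>lborel \<partial>lborel) \<partial>lborel)"
      by (simp add: split nn_integral_mono)
    also have "\<dots> = 4 * H * (\<integral>\<^sup>+x. (g x)\<^sup>2 \<partial>lborel)"
      by (subst nn_integral_cmult) (simp_all add: split)
    also have "\<dots> \<le> 4 * H * H" using gH by (intro mult_left_mono) auto
    finally show ?thesis by (simp add: power2_eq_square mult.assoc)
  qed
  then show ?thesis unfolding p4 H_def .
qed

section \<open>The convective form\<close>

text \<open>Signs, unlike sums, pass through an integral with no integrability assumption: both
  sides are 0 together if the integrals do not exist.\<close>

lemma trilinear_b_minus_left: "trilinear_b \<Omega> (\<lambda>x. - u x) v w = - trilinear_b \<Omega> u v w"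
  by (simp add: trilinear_b_def l2_inner_def convect_def inner_vec_def matrix_vector_mult_def sum_negf)

lemma trilinear_b_minus_right: "trilinear_b \<Omega> u v (\<lambda>x. - w x) = - trilinear_b \<Omega> u v w"
  by (simp add: trilinear_b_def l2_inner_def)

lemma Basis_real_vec: "(Basis :: (real ^ 'q) set) = range (\<lambda>j. axis j 1)"
  by (auto simp: Basis_vec_def)

lemma inj_axis_1: "inj (\<lambda>j. axis j (1::real))"
  by (rule injI) (metis axis_eq_axis zero_neq_one)

lemma grad_norm_le_norm_field_grad: "grad_norm (\<lambda>y. \<psi> y $ i) x \<le> norm (field_grad \<psi> x)"
proof -
  have "grad_norm (\<lambda>y. \<psi> y $ i) x = norm (field_grad \<psi> x $ i)"
    by (simp add: grad_norm_def Basis_real_vec sum.reindex[OF inj_axis_1] norm_vec_def L2_set_def field_grad_def)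
  then show ?thesis using Finite_Cartesian_Product.norm_nth_le by metis
qed

lemma l2_norm_wgrad_le_h1_norm: "l2_norm \<Omega> (wgrad \<Omega> u) \<le> h1_norm \<Omega> u"
  by (rule power2_le_imp_le) (auto simp: h1_norm_power2 h1_norm_nonneg)

lemma l2_norm_le_h1_norm: "l2_norm \<Omega> u \<le> h1_norm \<Omega> u"
  by (rule power2_le_imp_le) (auto simp: h1_norm_power2 h1_norm_nonneg)

context
  fixes \<Omega> :: "(real ^ 'q) set"
  assumes op: "open \<Omega>" and bd: "bounded \<Omega>"
begin

lemma h1_norm_test_field_power2:
  assumes "test_field \<Omega> \<psi>"
  shows "(h1_norm \<Omega> \<psi>)\<^sup>2 = integral\<^sup>L (lebesgue_on \<Omega>) (\<lambda>x. (norm (\<psi> x))\<^sup>2 + (norm (field_grad \<psi> x))\<^sup>2)"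
proof -
  have "l2_inner \<Omega> (wgrad \<Omega> \<psi>) (wgrad \<Omega> \<psi>) = l2_inner \<Omega> (field_grad \<psi>) (field_grad \<psi>)"
    by (intro l2_inner_cong_AE wgrad_test_field[OF op bd] wgrad_L2 H1_test_field[OF op bd] field_grad_L2[OF op] assms)
  then have "(h1_norm \<Omega> \<psi>)\<^sup>2 = l2_inner \<Omega> \<psi> \<psi> + l2_inner \<Omega> (field_grad \<psi>) (field_grad \<psi>)"
    by (simp add: h1_norm_power2 l2_norm_power2)
  also have "\<dots> = integral\<^sup>L (lebesgue_on \<Omega>) (\<lambda>x. \<psi> x \<bullet> \<psi> x + field_grad \<psi> x \<bullet> field_grad \<psi> x)"
    using test_field_L2[OF op assms] field_grad_L2[OF op assms]
    by (simp add: l2_inner_def L2_inner_integrable)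
  finally show ?thesis by (simp add: power2_norm_eq_inner)
qed

lemma nn_integral_test_field_power4_le:
  assumes "CARD('q) \<in> {2, 3}" and \<psi>: "test_field \<Omega> \<psi>"
  shows "(\<integral>\<^sup>+x. ennreal ((\<psi> x $ i) ^ 4) \<partial>lebesgue_on \<Omega>) \<le> 4 * (ennreal ((h1_norm \<Omega> \<psi>)\<^sup>2))\<^sup>2"
proof -
  let ?f = "\<lambda>x. \<psi> x $ i"
  have f: "test_function \<Omega> ?f" using \<psi> by (simp add: test_field_def)
  let ?h = "\<lambda>x. (?f x)\<^sup>2 + (grad_norm ?f x)\<^sup>2"
  \<comment> \<open>Without the square root the integrand is a sum of products of test functions,
    hence a test function itself, and its integral moves freely between \<open>lborel\<close> and
    \<Omega>.\<close>
  have "?h = (\<lambda>x. ?f x * ?f x + (\<Sum>b\<in>Basis. frechet_derivative ?f (at x) b * frechet_derivative ?f (at x) b))"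
    by (simp add: grad_norm_def sum_nonneg power2_eq_square)
  moreover have "test_function \<Omega> \<dots>"
    by (intro test_function_add test_function_sum test_function_mult test_function_derivative f) auto
  ultimately have h: "test_function \<Omega> ?h" by simp
  have "(\<integral>\<^sup>+x. ennreal ((?f x) ^ 4) \<partial>lebesgue_on \<Omega>) \<le> (\<integral>\<^sup>+x. ennreal ((?f x) ^ 4) \<partial>lebesgue)"
    using op by (subst nn_integral_restrict_space) (auto intro!: nn_integral_mono simp: indicator_def)
  also have "\<dots> = (\<integral>\<^sup>+x. ennreal ((?f x) ^ 4) \<partial>lborel)" by (rule nn_integral_completion)
  also have "\<dots> \<le> 4 * (\<integral>\<^sup>+x. ennreal (?h x) \<partial>lborel)\<^sup>2"
    by (rule nn_integral_test_function_power4_le[OF assms(1) f])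
  also have "(\<integral>\<^sup>+x. ennreal (?h x) \<partial>lborel) = ennreal (integral\<^sup>L lborel ?h)"
    by (rule nn_integral_eq_integral[OF test_function_integrable(1)[OF op h]]) auto
  also have "integral\<^sup>L lborel ?h = integral\<^sup>L (lebesgue_on \<Omega>) ?h"
    using test_function_integrable(3)[OF op h] by simp
  also have "4 * (ennreal (integral\<^sup>L (lebesgue_on \<Omega>) ?h))\<^sup>2 \<le> 4 * (ennreal ((h1_norm \<Omega> \<psi>)\<^sup>2))\<^sup>2"
  proof (intro mult_left_mono power_mono ennreal_leI)
    show "integral\<^sup>L (lebesgue_on \<Omega>) ?h \<le> (h1_norm \<Omega> \<psi>)\<^sup>2"
      unfolding h1_norm_test_field_power2[OF \<psi>]
    proof (rule integral_mono)
      show "integrable (lebesgue_on \<Omega>) ?h" by (rule test_function_integrable(2)[OF op h])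
      show "integrable (lebesgue_on \<Omega>) (\<lambda>x. (norm (\<psi> x))\<^sup>2 + (norm (field_grad \<psi> x))\<^sup>2)"
        using test_field_L2[OF op \<psi>] field_grad_L2[OF op \<psi>] by (simp add: L2_def)
      show "?h x \<le> (norm (\<psi> x))\<^sup>2 + (norm (field_grad \<psi> x))\<^sup>2" for x
        using component_le_norm_cart[of "\<psi> x" i] grad_norm_le_norm_field_grad[of \<psi> i x]
        by (intro add_mono) (auto simp: abs_le_square_iff[symmetric] abs_of_nonneg[OF grad_norm_nonneg])
    qed
  qed auto
  finally show ?thesis .
qed

text \<open>Along an approximating sequence of test fields the integrals of the fourth powers are
  bounded in terms of H1 norms, which stay bounded; almost everywhere convergence then gives the
  limit by Fatou's lemma.\<close>

lemma H10_component_power4_integrable: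
  assumes card: "CARD('q) \<in> {2, 3}" and u: "u \<in> H10 \<Omega>"
  shows "integrable (lebesgue_on \<Omega>) (\<lambda>x. (u x $ i) ^ 4)"
proof -
  have uL2: "u \<in> L2 \<Omega>" using u by (intro H1_L2 H10_H1)
  have "\<forall>k. \<exists>\<psi>. test_field \<Omega> \<psi> \<and> h1_norm \<Omega> (\<lambda>x. u x - \<psi> x) < 1 / real (Suc k)"
    using u by (auto simp: H10_def)
  then obtain \<psi> where \<psi>: "\<And>k. test_field \<Omega> (\<psi> k)"
    and h: "\<And>k. h1_norm \<Omega> (\<lambda>x. u x - \<psi> k x) < 1 / real (Suc k)" by metis
  define w where "w k x = (u x $ i - \<psi> k x $ i)\<^sup>2" for k x
  have d: "(\<lambda>x. u x - \<psi> k x) \<in> L2 \<Omega>" for k by (intro L2_diff uL2 test_field_L2[OF op \<psi>])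
  have w: "integrable (lebesgue_on \<Omega>) (w k)" for k
    using L2_component[OF d, of k i] unfolding w_def L2_def by simp
  have "integral\<^sup>L (lebesgue_on \<Omega>) (w k) \<le> (1 / real (Suc k))\<^sup>2" for k
  proof -
    have "integral\<^sup>L (lebesgue_on \<Omega>) (w k) \<le> integral\<^sup>L (lebesgue_on \<Omega>) (\<lambda>x. (u x - \<psi> k x) \<bullet> (u x - \<psi> k x))"
    proof (rule integral_mono[OF w L2_inner_integrable[OF d d]])
      show "w k x \<le> (u x - \<psi> k x) \<bullet> (u x - \<psi> k x)" for x
        using component_le_norm_cart[of "u x - \<psi> k x" i] abs_le_square_iff[of "(u x - \<psi> k x) $ i" "norm (u x - \<psi> k x)"]
        by (simp add: w_def power2_norm_eq_inner)
    qed
    also have "\<dots> = (l2_norm \<Omega> (\<lambda>x. u x - \<psi> k x))\<^sup>2" unfolding l2_norm_power2 l2_inner_def ..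
    also have "\<dots> \<le> (1 / real (Suc k))\<^sup>2"
      using l2_norm_le_h1_norm[of \<Omega> "\<lambda>x. u x - \<psi> k x"] h[of k] by (intro power_mono l2_norm_nonneg) linarith
    finally show ?thesis .
  qed
  moreover have "(\<lambda>k. (1 / real (Suc k))\<^sup>2) \<longlonglongrightarrow> 0" by real_asymp
  moreover have "0 \<le> integral\<^sup>L (lebesgue_on \<Omega>) (w k)" for k by (simp add: w_def)
  ultimately have "(\<lambda>k. integral\<^sup>L (lebesgue_on \<Omega>) (w k)) \<longlonglongrightarrow> 0"
    by (rule_tac tendsto_sandwich[OF always_eventually[OF allI] always_eventually[OF allI] tendsto_const])
  then have "(\<lambda>k. integral\<^sup>L (lebesgue_on \<Omega>) (\<lambda>x. norm (w k x))) \<longlonglongrightarrow> 0" by (simp add: w_def[abs_def])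
  \<comment> \<open>The squared differences tend to 0 in L1, so along a subsequence they do so
    almost everywhere, as Fatou's lemma requires.\<close>
  from tendsto_L1_AE_subseq[OF w this] obtain r
    where r: "AE x in lebesgue_on \<Omega>. (\<lambda>k. w (r k) x) \<longlonglongrightarrow> 0" by blast
  \<comment> \<open>Every approximation error is at most 1, so the parallelogram bound for
    \<open>\<psi> k = u - (u - \<psi> k)\<close> gives this value for all k at once.\<close>
  define c where "c = 2 * (h1_norm \<Omega> u)\<^sup>2 + 2"
  have hb: "(h1_norm \<Omega> (\<psi> k))\<^sup>2 \<le> c" for k
  proof -
    have uH: "u \<in> H1 \<Omega>" using u by (rule H10_H1)
    have dH: "(\<lambda>x. u x - \<psi> k x) \<in> H1 \<Omega>" by (intro H1_diff[OF op bd] uH H1_test_field[OF op bd] \<psi>)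
    have "(h1_norm \<Omega> (\<lambda>x. u x + (-1) *\<^sub>R (u x - \<psi> k x)))\<^sup>2
        \<le> 2 * (h1_norm \<Omega> u)\<^sup>2 + 2 * (h1_norm \<Omega> (\<lambda>x. (-1) *\<^sub>R (u x - \<psi> k x)))\<^sup>2"
      by (intro h1_norm_add_power2_le[OF op bd] uH H1_scaleR[OF op bd] dH)
    also have "h1_norm \<Omega> (\<lambda>x. (-1) *\<^sub>R (u x - \<psi> k x)) = h1_norm \<Omega> (\<lambda>x. u x - \<psi> k x)"
      using h1_norm_scaleR[OF op bd dH, of "-1"] by simp
    also have "2 * (h1_norm \<Omega> u)\<^sup>2 + 2 * (h1_norm \<Omega> (\<lambda>x. u x - \<psi> k x))\<^sup>2 \<le> 2 * (h1_norm \<Omega> u)\<^sup>2 + 2 * 1\<^sup>2"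
    proof (intro add_left_mono mult_left_mono power_mono h1_norm_nonneg)
      have "1 / real (Suc k) \<le> 1" by simp
      then show "h1_norm \<Omega> (\<lambda>x. u x - \<psi> k x) \<le> 1" using h[of k] by linarith
    qed auto
    finally show ?thesis by (simp add: c_def)
  qed
  have psim: "(\<lambda>x. \<psi> k x $ i) \<in> borel_measurable (lebesgue_on \<Omega>)" for k
    using \<psi>[of k] test_field_L2[OF op] L2_component L2_measurable by blast
  have um: "(\<lambda>x. u x $ i) \<in> borel_measurable (lebesgue_on \<Omega>)"
    using uL2 L2_component L2_measurable by blast
  have "(\<integral>\<^sup>+x. ennreal ((u x $ i) ^ 4) \<partial>lebesgue_on \<Omega>)
      = (\<integral>\<^sup>+x. liminf (\<lambda>k. ennreal ((\<psi> (r k) x $ i) ^ 4)) \<partial>lebesgue_on \<Omega>)"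
  proof (rule nn_integral_cong_AE, use r in eventually_elim)
    case (elim x)
    then have "(\<lambda>k. sqrt (w (r k) x)) \<longlonglongrightarrow> sqrt 0" by (rule tendsto_real_sqrt)
    then have "(\<lambda>k. u x $ i - \<psi> (r k) x $ i) \<longlonglongrightarrow> 0"
      by (simp add: w_def tendsto_rabs_zero_iff)
    from tendsto_diff[OF tendsto_const[of "u x $ i"] this]
    have "(\<lambda>k. \<psi> (r k) x $ i) \<longlonglongrightarrow> u x $ i" by simp
    then have "(\<lambda>k. ennreal ((\<psi> (r k) x $ i) ^ 4)) \<longlonglongrightarrow> ennreal ((u x $ i) ^ 4)"
      by (intro tendsto_ennrealI tendsto_power)
    then show ?case by (intro lim_imp_Liminf[symmetric]) auto
  qed
  also have "\<dots> \<le> liminf (\<lambda>k. \<integral>\<^sup>+x. ennreal ((\<psi> (r k) x $ i) ^ 4) \<partial>lebesgue_on \<Omega>)"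
    using psim by (intro nn_integral_liminf) measurable
  also have "\<dots> \<le> limsup (\<lambda>k. \<integral>\<^sup>+x. ennreal ((\<psi> (r k) x $ i) ^ 4) \<partial>lebesgue_on \<Omega>)"
    by (intro Liminf_le_Limsup) auto
  also have "\<dots> \<le> 4 * (ennreal c)\<^sup>2"
  proof (intro Limsup_bounded always_eventually allI)
    fix k
    have "(\<integral>\<^sup>+x. ennreal ((\<psi> (r k) x $ i) ^ 4) \<partial>lebesgue_on \<Omega>) \<le> 4 * (ennreal ((h1_norm \<Omega> (\<psi> (r k)))\<^sup>2))\<^sup>2"
      by (rule nn_integral_test_field_power4_le[OF card \<psi>])
    also have "\<dots> \<le> 4 * (ennreal c)\<^sup>2" by (intro mult_left_mono power_mono ennreal_leI hb) auto
    finally show "(\<integral>\<^sup>+x. ennreal ((\<psi> (r k) x $ i) ^ 4) \<partial>lebesgue_on \<Omega>) \<le> 4 * (ennreal c)\<^sup>2" .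
  qed
  also have "\<dots> < \<infinity>" by (simp add: ennreal_mult_less_top power2_eq_square)
  finally show ?thesis using um unfolding integrable_iff_bounded by simp
qed

text \<open>Instead of the Hoelder inequality with exponents 2, 4, 4, each summand is dominated
  pointwise by |a b c| \<le> a^2 + b^4 + c^4. G is an arbitrary L2 matrix field so that chosen
  gradients, their sums and Jacobians are all covered.\<close>

lemma convect_inner_integrable:
  assumes card: "CARD('q) \<in> {2, 3}" and u: "u \<in> H10 \<Omega>" and w: "w \<in> H10 \<Omega>" and G: "G \<in> L2 \<Omega>"
  shows "integrable (lebesgue_on \<Omega>) (\<lambda>x. (G x *v u x) \<bullet> w x)"
proof -
  have [measurable]: "(\<lambda>x. u x $ i) \<in> borel_measurable (lebesgue_on \<Omega>)"
    "(\<lambda>x. w x $ i) \<in> borel_measurable (lebesgue_on \<Omega>)"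
    "(\<lambda>x. G x $ i $ j) \<in> borel_measurable (lebesgue_on \<Omega>)" for i j
    using L2_component[OF H1_L2[OF H10_H1[OF u]]] L2_component[OF H1_L2[OF H10_H1[OF w]]]
      L2_component[OF L2_component[OF G]] by (auto intro: L2_measurable)
  have "integrable (lebesgue_on \<Omega>) (\<lambda>x. G x $ i $ j * u x $ j * w x $ i)" for i j
  proof (rule Bochner_Integration.integrable_bound)
    show "integrable (lebesgue_on \<Omega>) (\<lambda>x. (G x $ i $ j)\<^sup>2 + (u x $ j) ^ 4 + (w x $ i) ^ 4)"
      using L2_component[OF L2_component[OF G, of i], of j]
      by (intro Bochner_Integration.integrable_add H10_component_power4_integrable card u w) (simp add: L2_def)
    have "\<bar>a * b * c\<bar> \<le> a\<^sup>2 + b ^ 4 + c ^ 4" for a b c :: real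
    proof -
      have 1: "\<bar>x * y\<bar> \<le> x\<^sup>2 + y\<^sup>2" for x y :: real
      proof -
        have "2 * (\<bar>x\<bar> * \<bar>y\<bar>) \<le> x\<^sup>2 + y\<^sup>2"
          using sum_squares_bound[of "\<bar>x\<bar>" "\<bar>y\<bar>"] by (simp only: mult.assoc power2_abs)
        moreover have "0 \<le> \<bar>x\<bar> * \<bar>y\<bar>" by simp
        ultimately show ?thesis unfolding abs_mult by linarith
      qed
      have "\<bar>a * b * c\<bar> \<le> a\<^sup>2 + (b * c)\<^sup>2"
        using 1[of a "b * c"] by (simp add: mult.assoc)
      moreover have "(b * c)\<^sup>2 \<le> (b\<^sup>2)\<^sup>2 + (c\<^sup>2)\<^sup>2"
        using 1[of "b\<^sup>2" "c\<^sup>2"] by (simp add: power_mult_distrib)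
      ultimately show ?thesis by simp
    qed
    then show "AE x in lebesgue_on \<Omega>. norm (G x $ i $ j * u x $ j * w x $ i)
        \<le> norm ((G x $ i $ j)\<^sup>2 + (u x $ j) ^ 4 + (w x $ i) ^ 4)"
      by (intro AE_I2) (simp add: abs_of_nonneg)
  qed measurable
  then have "integrable (lebesgue_on \<Omega>) (\<lambda>x. \<Sum>i\<in>UNIV. \<Sum>j\<in>UNIV. G x $ i $ j * u x $ j * w x $ i)"
    by (intro Bochner_Integration.integrable_sum)
  then show ?thesis by (simp add: inner_vec_def matrix_vector_mult_def sum_distrib_right)
qed

lemma AE_trilinear_b_cong:
  assumes card: "CARD('q) \<in> {2, 3}" and u: "u \<in> H10 \<Omega>" and w: "w \<in> H10 \<Omega>" and v: "v \<in> H1 \<Omega>"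
    and G: "G \<in> L2 \<Omega>" "AE x in lebesgue_on \<Omega>. wgrad \<Omega> v x = G x"
  shows "trilinear_b \<Omega> u v w = integral\<^sup>L (lebesgue_on \<Omega>) (\<lambda>x. (G x *v u x) \<bullet> w x)"
  unfolding trilinear_b_def l2_inner_def convect_def
proof (rule integral_cong_AE)
  show "AE x in lebesgue_on \<Omega>. (wgrad \<Omega> v x *v u x) \<bullet> w x = (G x *v u x) \<bullet> w x"
    using G(2) by eventually_elim simp
qed (use convect_inner_integrable[OF card u w] G(1) wgrad_L2[OF v] in auto)

section \<open>Additivity of the convective form in each argument\<close>

lemma trilinear_b_add_left:
  assumes card: "CARD('q) \<in> {2, 3}" and "u \<in> H10 \<Omega>" "u' \<in> H10 \<Omega>" "v \<in> H1 \<Omega>" "w \<in> H10 \<Omega>"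
  shows "trilinear_b \<Omega> (\<lambda>x. u x + u' x) v w = trilinear_b \<Omega> u v w + trilinear_b \<Omega> u' v w"
  unfolding trilinear_b_def l2_inner_def convect_def using assms
  by (simp add: matrix_vector_right_distrib inner_add_left convect_inner_integrable wgrad_L2)

text \<open>The middle argument enters through \<open>wgrad\<close>, which is additive only almost
  everywhere; hence the detour through \<open>AE_trilinear_b_cong\<close>.\<close>

lemma trilinear_b_add_mid:
  assumes card: "CARD('q) \<in> {2, 3}" and u: "u \<in> H10 \<Omega>" and v: "v \<in> H1 \<Omega>" "v' \<in> H1 \<Omega>" and w: "w \<in> H10 \<Omega>"
  shows "trilinear_b \<Omega> u (\<lambda>x. v x + v' x) w = trilinear_b \<Omega> u v w + trilinear_b \<Omega> u v' w"
proof -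
  have "trilinear_b \<Omega> u (\<lambda>x. v x + v' x) w
      = integral\<^sup>L (lebesgue_on \<Omega>) (\<lambda>x. ((wgrad \<Omega> v x + wgrad \<Omega> v' x) *v u x) \<bullet> w x)"
    by (intro AE_trilinear_b_cong card u w H1_add[OF op bd] L2_add wgrad_L2 wgrad_add[OF op bd] v)
  then show ?thesis unfolding trilinear_b_def l2_inner_def convect_def using assms
    by (simp add: matrix_vector_mult_add_rdistrib inner_add_left convect_inner_integrable wgrad_L2)
qed

lemma trilinear_b_add_right:
  assumes card: "CARD('q) \<in> {2, 3}" and "u \<in> H10 \<Omega>" "v \<in> H1 \<Omega>" "w \<in> H10 \<Omega>" "w' \<in> H10 \<Omega>"
  shows "trilinear_b \<Omega> u v (\<lambda>x. w x + w' x) = trilinear_b \<Omega> u v w + trilinear_b \<Omega> u v w'"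
  unfolding trilinear_b_def l2_inner_def convect_def using assms
  by (simp add: inner_add_right convect_inner_integrable wgrad_L2)

text \<open>The weak divergence of \<open>v\<close> is tested against \<open>\<bar>\<psi>\<bar>\<^sup>2 / 2\<close>.\<close>

lemma trilinear_b_test_field_eq_0:
  assumes card: "CARD('q) \<in> {2, 3}" and v: "v \<in> H10 \<Omega>" "divergence_free \<Omega> v" and \<psi>: "test_field \<Omega> \<psi>"
  shows "trilinear_b \<Omega> v \<psi> \<psi> = 0"
proof -
  define \<theta> where "\<theta> x = (1 / 2) * (\<Sum>i\<in>UNIV. \<psi> x $ i * \<psi> x $ i)" for x
  have f: "test_function \<Omega> (\<lambda>x. \<psi> x $ i)" for i using \<psi> by (simp add: test_field_def)
  have \<theta>: "test_function \<Omega> \<theta>" unfolding \<theta>_def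
    by (intro test_function_cmult test_function_sum test_function_mult f) auto
  have D: "(\<theta> has_derivative (\<lambda>b. (1 / 2) * (\<Sum>i\<in>UNIV. \<psi> x $ i * frechet_derivative (\<lambda>y. \<psi> y $ i) (at x) b
      + frechet_derivative (\<lambda>y. \<psi> y $ i) (at x) b * \<psi> x $ i))) (at x)" for x
    unfolding \<theta>_def
    by (intro has_derivative_mult_right has_derivative_sum has_derivative_mult test_function_has_derivative[OF f])
  have D\<theta>: "frechet_derivative \<theta> (at x) (axis j 1) = (\<Sum>i\<in>UNIV. \<psi> x $ i * field_grad \<psi> x $ i $ j)" for x j
    unfolding frechet_derivative_at[OF D, symmetric] field_grad_def
    by (simp add: sum_distrib_left mult.commute flip: mult_2)
  have vH: "v \<in> H1 \<Omega>" "v \<in> L2 \<Omega>" using v by (auto intro: H10_H1 H1_L2)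
  note G = wgrad_L2[OF vH(1)]
  have i1: "integrable (lebesgue_on \<Omega>) (\<lambda>x. v x $ j * frechet_derivative \<theta> (at x) (axis j 1))" for j
    by (intro integrable_mult_test[OF op] L2_component vH test_function_derivative \<theta> axis_real_in_Basis)
  have i2: "integrable (lebesgue_on \<Omega>) (\<lambda>x. wgrad \<Omega> v x $ j $ j * \<theta> x)" for j
    by (intro integrable_mult_test[OF op] L2_component G \<theta>)
  have "trilinear_b \<Omega> v \<psi> \<psi> = integral\<^sup>L (lebesgue_on \<Omega>) (\<lambda>x. (field_grad \<psi> x *v v x) \<bullet> \<psi> x)"
    by (intro AE_trilinear_b_cong card v H10_test_field[OF op bd] H1_test_field[OF op bd]
        field_grad_L2[OF op] wgrad_test_field[OF op bd] \<psi>)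
  also have "(\<lambda>x. (field_grad \<psi> x *v v x) \<bullet> \<psi> x) = (\<lambda>x. \<Sum>j\<in>UNIV. v x $ j * frechet_derivative \<theta> (at x) (axis j 1))"
  proof
    fix x
    have "(field_grad \<psi> x *v v x) \<bullet> \<psi> x = (\<Sum>i\<in>UNIV. \<Sum>j\<in>UNIV. field_grad \<psi> x $ i $ j * v x $ j * \<psi> x $ i)"
      by (simp add: inner_vec_def matrix_vector_mult_def sum_distrib_right)
    also have "\<dots> = (\<Sum>j\<in>UNIV. \<Sum>i\<in>UNIV. field_grad \<psi> x $ i $ j * v x $ j * \<psi> x $ i)" by (rule sum.swap)
    also have "\<dots> = (\<Sum>j\<in>UNIV. v x $ j * frechet_derivative \<theta> (at x) (axis j 1))"
      unfolding D\<theta> by (simp add: sum_distrib_left mult_ac)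
    finally show "(field_grad \<psi> x *v v x) \<bullet> \<psi> x = (\<Sum>j\<in>UNIV. v x $ j * frechet_derivative \<theta> (at x) (axis j 1))" .
  qed
  also have "integral\<^sup>L (lebesgue_on \<Omega>) \<dots> = (\<Sum>j\<in>UNIV. - integral\<^sup>L (lebesgue_on \<Omega>) (\<lambda>x. wgrad \<Omega> v x $ j $ j * \<theta> x))"
    using i1 is_weak_grad_wgrad[OF vH(1)] \<theta> unfolding is_weak_grad_def by simp
  also have "\<dots> = - integral\<^sup>L (lebesgue_on \<Omega>) (\<lambda>x. \<Sum>j\<in>UNIV. wgrad \<Omega> v x $ j $ j * \<theta> x)"
    using i2 by (simp add: sum_negf)
  also have "integral\<^sup>L (lebesgue_on \<Omega>) (\<lambda>x. \<Sum>j\<in>UNIV. wgrad \<Omega> v x $ j $ j * \<theta> x) = 0"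
    using v(2) unfolding divergence_free_def
    by (intro integral_eq_zero_AE) (auto elim!: eventually_mono simp flip: sum_distrib_right)
  finally show ?thesis by simp
qed

text \<open>Density of test fields carries the vanishing of b(v, \<psi>, \<psi>) over to H10. An
  inequality is enough, since replacing v by - v gives the opposite sign.\<close>

lemma trilinear_b_nonpos:
  assumes card: "CARD('q) \<in> {2, 3}" and "C\<^sub>\<Omega> > 0"
    and bound: "\<And>u v w. u \<in> H10 \<Omega> \<Longrightarrow> v \<in> H10 \<Omega> \<Longrightarrow> w \<in> H10 \<Omega> \<Longrightarrow>
           trilinear_b \<Omega> u v w
           \<le> C\<^sub>\<Omega> * sqrt (l2_norm \<Omega> u * l2_norm \<Omega> (wgrad \<Omega> u))
               * l2_norm \<Omega> (wgrad \<Omega> v) * l2_norm \<Omega> (wgrad \<Omega> w)"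
    and v: "v \<in> H10 \<Omega>" "divergence_free \<Omega> v" and w: "w \<in> H10 \<Omega>"
  shows "trilinear_b \<Omega> v w w \<le> 0"
proof (rule field_le_epsilon)
  fix e :: real assume e: "e > 0"
  define S where "S = C\<^sub>\<Omega> * sqrt (l2_norm \<Omega> v * l2_norm \<Omega> (wgrad \<Omega> v))"
  have S: "S \<ge> 0" unfolding S_def using \<open>C\<^sub>\<Omega> > 0\<close> by (simp add: l2_norm_nonneg)
  \<comment> \<open>The three error terms below add up to at most S (2 h + 1) \<epsilon>, where h is
    the H1 norm of w and one of two factors \<epsilon> has been bounded by 1; \<epsilon> is then
    chosen to make this at most e.\<close>
  define B where "B = 2 * h1_norm \<Omega> w + 1"
  have B: "B > 0" unfolding B_def using h1_norm_nonneg[of \<Omega> w] by simp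
  define \<epsilon> where "\<epsilon> = min 1 (e / (S * B + 1))"
  have SB: "S * B + 1 > 0" using S B by (simp add: add_nonneg_pos)
  then have \<epsilon>: "\<epsilon> > 0" "\<epsilon> \<le> 1" "\<epsilon> \<le> e / (S * B + 1)" using e by (auto simp: \<epsilon>_def)
  obtain \<psi> where \<psi>: "test_field \<Omega> \<psi>" "h1_norm \<Omega> (\<lambda>x. w x - \<psi> x) < \<epsilon>"
    using H10_approx[OF w \<epsilon>(1)] by blast
  define z where "z x = w x - \<psi> x" for x
  have \<psi>H: "\<psi> \<in> H10 \<Omega>" by (rule H10_test_field[OF op bd \<psi>(1)])
  have z: "z \<in> H10 \<Omega>" unfolding z_def by (rule H10_diff[OF op bd w \<psi>H])
  have H1: "\<psi> \<in> H1 \<Omega>" "z \<in> H1 \<Omega>" "w \<in> H1 \<Omega>" using \<psi>H z w by (auto intro: H10_H1)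
  have mz: "(\<lambda>x. - z x) \<in> H10 \<Omega>" using H10_scaleR[OF op bd z, of "-1"] by simp
  let ?n = "\<lambda>u. l2_norm \<Omega> (wgrad \<Omega> u)"
  have nz: "?n z \<le> \<epsilon>" "?n (\<lambda>x. - z x) \<le> \<epsilon>" "?n w \<le> h1_norm \<Omega> w"
    using l2_norm_wgrad_le_h1_norm[of \<Omega> z] \<psi>(2) l2_norm_wgrad_scaleR[OF op bd H1(2), of "-1"]
      l2_norm_wgrad_le_h1_norm[of \<Omega> w]
    unfolding z_def by auto
  have eqs: "w = (\<lambda>x. \<psi> x + z x)" "\<psi> = (\<lambda>x. w x + - z x)" by (auto simp: z_def)
  have "trilinear_b \<Omega> v w w = trilinear_b \<Omega> v \<psi> w + trilinear_b \<Omega> v z w"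
    using trilinear_b_add_mid[OF card v(1) H1(1,2) w] eqs(1) by simp
  also have "trilinear_b \<Omega> v \<psi> w = trilinear_b \<Omega> v \<psi> \<psi> + trilinear_b \<Omega> v \<psi> z"
    using trilinear_b_add_right[OF card v(1) H1(1) \<psi>H z] eqs(1) by simp
  also have "trilinear_b \<Omega> v \<psi> \<psi> = 0" by (rule trilinear_b_test_field_eq_0[OF card v \<psi>(1)])
  \<comment> \<open>Here \<psi> is replaced by w - z, so that the bound on b involves only w and z
    and no norm of \<psi>.\<close>
  also have "trilinear_b \<Omega> v \<psi> z = trilinear_b \<Omega> v w z + trilinear_b \<Omega> v (\<lambda>x. - z x) z"
    using trilinear_b_add_mid[OF card v(1) H1(3) H10_H1[OF mz] z] eqs(2) by simp
  also have "0 + (trilinear_b \<Omega> v w z + trilinear_b \<Omega> v (\<lambda>x. - z x) z) + trilinear_b \<Omega> v z w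
      \<le> S * ?n w * ?n z + S * ?n (\<lambda>x. - z x) * ?n z + S * ?n z * ?n w"
    using bound[OF v(1) w z] bound[OF v(1) mz z] bound[OF v(1) z w] unfolding S_def by linarith
  also have "\<dots> \<le> S * h1_norm \<Omega> w * \<epsilon> + S * 1 * \<epsilon> + S * \<epsilon> * h1_norm \<Omega> w"
    using nz S \<epsilon> by (intro add_mono mult_mono mult_left_mono mult_nonneg_nonneg l2_norm_nonneg h1_norm_nonneg) auto
  also have "\<dots> = (S * B) * \<epsilon>" by (simp add: B_def algebra_simps)
  also have "\<dots> \<le> (S * B + 1) * \<epsilon>" using \<epsilon> by (intro mult_right_mono) auto
  also have "\<dots> \<le> e" using \<epsilon>(3) SB by (simp add: field_simps)
  finally show "trilinear_b \<Omega> v w w \<le> 0 + e" by simp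
qed

end

section \<open>The error estimate\<close>

text \<open>Since \<kappa>_j multiplies the current value, each step divides by 1 - \<kappa>_j. The
  identity 1 / (1 - \<kappa>_j) = 1 + \<kappa>_j / (1 - \<kappa>_j) bounds this factor by an
  exponential, and the exponentials multiply.\<close>

lemma discrete_gronwall:
  fixes x g s \<kappa> :: "nat \<Rightarrow> real"
  assumes x0: "x 0 = 0"
    and step: "\<And>j. j \<in> {1..M} \<Longrightarrow> x j - x (j - 1) + g j \<le> \<kappa> j * x j + s j"
    and g: "\<And>j. j \<in> {1..M} \<Longrightarrow> 0 \<le> g j" and s: "\<And>j. j \<in> {1..M} \<Longrightarrow> 0 \<le> s j"
    and \<kappa>: "\<And>j. j \<in> {1..M} \<Longrightarrow> 0 \<le> \<kappa> j \<and> \<kappa> j < 1"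
    and "n \<le> M"
  shows "x n + (\<Sum>j=1..n. g j) \<le> exp (\<Sum>j=1..n. \<kappa> j / (1 - \<kappa> j)) * (\<Sum>j=1..n. s j)"
  using \<open>n \<le> M\<close>
proof (induction n)
  case 0
  then show ?case by (simp add: x0)
next
  case (Suc n)
  define k where "k = \<kappa> (Suc n)"
  define E where "E = exp (\<Sum>j=1..n. \<kappa> j / (1 - \<kappa> j))"
  have n: "Suc n \<in> {1..M}" using Suc.prems by simp
  have k: "0 \<le> k" "k < 1" using \<kappa>[OF n] by (auto simp: k_def)
  have gn: "0 \<le> g (Suc n)" and sn: "0 \<le> s (Suc n)" using g[OF n] s[OF n] by auto
  have G: "0 \<le> (\<Sum>j=1..n. g j)" using Suc.prems by (intro sum_nonneg g) auto
  have S: "0 \<le> (\<Sum>j=1..n. s j)" using Suc.prems by (intro sum_nonneg s) auto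
  have E1: "1 \<le> E" unfolding E_def
    using Suc.prems \<kappa> by (auto intro!: sum_nonneg divide_nonneg_nonneg simp: less_imp_le)
  have ke: "1 \<le> exp (k / (1 - k)) * (1 - k)"
  proof -
    have "1 + k / (1 - k) \<le> exp (k / (1 - k))" by (rule exp_ge_add_one_self)
    then have "(1 + k / (1 - k)) * (1 - k) \<le> exp (k / (1 - k)) * (1 - k)"
      using k by (intro mult_right_mono) auto
    then show ?thesis using k by (simp add: field_simps)
  qed
  \<comment> \<open>Multiplying the nonnegative sum of g by 1 - k \<le> 1 only decreases it, so the
    whole left-hand side is carried through the induction with one common factor.\<close>
  have "(1 - k) * (x (Suc n) + (\<Sum>j=1..Suc n. g j)) \<le> (1 - k) * x (Suc n) + (\<Sum>j=1..Suc n. g j)"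
    using k G gn mult_right_mono[of "1 - k" 1 "\<Sum>j=1..Suc n. g j"] by (simp add: distrib_left)
  also have "\<dots> \<le> x n + (\<Sum>j=1..n. g j) + s (Suc n)"
    using step[OF n] by (simp add: k_def algebra_simps)
  also have "\<dots> \<le> E * (\<Sum>j=1..n. s j) + s (Suc n)"
    using Suc.IH Suc.prems by (simp add: E_def)
  also have "\<dots> \<le> E * (\<Sum>j=1..Suc n. s j)"
    using E1 sn mult_right_mono[of 1 E "s (Suc n)"] by (simp add: distrib_left)
  finally have *: "(1 - k) * (x (Suc n) + (\<Sum>j=1..Suc n. g j)) \<le> E * (\<Sum>j=1..Suc n. s j)" .
  also have "\<dots> \<le> (exp (k / (1 - k)) * (1 - k)) * (E * (\<Sum>j=1..Suc n. s j))"
    using mult_right_mono[OF ke, of "E * (\<Sum>j=1..Suc n. s j)"] E1 S sn by simp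
  also have "\<dots> = (1 - k) * (E * exp (k / (1 - k)) * (\<Sum>j=1..Suc n. s j))" by simp
  finally have "x (Suc n) + (\<Sum>j=1..Suc n. g j) \<le> E * exp (k / (1 - k)) * (\<Sum>j=1..Suc n. s j)"
    using k by (simp only: mult_le_cancel_left_pos diff_gt_0_iff_gt)
  also have "E * exp (k / (1 - k)) = exp (\<Sum>j=1..Suc n. \<kappa> j / (1 - \<kappa> j))"
    by (simp add: E_def k_def exp_add)
  finally show ?case .
qed

text \<open>Young's inequality with exponents \<open>4/3\<close> and \<open>4\<close>, reduced to
  \<open>3 a\<^sup>4 + b\<^sup>4 - 4 a\<^sup>3 b = (a - b)\<^sup>2 (3 a\<^sup>2 + 2 a b + b\<^sup>2)\<close> with \<open>a = sqrt x\<close> and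
  \<open>b = 3 R c p sqrt y / 2\<close>.\<close>

lemma young_convection:
  fixes R c x y p :: real
  assumes "R > 0" "c \<ge> 0" "x \<ge> 0" "y \<ge> 0" "p \<ge> 0"
  shows "c * sqrt (y * x) * p * x \<le> x\<^sup>2 / (2 * R) + 27 * R ^ 3 * c ^ 4 / 32 * p ^ 4 * y\<^sup>2"
proof -
  define a t b where "a = sqrt x" and "t = c * p * sqrt y" and "b = 3 / 2 * R * t"
  have ab: "a \<ge> 0" "b \<ge> 0" using assms by (auto simp: a_def b_def t_def)
  have "3 * a ^ 4 + b ^ 4 - 4 * a ^ 3 * b = (a - b)\<^sup>2 * (3 * a\<^sup>2 + 2 * a * b + b\<^sup>2)"
    by (simp add: power2_eq_square power3_eq_cube power4_eq_xxxx algebra_simps)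
  also have "\<dots> \<ge> 0" using ab by simp
  \<comment> \<open>Division by 6 R turns 3 a^4 into a^4 / (2 R), half of the viscous term, and
    (3/2)^4 / 6 = 27/32 is the origin of the constant.\<close>
  finally have "(4 * a ^ 3 * b) / (6 * R) \<le> (3 * a ^ 4 + b ^ 4) / (6 * R)"
    using assms(1) by (intro divide_right_mono) auto
  moreover have "(4 * a ^ 3 * b) / (6 * R) = a ^ 3 * t" using assms(1) by (simp add: b_def)
  moreover have "(3 * a ^ 4 + b ^ 4) / (6 * R) = a ^ 4 / (2 * R) + 27 * R ^ 3 / 32 * t ^ 4"
    using assms(1) by (simp add: b_def power_mult_distrib field_simps power4_eq_xxxx power3_eq_cube)
  ultimately have "a ^ 3 * t \<le> a ^ 4 / (2 * R) + 27 * R ^ 3 / 32 * t ^ 4" by simp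
  moreover have "a ^ 3 * t = c * sqrt (y * x) * p * x"
  proof -
    have "a ^ 3 = a\<^sup>2 * a" by (simp add: power2_eq_square power3_eq_cube)
    then show ?thesis using assms by (simp add: a_def t_def real_sqrt_mult mult_ac)
  qed
  moreover have "a ^ 4 = x\<^sup>2"
  proof -
    have "a ^ 4 = (a\<^sup>2)\<^sup>2" by simp
    then show ?thesis using assms by (simp only: a_def real_sqrt_pow2)
  qed
  moreover have "t ^ 4 = c ^ 4 * p ^ 4 * y\<^sup>2"
  proof -
    have "t ^ 4 = c ^ 4 * p ^ 4 * ((sqrt y)\<^sup>2)\<^sup>2" by (simp add: t_def power_mult_distrib)
    then show ?thesis using assms by (simp only: real_sqrt_pow2)
  qed
  ultimately show ?thesis by (simp add: mult_ac)
qed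

section \<open>Coordinates in the reduced spaces\<close>

lemma rom_field_diff: "rom_field \<phi> r a x - rom_field \<phi> r b x = rom_field \<phi> r (\<lambda>i. a i - b i) x"
  by (simp add: rom_field_def sum_subtractf scaleR_diff_left)

lemma scaleR_rom_field: "c *\<^sub>R rom_field \<phi> r a x = rom_field \<phi> r (\<lambda>i. c * a i) x"
  by (simp add: rom_field_def scaleR_sum_right)

lemma rom_field_cong: "(\<And>i. i \<in> {1..r} \<Longrightarrow> a i = b i) \<Longrightarrow> rom_field \<phi> r a = rom_field \<phi> r b"
  unfolding rom_field_def by (intro ext sum.cong) auto

text \<open>Integrability against each basis function is assumed instead of
  \<open>F \<in> L2 \<Omega>\<close>, because F will also be \<open>tau_fom\<close>, whose
  convective terms need not be square integrable.\<close>

lemma l2_inner_rom_field_right: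
  assumes "\<And>i. i \<in> {1..r} \<Longrightarrow> integrable (lebesgue_on \<Omega>) (\<lambda>x. F x \<bullet> \<phi> i x)"
  shows "l2_inner \<Omega> F (rom_field \<phi> r b) = (\<Sum>i=1..r. b i * l2_inner \<Omega> F (\<phi> i))"
  using assms by (simp add: l2_inner_def rom_field_def inner_sum_right)

context
  fixes \<Omega> :: "(real ^ 'q) set" and \<phi> :: "nat \<Rightarrow> real ^ 'q \<Rightarrow> real ^ 'q" and r :: nat
  assumes op: "open \<Omega>" and bd: "bounded \<Omega>"
    and \<phi>: "\<And>i. i \<in> {1..r} \<Longrightarrow> \<phi> i \<in> H10 \<Omega>"
begin

lemma rom_field_H10: "rom_field \<phi> r a \<in> H10 \<Omega>"
  unfolding rom_field_def by (intro H10_sum[OF op bd] H10_scaleR[OF op bd] \<phi>) auto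

lemma rom_field_L2: "rom_field \<phi> r a \<in> L2 \<Omega>"
  using rom_field_H10 by (intro H1_L2 H10_H1)

lemma divergence_free_rom_field:
  assumes "\<And>i. i \<in> {1..r} \<Longrightarrow> divergence_free \<Omega> (\<phi> i)"
  shows "divergence_free \<Omega> (rom_field \<phi> r a)"
  unfolding rom_field_def
  using assms \<phi> by (intro divergence_free_sum[OF op bd] conjI H10_scaleR[OF op bd]
      divergence_free_scaleR[OF op bd] H10_H1) auto

context
  assumes orth: "\<And>i j. i \<in> {1..r} \<Longrightarrow> j \<in> {1..r} \<Longrightarrow> l2_inner \<Omega> (\<phi> i) (\<phi> j) = (if i = j then 1 else 0)"
begin

lemma l2_inner_rom_field_basis:
  assumes "i \<in> {1..r}" shows "l2_inner \<Omega> (rom_field \<phi> r a) (\<phi> i) = a i"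
proof -
  have "l2_inner \<Omega> (rom_field \<phi> r a) (\<phi> i) = (\<Sum>j=1..r. l2_inner \<Omega> (\<lambda>x. a j *\<^sub>R \<phi> j x) (\<phi> i))"
    unfolding rom_field_def using assms
    by (intro l2_inner_sum_left L2_scaleR H1_L2 H10_H1 \<phi>) auto
  also have "\<dots> = (\<Sum>j=1..r. if j = i then a j else 0)"
    using assms by (intro sum.cong) (auto simp: l2_inner_scaleR_left orth)
  finally show ?thesis using assms by simp
qed

lemma l2_inner_rom_field:
  "l2_inner \<Omega> (rom_field \<phi> r a) (rom_field \<phi> r b) = (\<Sum>i=1..r. a i * b i)"
proof -
  have "l2_inner \<Omega> (rom_field \<phi> r a) (rom_field \<phi> r b) = (\<Sum>i=1..r. b i * l2_inner \<Omega> (rom_field \<phi> r a) (\<phi> i))"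
    by (intro l2_inner_rom_field_right L2_inner_integrable rom_field_L2 H1_L2 H10_H1 \<phi>)
  also have "\<dots> = (\<Sum>i=1..r. a i * b i)"
    by (intro sum.cong) (auto simp: l2_inner_rom_field_basis mult.commute)
  finally show ?thesis .
qed

lemma rom_coeffs_rom_field:
  assumes "i \<in> {1..r}" shows "rom_coeffs \<phi> r (rom_field \<phi> r a) i = a i"
proof -
  \<comment> \<open>\<open>rom_coeffs\<close> requires the entries outside \<open>{1..r}\<close> to
    vanish, so the candidate is a cut off to that range. It is unique because the remaining entries
    are recovered by pairing with the basis.\<close>
  let ?a = "\<lambda>i. if i \<in> {1..r} then a i else 0"
  have "rom_coeffs \<phi> r (rom_field \<phi> r a) = ?a"
    unfolding rom_coeffs_def
  proof (rule the_equality)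
    show "(\<forall>i. i \<notin> {1..r} \<longrightarrow> ?a i = 0) \<and> rom_field \<phi> r a = rom_field \<phi> r ?a"
      by (auto intro: rom_field_cong)
    fix a' assume a': "(\<forall>i. i \<notin> {1..r} \<longrightarrow> a' i = 0) \<and> rom_field \<phi> r a = rom_field \<phi> r a'"
    then have "a' i = a i" if "i \<in> {1..r}" for i
      using l2_inner_rom_field_basis[OF that] by metis
    then show "a' = ?a" using a' by auto
  qed
  then show ?thesis using assms by simp
qed

lemma tau_rom_rom_field: "tau_rom \<phi> r A (rom_field \<phi> r a) = rom_field \<phi> r (\<lambda>i. - mat_vec r A a i)"
  unfolding tau_rom_def mat_vec_def
  by (intro rom_field_cong) (simp add: rom_coeffs_rom_field)

end

end

lemma gronwall_coeff_nonneg: "Rey > 0 \<Longrightarrow> C\<^sub>\<Omega> > 0 \<Longrightarrow> 0 \<le> gronwall_coeff \<Omega> Rey C\<^sub>\<Omega> \<phi> ud r j"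
  by (simp add: gronwall_coeff_def l2_norm_nonneg)

section \<open>The discrete error equation and its energy estimate\<close>

context
  fixes \<Omega> :: "(real ^ 'q) set"
    and Rey dt C\<^sub>\<Omega> :: real
    and M d r :: nat
    and f \<phi> ud u :: "nat \<Rightarrow> real ^ 'q \<Rightarrow> real ^ 'q"
    and ad A :: "nat \<Rightarrow> nat \<Rightarrow> real"
  assumes card: "CARD('q) \<in> {2, 3}" and op: "open \<Omega>" and bd: "bounded \<Omega>"
    and Rey: "Rey > 0" and dt: "dt > 0" and C: "C\<^sub>\<Omega> > 0"
    and bound: "\<And>u v w. u \<in> H10 \<Omega> \<Longrightarrow> v \<in> H10 \<Omega> \<Longrightarrow> w \<in> H10 \<Omega> \<Longrightarrow>
           trilinear_b \<Omega> u v w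
           \<le> C\<^sub>\<Omega> * sqrt (l2_norm \<Omega> u * l2_norm \<Omega> (wgrad \<Omega> u))
               * l2_norm \<Omega> (wgrad \<Omega> v) * l2_norm \<Omega> (wgrad \<Omega> w)"
    and \<phi>d: "\<And>i. i \<in> {1..d} \<Longrightarrow> \<phi> i \<in> H10 \<Omega>"
    and divd: "\<And>i. i \<in> {1..d} \<Longrightarrow> divergence_free \<Omega> (\<phi> i)"
    and orthd: "\<And>i j. i \<in> {1..d} \<Longrightarrow> j \<in> {1..d} \<Longrightarrow>
           l2_inner \<Omega> (\<phi> i) (\<phi> j) = (if i = j then 1 else 0)"
    and truth: "truth_solution \<Omega> Rey dt M f \<phi> d ad ud"
    and r: "r \<le> d"
    and les: "filtered_equations \<Omega> Rey dt M f \<phi> ud r"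
    and rom: "dd_vms_rom \<Omega> Rey dt M f \<phi> ad ud r A u"
begin

text \<open>The forcing cancels when both equations are tested with the error. In the orthonormal
  basis all terms except diffusion and convection become finite sums of coefficients and are
  estimated entry by entry.\<close>

lemma error_energy_step:
  fixes n :: nat
  assumes n: "n \<in> {1..M}"
  defines "e \<equiv> \<lambda>n x. rom_proj \<Omega> \<phi> r (ud n) x - u n x"
  shows "(l2_norm \<Omega> (e n))\<^sup>2 - (l2_norm \<Omega> (e (n - 1)))\<^sup>2
      + dt * (inverse Rey * (l2_norm \<Omega> (wgrad \<Omega> (e n)))\<^sup>2)
    \<le> dt * gronwall_coeff \<Omega> Rey C\<^sub>\<Omega> \<phi> ud r n * (l2_norm \<Omega> (e n))\<^sup>2
      + dt * (inverse Rey * (closure_error \<Omega> \<phi> r (tau_rom \<phi> r A) (ud n))\<^sup>2)"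
proof -
  have \<phi>: "\<And>i. i \<in> {1..r} \<Longrightarrow> \<phi> i \<in> H10 \<Omega>"
    and div: "\<And>i. i \<in> {1..r} \<Longrightarrow> divergence_free \<Omega> (\<phi> i)"
    and orth: "\<And>i j. i \<in> {1..r} \<Longrightarrow> j \<in> {1..r} \<Longrightarrow> l2_inner \<Omega> (\<phi> i) (\<phi> j) = (if i = j then 1 else 0)"
    using \<phi>d divd orthd r by auto
  have H10: "rom_field \<phi> r a \<in> H10 \<Omega>" and L2: "rom_field \<phi> r a \<in> L2 \<Omega>" for a
    using rom_field_H10[OF op bd, of r \<phi>] rom_field_L2[OF op bd, of r \<phi>] \<phi> by blast+
  have ip: "l2_inner \<Omega> (rom_field \<phi> r a) (rom_field \<phi> r b) = (\<Sum>i=1..r. a i * b i)" for a b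
    by (rule l2_inner_rom_field[OF op bd \<phi> orth])
  have ipb: "l2_inner \<Omega> (rom_field \<phi> r a) (\<phi> i) = a i" if "i \<in> {1..r}" for a i
    by (rule l2_inner_rom_field_basis[OF op bd \<phi> orth that])
  have dfree: "divergence_free \<Omega> (rom_field \<phi> r a)" for a
    by (rule divergence_free_rom_field[OF op bd \<phi> div])
  have trom: "tau_rom \<phi> r A (rom_field \<phi> r a) = rom_field \<phi> r (\<lambda>i. - mat_vec r A a i)" for a
    by (rule tau_rom_rom_field[OF op bd \<phi> orth])
  have phys: "(\<Sum>i=1..r. a i * mat_vec r A a i) \<le> 0" for a
    using rom by (auto simp: dd_vms_rom_def is_arg_min_def physical_constraint_def)
  have sol: "\<And>m. m \<le> M \<Longrightarrow> u m \<in> rom_space \<phi> r"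
    and eq: "\<And>v. v \<in> rom_space \<phi> r \<Longrightarrow>
      navier_stokes_form \<Omega> Rey dt u n v + l2_inner \<Omega> (tau_rom \<phi> r A (u n)) v = l2_inner \<Omega> (f n) v"
    using rom n by (auto simp: dd_vms_rom_def rom_solution_def)
  have "\<forall>m. \<exists>b. m \<le> M \<longrightarrow> u m = rom_field \<phi> r b"
    using sol by (auto simp: rom_space_def)
  then obtain \<beta> where \<beta>: "\<And>m. m \<le> M \<Longrightarrow> u m = rom_field \<phi> r (\<beta> m)" by metis
  define \<alpha> where "\<alpha> m i = l2_inner \<Omega> (ud m) (\<phi> i)" for m i
  have P: "rom_proj \<Omega> \<phi> r (ud m) = rom_field \<phi> r (\<alpha> m)" for m
    by (simp add: rom_proj_def \<alpha>_def[abs_def])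
  define c where "c m i = \<alpha> m i - \<beta> m i" for m i
  have e: "e m = rom_field \<phi> r (c m)" if "m \<le> M" for m
    unfolding e_def P using that by (simp add: \<beta> rom_field_diff c_def[abs_def])
  have nM: "n \<le> M" "n - 1 \<le> M" using n by auto
  let ?P = "rom_field \<phi> r (\<alpha> n)" and ?u = "rom_field \<phi> r (\<beta> n)" and ?e = "rom_field \<phi> r (c n)"
  let ?N = "\<lambda>v. l2_norm \<Omega> (wgrad \<Omega> v)"
  define y where "y = l2_norm \<Omega> ?e"
  define X where "X = ?N ?e"
  define p where "p = ?N ?P"
  have nn: "0 \<le> y" "0 \<le> X" "0 \<le> p" by (simp_all add: y_def X_def p_def l2_norm_nonneg)
  have y2: "y\<^sup>2 = (\<Sum>i=1..r. c n i * c n i)" by (simp add: y_def l2_norm_power2 ip)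
  have split: "?P = (\<lambda>x. ?u x + ?e x)"
    by (rule ext) (simp add: c_def[abs_def] flip: rom_field_diff)
  have H1: "?P \<in> H1 \<Omega>" "?u \<in> H1 \<Omega>" "?e \<in> H1 \<Omega>" using H10 by (auto intro: H10_H1)

  let ?F = "tau_fom \<Omega> \<phi> r (ud n)"
  have udH: "ud n \<in> H10 \<Omega>"
    using truth nM(1) rom_field_H10[OF op bd \<phi>d] by (auto simp: truth_solution_def)
  have Fi: "integrable (lebesgue_on \<Omega>) (\<lambda>x. ?F x \<bullet> \<phi> i x)" if "i \<in> {1..r}" for i
    unfolding tau_fom_def P convect_def inner_diff_left
    using that by (intro Bochner_Integration.integrable_diff convect_inner_integrable[OF op bd card]
        wgrad_L2 H10_H1 H10 udH \<phi>)
  define t where "t i = l2_inner \<Omega> ?F (\<phi> i)" for i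
  have Fe: "l2_inner \<Omega> ?F ?e = (\<Sum>i=1..r. c n i * t i)"
    unfolding t_def by (rule l2_inner_rom_field_right[OF Fi])
  \<comment> \<open>These are the coordinates of the projected closure error; the plus sign arises
    because the ansatz has coefficients \<open>- mat_vec r A\<close>.\<close>
  define k where "k i = t i + mat_vec r A (\<alpha> n) i" for i
  have ki: "l2_inner \<Omega> (\<lambda>x. ?F x - tau_rom \<phi> r A ?P x) (\<phi> i) = k i" if i: "i \<in> {1..r}" for i
  proof -
    have "integrable (lebesgue_on \<Omega>) (\<lambda>x. tau_rom \<phi> r A ?P x \<bullet> \<phi> i x)"
      unfolding trom using i by (intro L2_inner_integrable L2 H1_L2 H10_H1 \<phi>)
    then have "l2_inner \<Omega> (\<lambda>x. ?F x - tau_rom \<phi> r A ?P x) (\<phi> i) = t i - l2_inner \<Omega> (tau_rom \<phi> r A ?P) (\<phi> i)"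
      unfolding l2_inner_def t_def inner_diff_left using Fi[OF i] by simp
    then show ?thesis using i by (simp add: trom ipb k_def)
  qed
  have cl: "(closure_error \<Omega> \<phi> r (tau_rom \<phi> r A) (ud n))\<^sup>2 = (\<Sum>i=1..r. (k i)\<^sup>2)"
  proof -
    have "rom_proj \<Omega> \<phi> r (\<lambda>x. ?F x - tau_rom \<phi> r A ?P x) = rom_field \<phi> r k"
      unfolding rom_proj_def by (rule rom_field_cong) (rule ki)
    then show ?thesis unfolding closure_error_def P l2_norm_power2 by (simp only: ip power2_eq_square)
  qed

  have quot: "(\<lambda>x. (rom_field \<phi> r a x - rom_field \<phi> r b x) /\<^sub>R dt) = rom_field \<phi> r (\<lambda>i. (a i - b i) / dt)" for a b
    by (rule ext) (simp add: rom_field_diff scaleR_rom_field divide_inverse mult.commute)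
  have "?e \<in> rom_space \<phi> r" by (simp add: rom_space_def)
  from les n this have "navier_stokes_form \<Omega> Rey dt (\<lambda>k. rom_proj \<Omega> \<phi> r (ud k)) n ?e
      + l2_inner \<Omega> ?F ?e = l2_inner \<Omega> (f n) ?e"
    by (auto simp: filtered_equations_def)
  also have "\<dots> = navier_stokes_form \<Omega> Rey dt u n ?e + l2_inner \<Omega> (tau_rom \<phi> r A (u n)) ?e"
    using eq[OF \<open>?e \<in> rom_space \<phi> r\<close>] by simp
  finally have bal:
    "(\<Sum>i=1..r. (\<alpha> n i - \<alpha> (n - 1) i) / dt * c n i) + inverse Rey * l2_inner \<Omega> (wgrad \<Omega> ?P) (wgrad \<Omega> ?e)
       + trilinear_b \<Omega> ?P ?P ?e + (\<Sum>i=1..r. c n i * t i)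
     = (\<Sum>i=1..r. (\<beta> n i - \<beta> (n - 1) i) / dt * c n i) + inverse Rey * l2_inner \<Omega> (wgrad \<Omega> ?u) (wgrad \<Omega> ?e)
       + trilinear_b \<Omega> ?u ?u ?e + (\<Sum>i=1..r. - mat_vec r A (\<beta> n) i * c n i)"
    unfolding navier_stokes_form_def P Fe \<beta>[OF nM(1)] \<beta>[OF nM(2)] quot ip trom trilinear_b_def .

  have time: "(\<Sum>i=1..r. (\<alpha> n i - \<alpha> (n - 1) i) / dt * c n i) - (\<Sum>i=1..r. (\<beta> n i - \<beta> (n - 1) i) / dt * c n i)
      \<ge> (y\<^sup>2 - (l2_norm \<Omega> (e (n - 1)))\<^sup>2) / (2 * dt)"
  proof -
    have "(y\<^sup>2 - (l2_norm \<Omega> (e (n - 1)))\<^sup>2) / (2 * dt)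
        = (\<Sum>i=1..r. (c n i * c n i - c (n - 1) i * c (n - 1) i) / (2 * dt))"
      unfolding y2 e[OF nM(2)] l2_norm_power2 ip
      by (simp add: sum_subtractf sum_divide_distrib diff_divide_distrib)
    also have "\<dots> \<le> (\<Sum>i=1..r. (\<alpha> n i - \<alpha> (n - 1) i) / dt * c n i - (\<beta> n i - \<beta> (n - 1) i) / dt * c n i)"
    proof (rule sum_mono)
      fix i
      \<comment> \<open>The two sides differ by the square of \<open>c n i - c (n - 1) i\<close>,
        the numerical dissipation of backward Euler.\<close>
      have "c n i * c n i - c (n - 1) i * c (n - 1) i \<le> 2 * ((c n i - c (n - 1) i) * c n i)"
        using zero_le_square[of "c n i - c (n - 1) i"] by (simp add: algebra_simps)
      then have "(c n i * c n i - c (n - 1) i * c (n - 1) i) / (2 * dt)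
          \<le> 2 * ((c n i - c (n - 1) i) * c n i) / (2 * dt)"
        using dt by (intro divide_right_mono) auto
      also have "\<dots> = (c n i - c (n - 1) i) * c n i / dt" by simp
      also have "\<dots> = (\<alpha> n i - \<alpha> (n - 1) i) / dt * c n i - (\<beta> n i - \<beta> (n - 1) i) / dt * c n i"
        by (simp add: c_def add_divide_distrib diff_divide_distrib algebra_simps)
      finally show "(c n i * c n i - c (n - 1) i * c (n - 1) i) / (2 * dt)
        \<le> (\<alpha> n i - \<alpha> (n - 1) i) / dt * c n i - (\<beta> n i - \<beta> (n - 1) i) / dt * c n i" .
    qed
    finally show ?thesis by (simp add: sum_subtractf)
  qed
  have diff: "l2_inner \<Omega> (wgrad \<Omega> ?P) (wgrad \<Omega> ?e) = l2_inner \<Omega> (wgrad \<Omega> ?u) (wgrad \<Omega> ?e) + X\<^sup>2"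
    using l2_inner_wgrad_add_left[OF op bd H1(2,3) wgrad_L2[OF H1(3)]] split by (simp add: X_def l2_norm_power2)
  have conv: "trilinear_b \<Omega> ?P ?P ?e - trilinear_b \<Omega> ?u ?u ?e \<ge> - (C\<^sub>\<Omega> * sqrt (y * X) * p * X)"
  proof -
    have "trilinear_b \<Omega> ?P ?P ?e = trilinear_b \<Omega> ?u ?P ?e + trilinear_b \<Omega> ?e ?P ?e"
      using trilinear_b_add_left[OF op bd card H10 H10 H1(1) H10, of "\<beta> n" "c n" "c n"] split by simp
    moreover have "trilinear_b \<Omega> ?u ?P ?e = trilinear_b \<Omega> ?u ?u ?e + trilinear_b \<Omega> ?u ?e ?e"
      using trilinear_b_add_mid[OF op bd card H10 H1(2,3) H10, of "\<beta> n" "c n"] split by simp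
    \<comment> \<open>\<open>trilinear_b_nonpos\<close> is applied to the negative of the reduced
      solution, which is again a divergence-free field of the reduced space.\<close>
    moreover have "0 \<le> trilinear_b \<Omega> ?u ?e ?e"
    proof -
      have m: "(\<lambda>x. - ?u x) = rom_field \<phi> r (\<lambda>i. - 1 * \<beta> n i)"
        by (rule ext) (simp add: rom_field_def sum_negf)
      have "trilinear_b \<Omega> (\<lambda>x. - ?u x) ?e ?e \<le> 0"
        unfolding m by (rule trilinear_b_nonpos[OF op bd card C bound H10 dfree H10])
      then show ?thesis by (simp add: trilinear_b_minus_left)
    qed
    \<comment> \<open>Since b is bounded only from above, the sign goes into the third argument,
      where it leaves the gradient norm unchanged.\<close>
    moreover have "- trilinear_b \<Omega> ?e ?P ?e \<le> C\<^sub>\<Omega> * sqrt (y * X) * p * X"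
    proof -
      have m: "(\<lambda>x. - ?e x) = (\<lambda>x. (-1) *\<^sub>R ?e x)" by simp
      have "trilinear_b \<Omega> ?e ?P (\<lambda>x. - ?e x) \<le> C\<^sub>\<Omega> * sqrt (y * X) * p * ?N (\<lambda>x. - ?e x)"
        unfolding y_def X_def p_def m by (intro bound H10 H10_scaleR[OF op bd])
      moreover have "?N (\<lambda>x. - ?e x) = X"
        unfolding m X_def using l2_norm_wgrad_scaleR[OF op bd H1(3), of "-1"] by simp
      ultimately show ?thesis by (simp add: trilinear_b_minus_right)
    qed
    ultimately show ?thesis by linarith
  qed
  have clos: "(\<Sum>i=1..r. - mat_vec r A (\<beta> n) i * c n i) - (\<Sum>i=1..r. c n i * t i)
      \<le> Rey / 2 * y\<^sup>2 + inverse Rey / 2 * (\<Sum>i=1..r. (k i)\<^sup>2)"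
  proof -
    have mv: "mat_vec r A (\<alpha> n) i - mat_vec r A (\<beta> n) i = mat_vec r A (c n) i" for i
      by (simp add: mat_vec_def c_def right_diff_distrib sum_subtractf)
    \<comment> \<open>As k = t + A \<alpha>, linearity of the ansatz gives - A \<beta> - t = A c - k
      with c = \<alpha> - \<beta>, and the physical constraint discards the quadratic form of A at
      c.\<close>
    have "(\<Sum>i=1..r. - mat_vec r A (\<beta> n) i * c n i) - (\<Sum>i=1..r. c n i * t i)
        = (\<Sum>i=1..r. c n i * mat_vec r A (c n) i - c n i * k i)"
      unfolding sum_subtractf[symmetric] mv[symmetric] k_def
      by (intro sum.cong) (auto simp: algebra_simps)
    also have "\<dots> \<le> (\<Sum>i=1..r. - (c n i * k i))" using phys[of "c n"] by (simp add: sum_subtractf sum_negf)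
    \<comment> \<open>The weight \<open>Rey\<close> in Young's inequality is chosen so that the
      closure error carries the same factor \<open>inverse Rey\<close> as the viscous term.\<close>
    also have "\<dots> \<le> (\<Sum>i=1..r. Rey / 2 * (c n i * c n i) + inverse Rey / 2 * (k i)\<^sup>2)"
    proof (rule sum_mono)
      fix i
      have "0 \<le> (Rey * c n i + k i)\<^sup>2 / (2 * Rey)" using Rey by simp
      also have "\<dots> = Rey / 2 * (c n i * c n i) + c n i * k i + inverse Rey / 2 * (k i)\<^sup>2"
        using Rey by (simp add: power2_eq_square field_simps)
      finally show "- (c n i * k i) \<le> Rey / 2 * (c n i * c n i) + inverse Rey / 2 * (k i)\<^sup>2" by simp
    qed
    finally show ?thesis by (simp add: y2 sum.distrib sum_distrib_left)
  qed
  have young: "C\<^sub>\<Omega> * sqrt (y * X) * p * X \<le> X\<^sup>2 / (2 * Rey) + 27 * Rey ^ 3 * C\<^sub>\<Omega> ^ 4 / 32 * p ^ 4 * y\<^sup>2"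
    by (rule young_convection) (use Rey C nn in auto)
  define S where "S = (\<Sum>i=1..r. (k i)\<^sup>2)"
  define G \<rho> Y where "G = 27 * Rey ^ 3 * C\<^sub>\<Omega> ^ 4" and "\<rho> = inverse Rey"
    and "Y = y\<^sup>2 - (l2_norm \<Omega> (e (n - 1)))\<^sup>2"
  have half: "X\<^sup>2 / (2 * Rey) = \<rho> / 2 * X\<^sup>2" using Rey by (simp add: \<rho>_def field_simps)
  have "Y / (2 * dt) + \<rho> * X\<^sup>2 \<le> \<rho> / 2 * X\<^sup>2 + G / 32 * p ^ 4 * y\<^sup>2 + Rey / 2 * y\<^sup>2 + \<rho> / 2 * S"
  proof -
    \<comment> \<open>The combination is proved for real variables, so that the sums and forms count
      as atoms. I is the diffusion of the reduced solution paired with the error, which cancels; J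
      is the viscous term of the error itself.\<close>
    have "\<tau> + J \<le> \<upsilon> + \<sigma>"
      if "a + (I + J) + b + m = a' + I + b' + m'" "\<tau> \<le> a - a'" "- \<kappa> \<le> b - b'" "m' - m \<le> \<sigma>" "\<kappa> \<le> \<upsilon>"
      for a a' b b' m m' I J \<kappa> \<tau> \<sigma> \<upsilon> :: real
      using that by linarith
    from this[OF bal[unfolded diff distrib_left] time conv clos young]
    show ?thesis unfolding half S_def[symmetric] G_def[symmetric] \<rho>_def[symmetric] Y_def[symmetric]
      by (simp only: add.assoc)
  qed
  \<comment> \<open>Of the two copies of the viscous term on the left, one cancels against the copy
    used for convection and one survives in the estimate.\<close>
  then have "2 * dt * (Y / (2 * dt) + \<rho> * X\<^sup>2)
      \<le> 2 * dt * (\<rho> / 2 * X\<^sup>2 + G / 32 * p ^ 4 * y\<^sup>2 + Rey / 2 * y\<^sup>2 + \<rho> / 2 * S)"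
    using dt by (intro mult_left_mono) auto
  moreover have "2 * dt * (Y / (2 * dt) + \<rho> * X\<^sup>2) = Y + 2 * (dt * (\<rho> * X\<^sup>2))"
    using dt by (simp add: distrib_left)
  moreover have "2 * dt * (\<rho> / 2 * X\<^sup>2 + G / 32 * p ^ 4 * y\<^sup>2 + Rey / 2 * y\<^sup>2 + \<rho> / 2 * S)
      = dt * (\<rho> * X\<^sup>2) + dt * (G / 16 * p ^ 4 + Rey) * y\<^sup>2 + dt * (\<rho> * S)"
    by (simp add: algebra_simps)
  ultimately have "Y + dt * (\<rho> * X\<^sup>2) \<le> dt * (G / 16 * p ^ 4 + Rey) * y\<^sup>2 + dt * (\<rho> * S)"
    by linarith
  then show ?thesis
    unfolding e[OF nM(1)] cl gronwall_coeff_def P y_def X_def p_def S_def G_def \<rho>_def Y_def .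
qed

lemma error_estimate:
  assumes small: "\<forall>j\<in>{1..M}. dt * gronwall_coeff \<Omega> Rey C\<^sub>\<Omega> \<phi> ud r j < 1" and n: "n \<in> {1..M}"
  defines "e \<equiv> \<lambda>n x. rom_proj \<Omega> \<phi> r (ud n) x - u n x"
    and "D \<equiv> gronwall_coeff \<Omega> Rey C\<^sub>\<Omega> \<phi> ud r"
  shows "(l2_norm \<Omega> (e n))\<^sup>2
      + dt * (\<Sum>j=1..n. inverse Rey * (l2_norm \<Omega> (wgrad \<Omega> (e j)))\<^sup>2)
    \<le> exp (dt * (\<Sum>j=1..n. D j / (1 - dt * D j)))
      * (dt * (\<Sum>j=1..n. inverse Rey * (closure_error \<Omega> \<phi> r (tau_rom \<phi> r A) (ud j))\<^sup>2))"
proof -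
  \<comment> \<open>The initial condition makes the error start at the zero function, so the
    Gronwall bound has no initial term.\<close>
  have "e 0 = (\<lambda>x. 0)" using rom by (simp add: e_def dd_vms_rom_def)
  then have e0: "(l2_norm \<Omega> (e 0))\<^sup>2 = 0" by (simp add: l2_norm_power2 l2_inner_def)
  have D: "0 \<le> D j" for j unfolding D_def by (rule gronwall_coeff_nonneg[OF Rey C])
  have "(l2_norm \<Omega> (e n))\<^sup>2 + (\<Sum>j=1..n. dt * (inverse Rey * (l2_norm \<Omega> (wgrad \<Omega> (e j)))\<^sup>2))
    \<le> exp (\<Sum>j=1..n. dt * D j / (1 - dt * D j))
      * (\<Sum>j=1..n. dt * (inverse Rey * (closure_error \<Omega> \<phi> r (tau_rom \<phi> r A) (ud j))\<^sup>2))"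
  proof (rule discrete_gronwall[where M = M and x = "\<lambda>n. (l2_norm \<Omega> (e n))\<^sup>2"])
    show "(l2_norm \<Omega> (e j))\<^sup>2 - (l2_norm \<Omega> (e (j - 1)))\<^sup>2 + dt * (inverse Rey * (l2_norm \<Omega> (wgrad \<Omega> (e j)))\<^sup>2)
      \<le> dt * D j * (l2_norm \<Omega> (e j))\<^sup>2 + dt * (inverse Rey * (closure_error \<Omega> \<phi> r (tau_rom \<phi> r A) (ud j))\<^sup>2)"
      if "j \<in> {1..M}" for j
      using error_energy_step[OF that] unfolding e_def D_def .
  qed (use e0 D dt Rey small n in \<open>auto simp: D_def\<close>)
  then show ?thesis by (simp add: sum_distrib_left)
qed

end

text \<open>Passing from a sum to a mean costs a factor n, which is at most M, and the exponent only
  grows when its nonnegative summands are extended up to M. The prefactor thereby becomes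
  independent of n.\<close>

lemma error_square_le_mean_closure_error:
  fixes D q :: "nat \<Rightarrow> real"
  assumes est: "E \<le> exp (dt * (\<Sum>j=1..n. D j / (1 - dt * D j))) * (dt * (\<Sum>j=1..n. inverse R * q j))"
    and "dt > 0" "R > 0" "n \<in> {1..M}" and D: "\<And>j. j \<in> {1..M} \<Longrightarrow> 0 \<le> D j \<and> dt * D j < 1"
    and q: "\<And>j. 0 \<le> q j"
  shows "E \<le> exp (dt * (\<Sum>j=1..M. D j / (1 - dt * D j))) * (dt * inverse R * real M) * (1 / real n * (\<Sum>j=1..n. q j))"
proof -
  have n: "real n > 0" "n \<le> M" using assms(4) by auto
  have Q: "0 \<le> (\<Sum>j=1..n. q j)" by (intro sum_nonneg q)
  have "dt * (\<Sum>j=1..n. inverse R * q j) = (dt * inverse R * real n) * (1 / real n * (\<Sum>j=1..n. q j))"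
    using n(1) unfolding sum_distrib_left[symmetric] by simp
  with est have "E \<le> exp (dt * (\<Sum>j=1..n. D j / (1 - dt * D j))) * (dt * inverse R * real n) * (1 / real n * (\<Sum>j=1..n. q j))"
    by (simp only: mult.assoc)
  also have "\<dots> \<le> exp (dt * (\<Sum>j=1..M. D j / (1 - dt * D j))) * (dt * inverse R * real M) * (1 / real n * (\<Sum>j=1..n. q j))"
  proof (rule mult_right_mono[OF mult_mono])
    have "(\<Sum>j=1..n. D j / (1 - dt * D j)) \<le> (\<Sum>j=1..M. D j / (1 - dt * D j))"
      using n D by (intro sum_mono2) (auto intro!: divide_nonneg_nonneg simp: less_imp_le)
    then show "exp (dt * (\<Sum>j=1..n. D j / (1 - dt * D j))) \<le> exp (dt * (\<Sum>j=1..M. D j / (1 - dt * D j)))"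
      using \<open>dt > 0\<close> by simp
    show "dt * inverse R * real n \<le> dt * inverse R * real M"
      using n \<open>dt > 0\<close> \<open>R > 0\<close> by (intro mult_left_mono) auto
  qed (use n Q \<open>dt > 0\<close> \<open>R > 0\<close> in auto)
  finally show ?thesis .
qed

theorem theorem5p2:
  fixes \<Omega> :: "(real ^ 'q) set"
    and Rey dt C\<^sub>\<Omega> :: real
    and M d :: nat
    and f \<phi> ud :: "nat \<Rightarrow> real ^ 'q \<Rightarrow> real ^ 'q"
    and ad :: "nat \<Rightarrow> nat \<Rightarrow> real"
  assumes "CARD('q) \<in> {2, 3}"
    and "open \<Omega>" and "bounded \<Omega>" and "C2_domain \<Omega>"
    and "Rey > 0" and "dt > 0" and "M > 0"
    and "C\<^sub>\<Omega> > 0"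
    and "\<And>u v w. u \<in> H10 \<Omega> \<Longrightarrow> v \<in> H10 \<Omega> \<Longrightarrow> w \<in> H10 \<Omega> \<Longrightarrow>
           trilinear_b \<Omega> u v w
           \<le> C\<^sub>\<Omega> * sqrt (l2_norm \<Omega> u * l2_norm \<Omega> (wgrad \<Omega> u))
               * l2_norm \<Omega> (wgrad \<Omega> v) * l2_norm \<Omega> (wgrad \<Omega> w)"
    and "\<And>i. i \<in> {1..d} \<Longrightarrow> \<phi> i \<in> H10 \<Omega>"
    and "\<And>i. i \<in> {1..d} \<Longrightarrow> divergence_free \<Omega> (\<phi> i)"
    and "\<And>i j. i \<in> {1..d} \<Longrightarrow> j \<in> {1..d} \<Longrightarrow>
           l2_inner \<Omega> (\<phi> i) (\<phi> j) = (if i = j then 1 else 0)"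
    and "truth_solution \<Omega> Rey dt M f \<phi> d ad ud"
  shows
    "(\<forall>r\<in>{1..d}. \<forall>A u.
        filtered_equations \<Omega> Rey dt M f \<phi> ud r \<longrightarrow>
        dd_vms_rom \<Omega> Rey dt M f \<phi> ad ud r A u \<longrightarrow>
        (\<forall>j\<in>{1..M}. dt * gronwall_coeff \<Omega> Rey C\<^sub>\<Omega> \<phi> ud r j < 1) \<longrightarrow>
        (let e = (\<lambda>n x. rom_proj \<Omega> \<phi> r (ud n) x - u n x);
             D = gronwall_coeff \<Omega> Rey C\<^sub>\<Omega> \<phi> ud r
         in \<forall>n\<in>{1..M}.
              (l2_norm \<Omega> (e n))\<^sup>2
                + dt * (\<Sum>j=1..n. inverse Rey * (l2_norm \<Omega> (wgrad \<Omega> (e j)))\<^sup>2)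
              \<le> exp (dt * (\<Sum>j=1..n. D j / (1 - dt * D j)))
                * (dt * (\<Sum>j=1..n. inverse Rey * (closure_error \<Omega> \<phi> r (tau_rom \<phi> r A) (ud j))\<^sup>2))))
     \<and>
     ((\<forall>r\<in>{1..d}. filtered_equations \<Omega> Rey dt M f \<phi> ud r \<and>
         (\<forall>j\<in>{1..M}. dt * gronwall_coeff \<Omega> Rey C\<^sub>\<Omega> \<phi> ud r j < 1)) \<longrightarrow>
      verifiable \<Omega> M \<phi> d ud
        (\<lambda>r \<tau> u. \<exists>A. \<tau> = tau_rom \<phi> r A \<and> dd_vms_rom \<Omega> Rey dt M f \<phi> ad ud r A u))"
proof (intro conjI ballI allI impI)
  fix r A u
  assume "r \<in> {1..d}" "filtered_equations \<Omega> Rey dt M f \<phi> ud r"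
    "dd_vms_rom \<Omega> Rey dt M f \<phi> ad ud r A u"
    "\<forall>j\<in>{1..M}. dt * gronwall_coeff \<Omega> Rey C\<^sub>\<Omega> \<phi> ud r j < 1"
  then show "let e = (\<lambda>n x. rom_proj \<Omega> \<phi> r (ud n) x - u n x);
             D = gronwall_coeff \<Omega> Rey C\<^sub>\<Omega> \<phi> ud r
         in \<forall>n\<in>{1..M}.
              (l2_norm \<Omega> (e n))\<^sup>2
                + dt * (\<Sum>j=1..n. inverse Rey * (l2_norm \<Omega> (wgrad \<Omega> (e j)))\<^sup>2)
              \<le> exp (dt * (\<Sum>j=1..n. D j / (1 - dt * D j)))
                * (dt * (\<Sum>j=1..n. inverse Rey * (closure_error \<Omega> \<phi> r (tau_rom \<phi> r A) (ud j))\<^sup>2))"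
    unfolding Let_def
    by (intro ballI error_estimate[OF assms(1-3,5,6,8-13)]) auto
next
  let ?D = "gronwall_coeff \<Omega> Rey C\<^sub>\<Omega> \<phi> ud"
  assume H: "\<forall>r\<in>{1..d}. filtered_equations \<Omega> Rey dt M f \<phi> ud r \<and>
         (\<forall>j\<in>{1..M}. dt * ?D r j < 1)"
  \<comment> \<open>The truth solution enters K r through \<open>gronwall_coeff\<close>, but neither
    the matrix nor the reduced solution does, so the constant can be fixed before them.\<close>
  define K where "K r = exp (dt * (\<Sum>j=1..M. ?D r j / (1 - dt * ?D r j))) * (dt * inverse Rey * real M)" for r
  have K0: "0 \<le> K r" for r using assms(5,6) by (simp add: K_def)
  show "verifiable \<Omega> M \<phi> d ud
        (\<lambda>r \<tau> u. \<exists>A. \<tau> = tau_rom \<phi> r A \<and> dd_vms_rom \<Omega> Rey dt M f \<phi> ad ud r A u)"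
    unfolding verifiable_def
  proof (intro exI[of _ "\<Sum>r=1..d. K r"] ballI allI impI)
    fix r \<tau> u n
    assume r: "r \<in> {1..d}" and n: "n \<in> {1..M}"
      and model: "\<exists>A. \<tau> = tau_rom \<phi> r A \<and> dd_vms_rom \<Omega> Rey dt M f \<phi> ad ud r A u"
    then obtain A where A: "\<tau> = tau_rom \<phi> r A" "dd_vms_rom \<Omega> Rey dt M f \<phi> ad ud r A u" by blast
    let ?E = "(l2_norm \<Omega> (\<lambda>x. rom_proj \<Omega> \<phi> r (ud n) x - u n x))\<^sup>2"
    let ?q = "\<lambda>j. (closure_error \<Omega> \<phi> r \<tau> (ud j))\<^sup>2"
    have rd: "r \<le> d" and les: "filtered_equations \<Omega> Rey dt M f \<phi> ud r"
      and small: "\<forall>j\<in>{1..M}. dt * ?D r j < 1"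
      using r H by auto
    \<comment> \<open>Verifiability concerns only the L2 norm, so the nonnegative gradient sum is
      given away.\<close>
    have "?E \<le> ?E + dt * (\<Sum>j=1..n. inverse Rey * (l2_norm \<Omega> (wgrad \<Omega> (\<lambda>x. rom_proj \<Omega> \<phi> r (ud j) x - u j x)))\<^sup>2)"
      using assms(5,6) by (simp add: sum_nonneg)
    also have "\<dots> \<le> exp (dt * (\<Sum>j=1..n. ?D r j / (1 - dt * ?D r j))) * (dt * (\<Sum>j=1..n. inverse Rey * ?q j))"
      unfolding A(1) by (rule error_estimate[OF assms(1-3,5,6,8-13) rd les A(2) small n])
    finally have "?E \<le> K r * (1 / real n * (\<Sum>j=1..n. ?q j))"
      unfolding K_def
      by (rule error_square_le_mean_closure_error)
        (use assms(5,6) n small gronwall_coeff_nonneg[OF assms(5,8)] in auto)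
    also have "\<dots> \<le> (\<Sum>r=1..d. K r) * (1 / real n * (\<Sum>j=1..n. ?q j))"
      using r K0 by (intro mult_right_mono member_le_sum) (auto intro!: divide_nonneg_nonneg sum_nonneg)
    finally show "?E \<le> (\<Sum>r=1..d. K r) * (1 / real n * (\<Sum>j=1..n. ?q j))" .
  qed
qed

end
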